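(* Let $(M,g)=(S_1,g_1)\times(S_2,g_2)$ be the Riemannian product of two scalene ellipsoids $S_1,S_2\subset\mathbb{R}^3$, each with the metric induced by $\mathbb{R}^3$. Then any nonempty open subset of $(M,g)$ satisfies the eigenflag condition (that is, the Weyl tensor satisfies it at every point) but does not admit any limiting Carleman weight.
   Context: An ellipsoid in $\mathbb{R}^3$ is scalene if its three axes have different lengths. Eigenflag condition: viewing the Weyl tensor at $q$ as a symmetric operator $W_q$ on $\Lambda^2T_qM$, $W_q$ satisfies the eigenflag condition if there is a nonzero $v\in T_qM$ with $W_q(v\wedge v^\perp)\subset v\wedge v^\perp$, where $v\wedge v^\perp=\{v\wedge w: w\perp v\}$. Limiting Carleman weight: a smooth function $\varphi:V\to\mathbb{R}$ on an open Riemannian manifold $(V,g)$ with nowhere vanishing gradient such that for every $q\in V$ and every $\xi\in T_qV$ with $g(\xi,\nabla\varphi)=0$ and $|\xi|_g=|\nabla\varphi|_g$ one has $\nabla^2\varphi(\nabla\varphi,\nabla\varphi)+\nabla^2\varphi(\xi,\xi)=0$. Equivalently, $d\varphi$ is nowhere zero and the gradient of $\varphi$ with respect to $\tilde g=|\nabla\varphi|_g^2\,g$ is a (unit) parallel vector field for $\tilde g$. *)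

theory Defs
  imports "HOL-Analysis.Analysis"
begin

section \<open>Smooth functions on open subsets of coordinate space\<close>

definition partial_deriv :: "'n::finite \<Rightarrow> (real^'n \<Rightarrow> 'b::real_normed_vector) \<Rightarrow> real^'n \<Rightarrow> 'b" where
  "partial_deriv i f p = frechet_derivative f (at p) (axis i 1)"

text \<open>Only meant for open \<open>U\<close>.\<close>

fun Ck_on :: "nat \<Rightarrow> (real^'n::finite) set \<Rightarrow> (real^'n \<Rightarrow> 'b::real_normed_vector) \<Rightarrow> bool" where
  "Ck_on 0 U f \<longleftrightarrow> continuous_on U f"
| "Ck_on (Suc k) U f \<longleftrightarrow>
     (\<forall>p\<in>U. f differentiable (at p)) \<and> (\<forall>i. Ck_on k U (partial_deriv i f))"

definition smooth_on :: "(real^'n::finite) set \<Rightarrow> (real^'n \<Rightarrow> 'b::real_normed_vector) \<Rightarrow> bool" where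
  "smooth_on U f \<longleftrightarrow> (\<forall>k. Ck_on k U f)"


section \<open>Tensors of a Riemannian metric in coordinates\<close>

text \<open>
  Throughout, \<open>G\<close> is the Gram matrix field \<open>p \<mapsto> (g\<^sub>i\<^sub>j(p))\<close> of a Riemannian metric in local
  coordinates, and tangent vectors are given by their components in the coordinate frame.
\<close>

type_synonym 'n metric_field = "real^'n \<Rightarrow> real^'n^'n"

definition g_inner :: "'n::finite metric_field \<Rightarrow> real^'n \<Rightarrow> real^'n \<Rightarrow> real^'n \<Rightarrow> real" where
  "g_inner G p v w = v \<bullet> (G p *v w)"

definition g_norm :: "'n::finite metric_field \<Rightarrow> real^'n \<Rightarrow> real^'n \<Rightarrow> real" where
  "g_norm G p v = sqrt (g_inner G p v v)"

definition g_inv :: "'n::finite metric_field \<Rightarrow> real^'n \<Rightarrow> 'n \<Rightarrow> 'n \<Rightarrow> real" where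
  "g_inv G p i j = matrix_inv (G p) $ i $ j"

text \<open>\<open>christoffel G k i j\<close> is \<open>\<Gamma>\<^sup>k\<^sub>i\<^sub>j\<close>.\<close>

definition christoffel :: "'n::finite metric_field \<Rightarrow> 'n \<Rightarrow> 'n \<Rightarrow> 'n \<Rightarrow> real^'n \<Rightarrow> real" where
  "christoffel G k i j p =
     (\<Sum>l\<in>UNIV. g_inv G p k l *
        (partial_deriv i (\<lambda>x. G x $ j $ l) p + partial_deriv j (\<lambda>x. G x $ i $ l) p
          - partial_deriv l (\<lambda>x. G x $ i $ j) p)) / 2"

text \<open>
  \<open>riem_up G p m i j l\<close> is the \<open>m\<close>-th component of
  \<open>R(\<partial>\<^sub>i,\<partial>\<^sub>j)\<partial>\<^sub>l = \<nabla>\<^sub>i\<nabla>\<^sub>j\<partial>\<^sub>l - \<nabla>\<^sub>j\<nabla>\<^sub>i\<partial>\<^sub>l\<close>, and \<open>riem G p i j k l = g(R(\<partial>\<^sub>i,\<partial>\<^sub>j)\<partial>\<^sub>l, \<partial>\<^sub>k)\<close>, so that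
  the unit round sphere has \<open>R\<^sub>i\<^sub>j\<^sub>k\<^sub>l = g\<^sub>i\<^sub>k g\<^sub>j\<^sub>l - g\<^sub>i\<^sub>l g\<^sub>j\<^sub>k\<close>.
\<close>

definition riem_up :: "'n::finite metric_field \<Rightarrow> real^'n \<Rightarrow> 'n \<Rightarrow> 'n \<Rightarrow> 'n \<Rightarrow> 'n \<Rightarrow> real" where
  "riem_up G p m i j l =
     partial_deriv i (christoffel G m j l) p - partial_deriv j (christoffel G m i l) p
     + (\<Sum>s\<in>UNIV. christoffel G m i s p * christoffel G s j l p
                 - christoffel G m j s p * christoffel G s i l p)"

definition riem :: "'n::finite metric_field \<Rightarrow> real^'n \<Rightarrow> 'n \<Rightarrow> 'n \<Rightarrow> 'n \<Rightarrow> 'n \<Rightarrow> real" where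
  "riem G p i j k l = (\<Sum>m\<in>UNIV. G p $ k $ m * riem_up G p m i j l)"

definition ricci :: "'n::finite metric_field \<Rightarrow> real^'n \<Rightarrow> 'n \<Rightarrow> 'n \<Rightarrow> real" where
  "ricci G p j l = (\<Sum>i\<in>UNIV. \<Sum>k\<in>UNIV. g_inv G p i k * riem G p i j k l)"

definition scal :: "'n::finite metric_field \<Rightarrow> real^'n \<Rightarrow> real" where
  "scal G p = (\<Sum>j\<in>UNIV. \<Sum>l\<in>UNIV. g_inv G p j l * ricci G p j l)"

text \<open>Only meaningful in dimension \<open>CARD('n) \<ge> 3\<close>.\<close>

definition weyl :: "'n::finite metric_field \<Rightarrow> real^'n \<Rightarrow> 'n \<Rightarrow> 'n \<Rightarrow> 'n \<Rightarrow> 'n \<Rightarrow> real" where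
  "weyl G p i j k l =
     (let n = real CARD('n); g = (\<lambda>i j. G p $ i $ j); Ric = ricci G p in
      riem G p i j k l
      - (Ric i k * g j l - Ric i l * g j k + g i k * Ric j l - g i l * Ric j k) / (n - 2)
      + scal G p / ((n - 1) * (n - 2)) * (g i k * g j l - g i l * g j k))"

text \<open>
  Bivectors at \<open>p\<close> are represented by their antisymmetric component matrices \<open>B\<^sup>i\<^sup>j\<close>.  The inner
  product of \<open>\<Lambda>\<^sup>2\<close> with \<open>\<langle>a \<and> b, c \<and> d\<rangle> = g(a,c) g(b,d) - g(a,d) g(b,c)\<close> is used to view the
  Weyl tensor as the operator with \<open>\<langle>W(a \<and> b), c \<and> d\<rangle> = W(a,b,c,d)\<close>; the factor \<open>1/2\<close> below
  compensates for summing over ordered instead of unordered pairs \<open>k, l\<close>.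
\<close>

definition wedge :: "real^'n::finite \<Rightarrow> real^'n \<Rightarrow> real^'n^'n" where
  "wedge v w = (\<chi> i j. v $ i * w $ j - v $ j * w $ i)"

definition weyl_operator :: "'n::finite metric_field \<Rightarrow> real^'n \<Rightarrow> real^'n^'n \<Rightarrow> real^'n^'n" where
  "weyl_operator G p B =
     (\<chi> i j. (\<Sum>a\<in>UNIV. \<Sum>b\<in>UNIV. \<Sum>k\<in>UNIV. \<Sum>l\<in>UNIV.
        g_inv G p i a * g_inv G p j b * weyl G p a b k l * B $ k $ l) / 2)"

definition wedge_perp :: "'n::finite metric_field \<Rightarrow> real^'n \<Rightarrow> real^'n \<Rightarrow> (real^'n^'n) set" where
  "wedge_perp G p v = {wedge v w | w. g_inner G p v w = 0}"

definition eigenflag_at :: "'n::finite metric_field \<Rightarrow> real^'n \<Rightarrow> bool" where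
  "eigenflag_at G p \<longleftrightarrow>
     (\<exists>v. v \<noteq> 0 \<and> weyl_operator G p ` wedge_perp G p v \<subseteq> wedge_perp G p v)"

definition gradient :: "'n::finite metric_field \<Rightarrow> (real^'n \<Rightarrow> real) \<Rightarrow> real^'n \<Rightarrow> real^'n" where
  "gradient G f p = (\<chi> i. \<Sum>j\<in>UNIV. g_inv G p i j * partial_deriv j f p)"

definition hessian ::
  "'n::finite metric_field \<Rightarrow> (real^'n \<Rightarrow> real) \<Rightarrow> real^'n \<Rightarrow> real^'n \<Rightarrow> real^'n \<Rightarrow> real" where
  "hessian G f p v w =
     (\<Sum>i\<in>UNIV. \<Sum>j\<in>UNIV.
        (partial_deriv i (partial_deriv j f) p
          - (\<Sum>k\<in>UNIV. christoffel G k i j p * partial_deriv k f p)) * v $ i * w $ j)"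

definition carleman_at :: "'n::finite metric_field \<Rightarrow> (real^'n \<Rightarrow> real) \<Rightarrow> real^'n \<Rightarrow> bool" where
  "carleman_at G f p \<longleftrightarrow>
     (let X = gradient G f p in
      X \<noteq> 0 \<and>
      (\<forall>\<xi>. g_inner G p \<xi> X = 0 \<and> g_norm G p \<xi> = g_norm G p X \<longrightarrow>
           hessian G f p X X + hessian G f p \<xi> \<xi> = 0))"


section \<open>Embedded manifolds with a Riemannian metric\<close>

text \<open>
  A manifold is a subset \<open>M\<close> of a Euclidean space \<open>'a\<close>, and \<open>T\<^sub>xM\<close> is a subspace of \<open>'a\<close>.
  A metric is given by \<open>g x v w\<close>, of which only the values for \<open>x \<in> M\<close> and \<open>v, w \<in> T\<^sub>xM\<close> matter.
  Charts are described by their inverses, i.e. by local parametrizations \<open>\<psi> : U \<rightarrow> M\<close> on open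
  sets \<open>U \<subseteq> \<real>\<^sup>n\<close>.
\<close>

type_synonym 'a riem_metric = "'a \<Rightarrow> 'a \<Rightarrow> 'a \<Rightarrow> real"

definition local_param ::
  "'a::euclidean_space set \<Rightarrow> (real^'n::finite) set \<Rightarrow> (real^'n \<Rightarrow> 'a) \<Rightarrow> bool" where
  "local_param M U \<psi> \<longleftrightarrow>
     open U \<and> smooth_on U \<psi> \<and> (\<forall>p\<in>U. inj (frechet_derivative \<psi> (at p))) \<and>
     (\<exists>\<theta>. homeomorphism U (\<psi> ` U) \<psi> \<theta>) \<and> openin (top_of_set M) (\<psi> ` U)"

definition pullback_metric ::
  "'a::euclidean_space riem_metric \<Rightarrow> (real^'n::finite \<Rightarrow> 'a) \<Rightarrow> 'n metric_field" where
  "pullback_metric g \<psi> p = (\<chi> i j. g (\<psi> p) (partial_deriv i \<psi> p) (partial_deriv j \<psi> p))"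

definition induced_metric :: "'a::euclidean_space riem_metric" where
  "induced_metric x v w = v \<bullet> w"

definition product_metric ::
  "'a::euclidean_space riem_metric \<Rightarrow> 'b::euclidean_space riem_metric \<Rightarrow> ('a \<times> 'b) riem_metric" where
  "product_metric g1 g2 x v w = g1 (fst x) (fst v) (fst w) + g2 (snd x) (snd v) (snd w)"

text \<open>
  The argument \<open>TYPE('n)\<close> fixes the dimension \<open>CARD('n)\<close> of \<open>M\<close>.  The pointwise conditions are
  independent of the coordinates; they are required in all coordinates around each point.
  The first conjunct below excludes that this holds vacuously for want of coordinates.
\<close>

definition eigenflag_condition ::
  "'n::finite itself \<Rightarrow> 'a::euclidean_space set \<Rightarrow> 'a riem_metric \<Rightarrow> bool" where
  "eigenflag_condition _ M g \<longleftrightarrow>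
     (\<forall>q\<in>M.
        (\<exists>U (\<psi> :: real^'n \<Rightarrow> 'a). local_param M U \<psi> \<and> q \<in> \<psi> ` U) \<and>
        (\<forall>U (\<psi> :: real^'n \<Rightarrow> 'a) p. local_param M U \<psi> \<and> p \<in> U \<and> \<psi> p = q \<longrightarrow>
           eigenflag_at (pullback_metric g \<psi>) p))"

definition limiting_carleman_weight ::
  "'n::finite itself \<Rightarrow> 'a::euclidean_space set \<Rightarrow> 'a riem_metric \<Rightarrow> ('a \<Rightarrow> real) \<Rightarrow> bool" where
  "limiting_carleman_weight _ M g \<phi> \<longleftrightarrow>
     (\<forall>U (\<psi> :: real^'n \<Rightarrow> 'a). local_param M U \<psi> \<longrightarrow>
        smooth_on U (\<phi> \<circ> \<psi>) \<and>
        (\<forall>p\<in>U. carleman_at (pullback_metric g \<psi>) (\<phi> \<circ> \<psi>) p))"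


section \<open>Ellipsoids\<close>

text \<open>Center \<open>c\<close>, axes in the directions \<open>T (axis i 1)\<close>, semi-axes \<open>a $ i\<close>.\<close>

definition ellipsoid :: "real^3 \<Rightarrow> (real^3 \<Rightarrow> real^3) \<Rightarrow> real^3 \<Rightarrow> (real^3) set" where
  "ellipsoid c T a = {c + T y | y. (\<Sum>i\<in>UNIV. (y $ i / a $ i)\<^sup>2) = 1}"

definition scalene_ellipsoid :: "(real^3) set \<Rightarrow> bool" where
  "scalene_ellipsoid S \<longleftrightarrow>
     (\<exists>c T a. orthogonal_transformation T \<and> (\<forall>i. a $ i > 0) \<and>
        (\<forall>i j. i \<noteq> j \<longrightarrow> a $ i \<noteq> a $ j) \<and> S = ellipsoid c T a)"

end

theory Submission
  imports Defs
begin

text \<open>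
  Straightening both ellipsoids to \<open>\<Sum> a\<^sub>i x\<^sub>i\<^sup>2 = 1\<close> turns any chart of the product into an isometric immersion
  \<open>(\<psi>1, \<psi>2)\<close> into \<open>\<real>\<^sup>3 \<times> \<real>\<^sup>3\<close>, and the Gauss equation, valid in every chart, expresses the curvature by the
  Gauss curvatures \<open>K1, K2 > 0\<close> of the factors.  The Weyl operator maps \<open>v \<and> w\<close> to
  \<open>v \<and> (K1 + K2) (w1 / 3 - w2 / 6)\<close> for \<open>v\<close> tangent to the first factor and \<open>w = (w1, w2) \<perp> v\<close>, so any such \<open>v\<close>
  is an eigenflag direction.

  For a limiting Carleman weight with gradient \<open>X\<close>, polarization of the defining condition shows that the
  Hessian is \<open>X\<^sub>i \<theta>\<^sub>j + \<theta>\<^sub>i X\<^sub>j - \<langle>\<theta>, X\<rangle> g\<^sub>i\<^sub>j\<close>.  If both components of \<open>X\<close> were nonzero somewhere, four instances of the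
  Ricci identity would give \<open>K1 + K2 = 0\<close>.  Hence locally the weight depends on one factor only; then
  \<open>X / |X|\<^sup>2\<close> is a Killing field of that ellipsoid, and its rotation \<open>\<alpha>\<close> by a right angle satisfies \<open>\<nabla>\<alpha> = - \<kappa> g\<close>.
  This forces \<open>d\<kappa> = K \<alpha>\<close>, hence \<open>dK\<close> and \<open>d|\<nabla>K|\<^sup>2\<close> are multiples of \<open>\<alpha>\<close>.  Here \<open>K\<close> is a function of \<open>m\<^sub>2\<close> and the
  dependence of the two differentials reads \<open>x\<^sub>1 x\<^sub>2 x\<^sub>3 ((a\<^sub>1 + a\<^sub>2 + a\<^sub>3) m\<^sub>2 - 2 m\<^sub>3) = 0\<close> with \<open>m\<^sub>k = \<Sum> a\<^sub>i\<^sup>k x\<^sub>i\<^sup>2\<close>, which fails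
  on every open subset unless the \<open>a\<^sub>i\<close> coincide.
\<close>

section \<open>Directional derivatives and smooth functions\<close>

text \<open>A chart of the product need not split into charts of the factors, so each ellipsoid is
  studied on \<open>U\<close> in \<real>^4 through a map that is a submersion onto the surface.
  Extrinsic geometry suits this: Christoffel symbols become tangential parts of second derivatives,
  and most identities below arise by differentiating an identity that holds on an open set. The
  Ricci instances yield \<open>K1 + K2 = 0\<close> because their weight-dependent terms separate
  into one depending only on \<open>v\<close> and one depending only on \<open>u\<close>; two
  choices of each suffice to eliminate them. The field X / |X|^2 is Killing because \<theta> = d log
  |X| and, once X lies in one factor, the Hessian is X \<theta> + \<theta> X: differentiating the
  quotient turns this into the skew form (X \<theta> - \<theta> X) / |X|^2. The last polynomial is a
  generalized Vandermonde determinant with exponents 0, 1, 3, whose quotient by the ordinary one is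
  \<open>a1 + a2 + a3\<close>.\<close>

definition dir_deriv :: "real^'n::finite \<Rightarrow> (real^'n \<Rightarrow> 'b::real_normed_vector) \<Rightarrow> real^'n \<Rightarrow> 'b" where
  "dir_deriv v f p = frechet_derivative f (at p) v"

lemma partial_deriv_eq_dir_deriv: "partial_deriv i f = dir_deriv (axis i 1) f"
  by (simp add: fun_eq_iff partial_deriv_def dir_deriv_def)

lemma dir_deriv_unique:
  assumes "(f has_derivative f') (at p)"
  shows "dir_deriv v f p = f' v"
  using frechet_derivative_at[OF assms] by (simp add: dir_deriv_def)

lemma has_derivative_dir_deriv:
  assumes "f differentiable (at p)"
  shows "(f has_derivative (\<lambda>v. dir_deriv v f p)) (at p)"
  using assms unfolding dir_deriv_def by (simp add: frechet_derivative_works)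

lemma linear_dir_deriv:
  assumes "f differentiable (at p)"
  shows "linear (\<lambda>v. dir_deriv v f p)"
  using has_derivative_dir_deriv[OF assms] has_derivative_linear by blast

text \<open>This is what permits differentiating an identity valid on \<open>U\<close>. The choice
  behind \<open>frechet_derivative\<close> sees only which linear maps are derivatives, and these
  agree for functions that coincide near \<open>p\<close>.\<close>

lemma dir_deriv_cong_open:
  assumes "open U" "p \<in> U" and eq: "\<And>x. x \<in> U \<Longrightarrow> f x = g x"
  shows "dir_deriv v f p = dir_deriv v g p"
proof -
  have "(f has_derivative f') (at p) \<longleftrightarrow> (g has_derivative f') (at p)" for f'
    using has_derivative_transform_within_open[OF _ assms(1,2)] eq by metis
  then show ?thesis by (simp add: dir_deriv_def frechet_derivative_def)
qed

lemma differentiable_cong_open: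
  assumes "open U" "p \<in> U" and eq: "\<And>x. x \<in> U \<Longrightarrow> f x = g x"
    and "f differentiable (at p)"
  shows "g differentiable (at p)"
  using assms has_derivative_transform_within_open unfolding differentiable_def by metis

lemma dir_deriv_expand:
  assumes "f differentiable (at p)"
  shows "dir_deriv v f p = (\<Sum>i\<in>UNIV. v $ i *\<^sub>R partial_deriv i f p)"
proof -
  interpret linear "\<lambda>v. dir_deriv v f p" by (rule linear_dir_deriv[OF assms])
  have "dir_deriv v f p = dir_deriv (\<Sum>i\<in>UNIV. v $ i *\<^sub>R axis i 1) f p"
    by (simp add: basis_expansion[of v, unfolded scalar_mult_eq_scaleR])
  also have "\<dots> = (\<Sum>i\<in>UNIV. v $ i *\<^sub>R partial_deriv i f p)"
    by (simp add: sum scale partial_deriv_eq_dir_deriv)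
  finally show ?thesis .
qed

lemma dir_deriv_const [simp]: "dir_deriv v (\<lambda>x. c) p = 0"
  by (simp add: dir_deriv_def)

lemma dir_deriv_bounded_linear:
  assumes "bounded_linear L" "f differentiable (at p)"
  shows "dir_deriv v (\<lambda>x. L (f x)) p = L (dir_deriv v f p)"
  by (rule dir_deriv_unique[OF bounded_linear.has_derivative[OF assms(1) has_derivative_dir_deriv[OF assms(2)]]])

lemma dir_deriv_bilinear:
  assumes "bounded_bilinear h" "f differentiable (at p)" "g differentiable (at p)"
  shows "dir_deriv v (\<lambda>x. h (f x) (g x)) p = h (f p) (dir_deriv v g p) + h (dir_deriv v f p) (g p)"
  by (rule dir_deriv_unique[OF bounded_bilinear.FDERIV[OF assms(1) has_derivative_dir_deriv[OF assms(2)]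
        has_derivative_dir_deriv[OF assms(3)]]])

lemma dir_deriv_add:
  assumes "f differentiable (at p)" "g differentiable (at p)"
  shows "dir_deriv v (\<lambda>x. f x + g x) p = dir_deriv v f p + dir_deriv v g p"
  by (rule dir_deriv_unique[OF has_derivative_add[OF has_derivative_dir_deriv[OF assms(1)]
        has_derivative_dir_deriv[OF assms(2)]]])

lemma dir_deriv_inverse:
  fixes f :: "real^'n::finite \<Rightarrow> real"
  assumes "f differentiable (at p)" "f p \<noteq> 0"
  shows "dir_deriv v (\<lambda>x. inverse (f x)) p = - (dir_deriv v f p * (inverse (f p) * inverse (f p)))"
  using dir_deriv_unique[OF Deriv.has_derivative_inverse[OF assms(2) has_derivative_dir_deriv[OF assms(1)]], of v]
  by (simp add: algebra_simps)

lemma dir_deriv_sqrt: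
  fixes f :: "real^'n::finite \<Rightarrow> real"
  assumes "f differentiable (at p)" "f p > 0"
  shows "dir_deriv v (\<lambda>x. sqrt (f x)) p = dir_deriv v f p * (inverse (sqrt (f p)) / 2)"
  using dir_deriv_unique[OF DERIV_compose_FDERIV[OF DERIV_real_sqrt[OF assms(2)] has_derivative_dir_deriv[OF assms(1)]], of v]
  by (simp add: field_simps)

section \<open>Closure properties of smooth functions on an open set\<close>

lemma Ck_on_cong:
  assumes "open U" "\<And>x. x \<in> U \<Longrightarrow> f x = g x"
  shows "Ck_on k U f \<longleftrightarrow> Ck_on k U g"
  using assms(2)
proof (induction k arbitrary: f g)
  case 0
  then show ?case by (simp cong: continuous_on_cong)
next
  case (Suc k)
  have "Ck_on k U (partial_deriv i f) \<longleftrightarrow> Ck_on k U (partial_deriv i g)" for i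
    by (rule Suc.IH) (simp add: partial_deriv_eq_dir_deriv dir_deriv_cong_open[OF \<open>open U\<close> _ Suc.prems])
  moreover have "f differentiable (at p) \<longleftrightarrow> g differentiable (at p)" if "p \<in> U" for p
    using differentiable_cong_open[OF \<open>open U\<close> that, of f g] differentiable_cong_open[OF \<open>open U\<close> that, of g f]
      Suc.prems by auto
  ultimately show ?case by auto
qed

text \<open>The recursion mentions only differentiability and the partial derivatives. The product
  rule leaves one factor undifferentiated, so it needs the lower order as well.\<close>

lemma Ck_on_SucD: "Ck_on (Suc k) U f \<Longrightarrow> Ck_on k U f"
proof (induction k arbitrary: f)
  case 0
  then show ?case
    by (auto intro!: continuous_at_imp_continuous_on simp: differentiable_imp_continuous_within)
next
  case (Suc k)
  have "Ck_on k U (partial_deriv i f)" for i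
    using Suc.IH Suc.prems by (metis Ck_on.simps(2))
  then show ?case using Suc.prems by (metis Ck_on.simps(2))
qed

lemma Ck_on_const: "Ck_on k U (\<lambda>x. c)"
  by (induction k arbitrary: c) (simp_all add: partial_deriv_def[abs_def])

lemma Ck_on_add:
  assumes "open U" "Ck_on k U f" "Ck_on k U g"
  shows "Ck_on k U (\<lambda>x. f x + g x)"
  using assms(2,3)
proof (induction k arbitrary: f g)
  case 0
  then show ?case by (auto intro: continuous_intros)
next
  case (Suc k)
  have "Ck_on k U (partial_deriv i (\<lambda>x. f x + g x)) \<longleftrightarrow> Ck_on k U (\<lambda>x. partial_deriv i f x + partial_deriv i g x)" for i
    by (rule Ck_on_cong[OF \<open>open U\<close>]) (use Suc.prems in \<open>simp add: partial_deriv_eq_dir_deriv dir_deriv_add\<close>)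
  with Suc show ?case by simp
qed

lemma Ck_on_bounded_linear:
  assumes "open U" "bounded_linear L" "Ck_on k U f"
  shows "Ck_on k U (\<lambda>x. L (f x))"
  using assms(3)
proof (induction k arbitrary: f)
  case 0
  then show ?case using assms(2) by (auto intro: bounded_linear.continuous_on)
next
  case (Suc k)
  have "Ck_on k U (partial_deriv i (\<lambda>x. L (f x))) \<longleftrightarrow> Ck_on k U (\<lambda>x. L (partial_deriv i f x))" for i
    by (rule Ck_on_cong[OF \<open>open U\<close>])
      (use Suc.prems in \<open>simp add: partial_deriv_eq_dir_deriv dir_deriv_bounded_linear[OF assms(2)]\<close>)
  moreover have "(\<lambda>x. L (f x)) differentiable (at p)" if "p \<in> U" for p
    by (rule differentiableI, rule bounded_linear.has_derivative[OF assms(2) has_derivative_dir_deriv])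
      (use Suc.prems that in auto)
  ultimately show ?case using Suc by simp
qed

lemma Ck_on_bilinear:
  assumes "open U" "bounded_bilinear h" "Ck_on k U f" "Ck_on k U g"
  shows "Ck_on k U (\<lambda>x. h (f x) (g x))"
  using assms(3,4)
proof (induction k arbitrary: f g)
  case 0
  then show ?case using assms(2) by (auto intro: bounded_bilinear.continuous_on)
next
  case (Suc k)
  have "Ck_on k U (partial_deriv i (\<lambda>x. h (f x) (g x))) \<longleftrightarrow>
      Ck_on k U (\<lambda>x. h (f x) (partial_deriv i g x) + h (partial_deriv i f x) (g x))" for i
    by (rule Ck_on_cong[OF \<open>open U\<close>])
      (use Suc.prems in \<open>simp add: partial_deriv_eq_dir_deriv dir_deriv_bilinear[OF assms(2)]\<close>)
  moreover have "Ck_on k U f" "Ck_on k U g" using Suc.prems Ck_on_SucD by blast+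
  moreover have "(\<lambda>x. h (f x) (g x)) differentiable (at p)" if "p \<in> U" for p
    by (rule differentiableI, rule bounded_bilinear.FDERIV[OF assms(2) has_derivative_dir_deriv has_derivative_dir_deriv])
      (use Suc.prems that in auto)
  ultimately show ?case using Suc by (simp add: Ck_on_add[OF \<open>open U\<close>])
qed

text \<open>The derivative of 1/f is built from f' and 1/f, and 1/f itself is of class
  \<open>k\<close> by the induction hypothesis; the square root below works in the same way.\<close>

lemma Ck_on_inverse:
  fixes f :: "real^'n::finite \<Rightarrow> real"
  assumes "open U" "Ck_on k U f" "\<And>x. x \<in> U \<Longrightarrow> f x \<noteq> 0"
  shows "Ck_on k U (\<lambda>x. inverse (f x))"
  using assms(2)
proof (induction k)
  case 0
  then show ?case using assms(3) by (auto intro: continuous_intros)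
next
  case (Suc k)
  have "Ck_on k U (partial_deriv i (\<lambda>x. inverse (f x))) \<longleftrightarrow>
      Ck_on k U (\<lambda>x. - (partial_deriv i f x * (inverse (f x) * inverse (f x))))" for i
    by (rule Ck_on_cong[OF \<open>open U\<close>])
      (use Suc.prems in \<open>simp add: partial_deriv_eq_dir_deriv dir_deriv_inverse assms(3)\<close>)
  moreover have "Ck_on k U (\<lambda>x. inverse (f x))" using Suc Ck_on_SucD by blast
  ultimately show ?case using Suc.prems assms(1,3)
    by (auto intro!: Ck_on_bilinear[OF _ bounded_bilinear_mult] Ck_on_bounded_linear[OF _ bounded_linear_minus[OF bounded_linear_ident]]
        differentiable_inverse)
qed

lemma Ck_on_sqrt:
  fixes f :: "real^'n::finite \<Rightarrow> real"
  assumes "open U" "Ck_on k U f" "\<And>x. x \<in> U \<Longrightarrow> f x > 0"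
  shows "Ck_on k U (\<lambda>x. sqrt (f x))"
  using assms(2)
proof (induction k)
  case 0
  then show ?case by (auto intro: continuous_intros)
next
  case (Suc k)
  have "Ck_on k U (partial_deriv i (\<lambda>x. sqrt (f x))) \<longleftrightarrow>
      Ck_on k U (\<lambda>x. partial_deriv i f x * (inverse (sqrt (f x)) / 2))" for i
    by (rule Ck_on_cong[OF \<open>open U\<close>])
      (use Suc.prems in \<open>simp add: partial_deriv_eq_dir_deriv dir_deriv_sqrt assms(3)\<close>)
  moreover have "Ck_on k U (\<lambda>x. sqrt (f x))" using Suc Ck_on_SucD by blast
  then have "Ck_on k U (\<lambda>x. inverse (sqrt (f x)))"
    by (rule Ck_on_inverse[OF assms(1)]) (use assms(3) in force)
  moreover have "(\<lambda>x. sqrt (f x)) differentiable (at p)" if "p \<in> U" for p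
    by (rule differentiableI, rule DERIV_compose_FDERIV[of sqrt _ f, OF DERIV_real_sqrt[OF assms(3)[OF that]] has_derivative_dir_deriv])
      (use Suc.prems that in auto)
  ultimately show ?case using Suc.prems assms(1)
    by (auto intro!: Ck_on_bilinear[OF _ bounded_bilinear_mult] Ck_on_bounded_linear[OF _ bounded_linear_divide])
qed

lemma smooth_on_cong: "open U \<Longrightarrow> (\<And>x. x \<in> U \<Longrightarrow> f x = g x) \<Longrightarrow> smooth_on U f \<longleftrightarrow> smooth_on U g"
  unfolding smooth_on_def using Ck_on_cong by blast

lemma Ck_on_subset: "Ck_on k U f \<Longrightarrow> W \<subseteq> U \<Longrightarrow> Ck_on k W f"
  by (induction k arbitrary: f) (auto intro: continuous_on_subset)

lemma smooth_on_subset: "smooth_on U f \<Longrightarrow> W \<subseteq> U \<Longrightarrow> smooth_on W f"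
  unfolding smooth_on_def using Ck_on_subset by blast

lemma smooth_on_differentiable: "smooth_on U f \<Longrightarrow> p \<in> U \<Longrightarrow> f differentiable (at p)"
  unfolding smooth_on_def by (metis Ck_on.simps(2))

lemma dir_deriv_inner:
  fixes f g :: "real^'n::finite \<Rightarrow> 'b::real_inner"
  assumes "smooth_on U f" "smooth_on U g" "p \<in> U"
  shows "dir_deriv v (\<lambda>x. f x \<bullet> g x) p = f p \<bullet> dir_deriv v g p + dir_deriv v f p \<bullet> g p"
  by (rule dir_deriv_bilinear[OF bounded_bilinear_inner]) (use assms smooth_on_differentiable in blast)+

lemma smooth_on_continuous: "smooth_on U f \<Longrightarrow> continuous_on U f"
  unfolding smooth_on_def by (metis Ck_on.simps(1))

lemma smooth_on_partial_deriv: "smooth_on U f \<Longrightarrow> smooth_on U (partial_deriv i f)"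
  unfolding smooth_on_def by (metis Ck_on.simps(2))

lemma smooth_on_const: "smooth_on U (\<lambda>x. c)"
  by (simp add: smooth_on_def Ck_on_const)

context
  fixes U :: "(real^'n::finite) set"
  assumes U: "open U"
begin

lemma smooth_on_bounded_linear: "bounded_linear L \<Longrightarrow> smooth_on U f \<Longrightarrow> smooth_on U (\<lambda>x. L (f x))"
  by (simp add: smooth_on_def Ck_on_bounded_linear[OF U])

lemma smooth_on_bilinear:
  "bounded_bilinear h \<Longrightarrow> smooth_on U f \<Longrightarrow> smooth_on U g \<Longrightarrow> smooth_on U (\<lambda>x. h (f x) (g x))"
  by (simp add: smooth_on_def Ck_on_bilinear[OF U])

lemma smooth_on_add: "smooth_on U f \<Longrightarrow> smooth_on U g \<Longrightarrow> smooth_on U (\<lambda>x. f x + g x)"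
  by (simp add: smooth_on_def Ck_on_add[OF U])

lemma smooth_on_minus: "smooth_on U f \<Longrightarrow> smooth_on U (\<lambda>x. - f x)"
  by (rule smooth_on_bounded_linear[OF bounded_linear_minus[OF bounded_linear_ident]])

lemma smooth_on_diff: "smooth_on U f \<Longrightarrow> smooth_on U g \<Longrightarrow> smooth_on U (\<lambda>x. f x - g x)"
  using smooth_on_add[OF _ smooth_on_minus, of f g] by simp

lemma smooth_on_inner:
  fixes f g :: "_ \<Rightarrow> 'b::real_inner"
  shows "smooth_on U f \<Longrightarrow> smooth_on U g \<Longrightarrow> smooth_on U (\<lambda>x. f x \<bullet> g x)"
  by (rule smooth_on_bilinear[OF bounded_bilinear_inner])

lemma smooth_on_mult:
  fixes f g :: "_ \<Rightarrow> real"
  shows "smooth_on U f \<Longrightarrow> smooth_on U g \<Longrightarrow> smooth_on U (\<lambda>x. f x * g x)"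
  by (rule smooth_on_bilinear[OF bounded_bilinear_mult])

lemma smooth_on_scaleR: "smooth_on U f \<Longrightarrow> smooth_on U g \<Longrightarrow> smooth_on U (\<lambda>x. f x *\<^sub>R g x)"
  by (rule smooth_on_bilinear[OF bounded_bilinear_scaleR])

lemma smooth_on_inverse:
  fixes f :: "_ \<Rightarrow> real"
  shows "smooth_on U f \<Longrightarrow> (\<And>x. x \<in> U \<Longrightarrow> f x \<noteq> 0) \<Longrightarrow> smooth_on U (\<lambda>x. inverse (f x))"
  using Ck_on_inverse[OF U] by (auto simp: smooth_on_def)

lemma smooth_on_divide:
  fixes f g :: "_ \<Rightarrow> real"
  shows "smooth_on U f \<Longrightarrow> smooth_on U g \<Longrightarrow> (\<And>x. x \<in> U \<Longrightarrow> g x \<noteq> 0) \<Longrightarrow> smooth_on U (\<lambda>x. f x / g x)"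
  unfolding divide_inverse by (intro smooth_on_mult smooth_on_inverse)

lemma smooth_on_sqrt:
  fixes f :: "_ \<Rightarrow> real"
  shows "smooth_on U f \<Longrightarrow> (\<And>x. x \<in> U \<Longrightarrow> f x > 0) \<Longrightarrow> smooth_on U (\<lambda>x. sqrt (f x))"
  using Ck_on_sqrt[OF U] by (auto simp: smooth_on_def)

lemma smooth_on_sum: "(\<And>i. i \<in> I \<Longrightarrow> smooth_on U (f i)) \<Longrightarrow> smooth_on U (\<lambda>x. \<Sum>i\<in>I. f i x)"
  by (induction I rule: infinite_finite_induct) (auto intro: smooth_on_const smooth_on_add)

lemma smooth_on_prod:
  fixes f :: "_ \<Rightarrow> _ \<Rightarrow> real"
  shows "(\<And>i. i \<in> I \<Longrightarrow> smooth_on U (f i)) \<Longrightarrow> smooth_on U (\<lambda>x. \<Prod>i\<in>I. f i x)"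
  by (induction I rule: infinite_finite_induct) (auto intro: smooth_on_const smooth_on_mult)

lemma smooth_on_fst: "smooth_on U f \<Longrightarrow> smooth_on U (\<lambda>x. fst (f x))"
  by (rule smooth_on_bounded_linear[OF bounded_linear_fst])

lemma smooth_on_snd: "smooth_on U f \<Longrightarrow> smooth_on U (\<lambda>x. snd (f x))"
  by (rule smooth_on_bounded_linear[OF bounded_linear_snd])

lemma smooth_on_nth: "smooth_on U f \<Longrightarrow> smooth_on U (\<lambda>x. f x $ i)"
  by (rule smooth_on_bounded_linear[OF bounded_linear_vec_nth])

lemma smooth_on_Pair:
  fixes f :: "_ \<Rightarrow> 'b::real_normed_vector" and g :: "_ \<Rightarrow> 'c::real_normed_vector"
  assumes "smooth_on U f" "smooth_on U g"
  shows "smooth_on U (\<lambda>x. (f x, g x))"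
proof -
  have "smooth_on U (\<lambda>x. (f x, 0::'c) + (0::'b, g x))"
    using smooth_on_bounded_linear[OF bounded_linear_Pair[OF bounded_linear_ident bounded_linear_zero] assms(1)]
      smooth_on_bounded_linear[OF bounded_linear_Pair[OF bounded_linear_zero bounded_linear_ident] assms(2)]
    by (rule smooth_on_add)
  then show ?thesis by simp
qed

lemma smooth_on_cross: "smooth_on U f \<Longrightarrow> smooth_on U g \<Longrightarrow> smooth_on U (\<lambda>x. cross3 (f x) (g x))"
  by (rule smooth_on_bilinear[OF bilinear_conv_bounded_bilinear[THEN iffD1, OF bilinear_cross]])

lemma smooth_on_ident: "smooth_on U (\<lambda>x. x)"
proof -
  have "Ck_on k U (\<lambda>x. x)" for k
    by (cases k) (simp_all add: partial_deriv_def[abs_def] Ck_on_const)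
  then show ?thesis by (simp add: smooth_on_def)
qed

lemma smooth_on_dir_deriv:
  assumes "smooth_on U f"
  shows "smooth_on U (dir_deriv v f)"
proof -
  have "smooth_on U (\<lambda>x. \<Sum>i\<in>UNIV. v $ i *\<^sub>R partial_deriv i f x)"
    by (intro smooth_on_sum smooth_on_scaleR smooth_on_const smooth_on_partial_deriv assms)
  then show ?thesis
    by (subst smooth_on_cong[OF U]) (auto intro: dir_deriv_expand smooth_on_differentiable[OF assms])
qed

end

lemmas smooth_intros = smooth_on_const smooth_on_inner smooth_on_mult smooth_on_scaleR smooth_on_sum

section \<open>Symmetry of mixed directional derivatives\<close>

lemma dir_deriv_eq_DERIV_line:
  fixes f :: "real^'n::finite \<Rightarrow> real"
  assumes "f differentiable (at (a + s *\<^sub>R u))"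
  shows "((\<lambda>s. f (a + s *\<^sub>R u)) has_real_derivative dir_deriv u f (a + s *\<^sub>R u)) (at s)"
proof -
  have "((\<lambda>s. a + s *\<^sub>R u) has_derivative (\<lambda>h. h *\<^sub>R u)) (at s)"
    by (auto intro!: derivative_eq_intros)
  from diff_chain_at[OF this has_derivative_dir_deriv[OF assms]]
  have "((\<lambda>s. f (a + s *\<^sub>R u)) has_derivative (\<lambda>h. dir_deriv (h *\<^sub>R u) f (a + s *\<^sub>R u))) (at s)"
    by (simp add: o_def)
  moreover have "(\<lambda>h. dir_deriv (h *\<^sub>R u) f (a + s *\<^sub>R u)) = (*) (dir_deriv u f (a + s *\<^sub>R u))"
    using linear_scale[OF linear_dir_deriv[OF assms]] by (simp add: fun_eq_iff)
  ultimately show ?thesis by (simp add: has_field_derivative_def)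
qed

text \<open>The mean value theorem is applied twice: along \<open>u\<close> to the increment of
  \<open>f\<close> in direction \<open>h v\<close>, then along \<open>v\<close> to the resulting
  increment of \<open>dir_deriv u f\<close>. The second difference is symmetric in \<open>u\<close>
  and \<open>v\<close>, although the right hand side does not look so.\<close>

lemma second_difference_eq_dir_deriv:
  fixes f :: "real^'n::finite \<Rightarrow> real"
  assumes B: "ball p r \<subseteq> U" and sm: "smooth_on U f" and U: "open U"
    and h: "h > 0" "h * (norm u + norm v) < r"
  obtains y where "dist p y \<le> h * (norm u + norm v)"
    "f (p + h *\<^sub>R u + h *\<^sub>R v) - f (p + h *\<^sub>R u) - f (p + h *\<^sub>R v) + f p
      = h\<^sup>2 * dir_deriv v (dir_deriv u f) y"
proof -
  have near: "dist p (p + s *\<^sub>R u + t *\<^sub>R v) \<le> h * (norm u + norm v)"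
    if "0 \<le> s" "s \<le> h" "0 \<le> t" "t \<le> h" for s t
  proof -
    have "dist p (p + s *\<^sub>R u + t *\<^sub>R v) = norm (s *\<^sub>R u + t *\<^sub>R v)"
      by (metis (no_types, lifting) add.assoc add_diff_cancel_left' dist_commute dist_norm)
    also have "\<dots> \<le> s * norm u + t * norm v"
      using norm_triangle_ineq[of "s *\<^sub>R u" "t *\<^sub>R v"] that by simp
    also have "\<dots> \<le> h * norm u + h * norm v"
      using that by (intro add_mono mult_right_mono) auto
    finally show ?thesis by (simp add: algebra_simps)
  qed
  have inU: "p + s *\<^sub>R u + t *\<^sub>R v \<in> U" if "0 \<le> s" "s \<le> h" "0 \<le> t" "t \<le> h" for s t
    using near[OF that] h(2) B by force
  have d0: "f differentiable (at (p + s *\<^sub>R u + t *\<^sub>R v))"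
      and d1: "dir_deriv u f differentiable (at (p + s *\<^sub>R u + t *\<^sub>R v))"
      if "0 \<le> s" "s \<le> h" "0 \<le> t" "t \<le> h" for s t
    using inU[OF that] sm smooth_on_dir_deriv[OF U sm] smooth_on_differentiable by blast+
  define \<phi> where "\<phi> s = f (p + h *\<^sub>R v + s *\<^sub>R u) - f (p + s *\<^sub>R u)" for s
  have "(\<phi> has_real_derivative
      dir_deriv u f (p + h *\<^sub>R v + s *\<^sub>R u) - dir_deriv u f (p + s *\<^sub>R u)) (at s)"
    if "0 \<le> s" "s \<le> h" for s
    unfolding \<phi>_def
    by (intro DERIV_diff dir_deriv_eq_DERIV_line)
      (use d0[of s h] d0[of s 0] that h in \<open>simp_all add: algebra_simps\<close>)
  from MVT2[OF h(1) this] obtain s where s: "0 < s" "s < h"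
    and eq1: "\<phi> h - \<phi> 0 = h * (dir_deriv u f (p + h *\<^sub>R v + s *\<^sub>R u) - dir_deriv u f (p + s *\<^sub>R u))"
    by auto
  have "((\<lambda>t. dir_deriv u f (p + s *\<^sub>R u + t *\<^sub>R v)) has_real_derivative
      dir_deriv v (dir_deriv u f) (p + s *\<^sub>R u + t *\<^sub>R v)) (at t)" if "0 \<le> t" "t \<le> h" for t
    by (rule dir_deriv_eq_DERIV_line) (use d1[of s t] that s in auto)
  from MVT2[OF h(1) this] obtain t where t: "0 < t" "t < h"
    and eq2: "dir_deriv u f (p + s *\<^sub>R u + h *\<^sub>R v) - dir_deriv u f (p + s *\<^sub>R u)
      = h * dir_deriv v (dir_deriv u f) (p + s *\<^sub>R u + t *\<^sub>R v)"
    by auto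
  have "f (p + h *\<^sub>R u + h *\<^sub>R v) - f (p + h *\<^sub>R u) - f (p + h *\<^sub>R v) + f p = \<phi> h - \<phi> 0"
    by (simp add: \<phi>_def algebra_simps)
  also have "\<dots> = h\<^sup>2 * dir_deriv v (dir_deriv u f) (p + s *\<^sub>R u + t *\<^sub>R v)"
    using eq1 eq2 by (simp add: power2_eq_square algebra_simps)
  finally show thesis using that near[of s t] s t by simp
qed

text \<open>Reading the symmetric second difference in both orders yields points \<open>y\<close>
  and \<open>z\<close> near \<open>p\<close> at which the two mixed derivatives agree; by continuity
  they cannot differ at \<open>p\<close>.\<close>

lemma dir_deriv_commute_real:
  fixes f :: "real^'n::finite \<Rightarrow> real"
  assumes sm: "smooth_on U f" and U: "open U" and p: "p \<in> U"
  shows "dir_deriv u (dir_deriv v f) p = dir_deriv v (dir_deriv u f) p"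
proof (rule ccontr)
  assume ne: "\<not> ?thesis"
  let ?F = "dir_deriv u (dir_deriv v f)" and ?G = "dir_deriv v (dir_deriv u f)"
  define e where "e = \<bar>?F p - ?G p\<bar> / 2"
  have e: "e > 0" using ne by (simp add: e_def)
  have "isCont ?F p" "isCont ?G p"
    using smooth_on_continuous[OF smooth_on_dir_deriv[OF U smooth_on_dir_deriv[OF U sm]]] U p
    by (auto simp: continuous_on_eq_continuous_at)
  then obtain d1 d2 where d: "d1 > 0" "d2 > 0" "\<And>y. dist y p < d1 \<Longrightarrow> dist (?F y) (?F p) < e"
    "\<And>y. dist y p < d2 \<Longrightarrow> dist (?G y) (?G p) < e"
    using e unfolding continuous_at_eps_delta by metis
  obtain r where r: "r > 0" "ball p r \<subseteq> U" using U p open_contains_ball by blast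
  define m where "m = min r (min d1 d2)"
  \<comment> \<open>The summand 1 keeps the denominator positive when \<open>u\<close> and
    \<open>v\<close> both vanish.\<close>
  define h where "h = m / (2 * (norm u + norm v + 1))"
  have pos: "norm u + norm v + 1 > 0" by (smt (verit) norm_ge_zero)
  have m: "m > 0" using r d by (simp add: m_def)
  have h0: "h > 0" using m pos by (simp add: h_def)
  have "h * (norm u + norm v) \<le> h * (norm u + norm v + 1)" using h0 by simp
  also have "\<dots> = m / 2" using pos by (simp add: h_def field_simps)
  finally have hm: "h * (norm u + norm v) < m" using m by linarith
  then have hr: "h * (norm u + norm v) < r" "h * (norm v + norm u) < r"
    by (simp_all add: m_def add.commute)
  obtain y where y: "dist p y \<le> h * (norm u + norm v)"
    "f (p + h *\<^sub>R u + h *\<^sub>R v) - f (p + h *\<^sub>R u) - f (p + h *\<^sub>R v) + f p = h\<^sup>2 * ?G y"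
    using second_difference_eq_dir_deriv[OF r(2) sm U h0 hr(1)] by blast
  obtain z where z: "dist p z \<le> h * (norm v + norm u)"
    "f (p + h *\<^sub>R v + h *\<^sub>R u) - f (p + h *\<^sub>R v) - f (p + h *\<^sub>R u) + f p = h\<^sup>2 * ?F z"
    using second_difference_eq_dir_deriv[OF r(2) sm U h0 hr(2)] by blast
  have "h\<^sup>2 * ?G y = h\<^sup>2 * ?F z"
    using y(2) z(2) by (simp add: algebra_simps)
  then have "?G y = ?F z" using h0 by simp
  moreover have "dist (?G y) (?G p) < e" "dist (?F z) (?F p) < e"
    using d(3)[of z] d(4)[of y] y(1) z(1) hm by (auto simp: m_def dist_commute algebra_simps)
  ultimately show False
    using dist_triangle_half_r[of "?F z" "?G p" "dist (?F p) (?G p)" "?F p"]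
    by (simp add: e_def dist_real_def dist_commute)
qed

lemma dir_deriv_commute:
  fixes f :: "real^'n::finite \<Rightarrow> 'b::euclidean_space"
  assumes sm: "smooth_on U f" and U: "open U" and p: "p \<in> U"
  shows "dir_deriv u (dir_deriv v f) p = dir_deriv v (dir_deriv u f) p"
proof (rule euclidean_eqI)
  fix b :: 'b
  assume "b \<in> Basis"
  have comp: "dir_deriv u (dir_deriv v (\<lambda>x. f x \<bullet> b)) p = dir_deriv u (dir_deriv v f) p \<bullet> b" for u v
  proof -
    have "dir_deriv u (dir_deriv v (\<lambda>x. f x \<bullet> b)) p = dir_deriv u (\<lambda>x. dir_deriv v f x \<bullet> b) p"
      by (rule dir_deriv_cong_open[OF U p])
        (simp add: dir_deriv_bounded_linear[OF bounded_linear_inner_left] smooth_on_differentiable[OF sm])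
    also have "\<dots> = dir_deriv u (dir_deriv v f) p \<bullet> b"
      by (simp add: dir_deriv_bounded_linear[OF bounded_linear_inner_left]
          smooth_on_differentiable[OF smooth_on_dir_deriv[OF U sm] p])
    finally show ?thesis .
  qed
  have "smooth_on U (\<lambda>x. f x \<bullet> b)" by (intro smooth_on_inner smooth_on_const U sm)
  from dir_deriv_commute_real[OF this U p]
  show "dir_deriv u (dir_deriv v f) p \<bullet> b = dir_deriv v (dir_deriv u f) p \<bullet> b"
    by (simp add: comp)
qed

section \<open>The Gauss equation for immersions into Euclidean space\<close>

text \<open>A tangent vector appears both as a coordinate vector \<open>v\<close> and as its image
  \<open>e v p\<close>; inner products are taken between images in the ambient space, which removes
  the Gram matrix from most computations.\<close>

locale immersion =
  fixes U :: "(real^'n::finite) set" and \<psi> :: "real^'n \<Rightarrow> 'a::euclidean_space"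
  assumes open_U: "open U" and smooth: "smooth_on U \<psi>"
    and inj_deriv: "\<And>p. p \<in> U \<Longrightarrow> inj (\<lambda>v. dir_deriv v \<psi> p)"
begin

abbreviation e :: "real^'n \<Rightarrow> real^'n \<Rightarrow> 'a" where "e v p \<equiv> dir_deriv v \<psi> p"

abbreviation pd :: "'n \<Rightarrow> real^'n \<Rightarrow> 'a" where "pd i p \<equiv> partial_deriv i \<psi> p"

definition gram :: "'n metric_field" where
  "gram p = (\<chi> i j. pd i p \<bullet> pd j p)"

lemma gram_nth [simp]: "gram p $ i $ j = pd i p \<bullet> pd j p"
  by (simp add: gram_def)

lemma diff_psi: "p \<in> U \<Longrightarrow> \<psi> differentiable (at p)"
  by (rule smooth_on_differentiable[OF smooth])

lemma linear_e: "p \<in> U \<Longrightarrow> linear (\<lambda>v. e v p)"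
  by (rule linear_dir_deriv[OF diff_psi])

lemma e_eq_0_iff: "p \<in> U \<Longrightarrow> e v p = 0 \<longleftrightarrow> v = 0"
  using inj_deriv linear_injective_0[OF linear_e] linear_0[OF linear_e] by metis

lemma e_expand: "p \<in> U \<Longrightarrow> e v p = (\<Sum>i\<in>UNIV. v $ i *\<^sub>R pd i p)"
  by (rule dir_deriv_expand[OF diff_psi])

lemma smooth_e: "smooth_on U (dir_deriv v \<psi>)"
  by (rule smooth_on_dir_deriv[OF open_U smooth])

lemma smooth_pd: "smooth_on U (partial_deriv i \<psi>)"
  by (rule smooth_on_partial_deriv[OF smooth])

lemma g_inner_gram: "p \<in> U \<Longrightarrow> g_inner gram p v w = e v p \<bullet> e w p"
  by (simp add: g_inner_def e_expand inner_vec_def[of v] matrix_vector_mult_def inner_sum_left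
      inner_sum_right sum_distrib_left mult_ac) (rule sum.swap)

lemma invertible_gram:
  assumes "p \<in> U" shows "invertible (gram p)"
proof -
  have "v = 0" if "gram p *v v = 0" for v
  proof -
    have "e v p \<bullet> e v p = 0"
      using g_inner_gram[OF assms, of v v] that by (simp add: g_inner_def)
    then show ?thesis using e_eq_0_iff[OF assms] by simp
  qed
  then show ?thesis
    using matrix_left_invertible_ker invertible_left_inverse by blast
qed

lemma gram_inv:
  assumes "p \<in> U"
  shows "gram p ** matrix_inv (gram p) = mat 1" "matrix_inv (gram p) ** gram p = mat 1"
  using someI_ex[OF invertible_gram[OF assms, unfolded invertible_def]] by (simp_all add: matrix_inv_def)

lemma g_inv_gram:
  assumes "p \<in> U"
  shows "(\<Sum>k\<in>UNIV. g_inv gram p i k * (pd k p \<bullet> pd j p)) = (if i = j then 1 else 0)"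
  using gram_inv(2)[OF assms] by (simp add: matrix_matrix_mult_def mat_def vec_eq_iff g_inv_def)

lemma g_inv_sym:
  assumes "p \<in> U" shows "g_inv gram p i j = g_inv gram p j i"
proof -
  have "transpose (gram p) = gram p" by (simp add: transpose_def vec_eq_iff inner_commute)
  then have "transpose (matrix_inv (gram p)) ** gram p = mat 1"
    using arg_cong[OF gram_inv(1)[OF assms], of transpose] by (simp add: matrix_transpose_mul transpose_mat)
  then have "transpose (matrix_inv (gram p)) = matrix_inv (gram p)"
    using gram_inv[OF assms] by (metis matrix_mul_assoc matrix_mul_lid matrix_mul_rid)
  then show ?thesis
    by (metis (no_types, lifting) g_inv_def transpose_def vec_lambda_beta)
qed

text \<open>By Cramer's rule an entry of the inverse is a quotient of determinants in the entries of
  \<open>gram\<close>; \<open>M\<close> is \<open>gram\<close> with column \<open>i\<close> replaced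
  by the \<open>j\<close>-th unit vector.\<close>

lemma smooth_g_inv: "smooth_on U (\<lambda>p. g_inv gram p i j)"
proof -
  define M where "M p = (\<chi> r c. if c = i then (axis j 1 :: real^'n) $ r else gram p $ r $ c)" for p
  have "g_inv gram p i j = det (M p) / det (gram p)" if "p \<in> U" for p
  proof -
    have dnz: "det (gram p) \<noteq> 0" using invertible_gram[OF that] invertible_det_nz by blast
    have "gram p *v (matrix_inv (gram p) *v axis j 1) = axis j 1"
      by (simp add: matrix_vector_mul_assoc gram_inv(1)[OF that])
    then have "matrix_inv (gram p) *v axis j 1
        = (\<chi> k. det (\<chi> r c. if c = k then (axis j 1 :: real^'n) $ r else gram p $ r $ c) / det (gram p))"
      using cramer[OF dnz] by blast
    then have "(matrix_inv (gram p) *v axis j 1) $ i = det (M p) / det (gram p)"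
      by (simp add: M_def)
    then show ?thesis
      by (simp add: g_inv_def matrix_vector_mul_component inner_axis)
  qed
  moreover have "smooth_on U (\<lambda>p. det (M p) / det (gram p))"
  proof -
    have "smooth_on U (\<lambda>p. M p $ r $ c)" for r c
      by (cases "c = i") (simp_all add: M_def smooth_intros open_U smooth_pd)
    moreover have "smooth_on U (\<lambda>p. gram p $ r $ c)" for r c
      by (simp add: smooth_intros open_U smooth_pd)
    ultimately have "smooth_on U (\<lambda>p. det (M p))" "smooth_on U (\<lambda>p. det (gram p))"
      unfolding det_def by (auto intro!: smooth_on_sum smooth_on_mult smooth_on_prod smooth_on_const open_U)
    then show ?thesis
      using invertible_gram invertible_det_nz by (intro smooth_on_divide open_U) blast+
  qed
  ultimately show ?thesis by (subst smooth_on_cong[OF open_U]) auto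
qed

text \<open>Raising an index: the coordinate vector metrically dual to the covector with components
  \<open>h\<close>.\<close>

definition coords :: "real^'n \<Rightarrow> ('n \<Rightarrow> real) \<Rightarrow> real^'n" where
  "coords p h = (\<chi> i. \<Sum>j\<in>UNIV. g_inv gram p i j * h j)"

lemma e_coords_pd:
  assumes "p \<in> U"
  shows "e (coords p h) p \<bullet> pd k p = h k"
proof -
  have "e (coords p h) p \<bullet> pd k p = (\<Sum>i\<in>UNIV. \<Sum>j\<in>UNIV. g_inv gram p i j * h j * (pd i p \<bullet> pd k p))"
    by (simp add: e_expand[OF assms] coords_def inner_sum_left sum_distrib_right)
  also have "\<dots> = (\<Sum>j\<in>UNIV. h j * (\<Sum>i\<in>UNIV. g_inv gram p j i * (pd i p \<bullet> pd k p)))"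
    by (subst sum.swap) (simp add: sum_distrib_left g_inv_sym[OF assms] mult_ac)
  also have "\<dots> = h k"
    by (simp add: g_inv_gram[OF assms] if_distrib cong: if_cong)
  finally show ?thesis .
qed

lemma inner_e_eqI:
  assumes "p \<in> U" "\<And>k. x \<bullet> pd k p = y \<bullet> pd k p"
  shows "x \<bullet> e v p = y \<bullet> e v p"
  using assms by (simp add: e_expand inner_sum_right)

lemma e_coords_inner: "p \<in> U \<Longrightarrow> e (coords p h) p \<bullet> e v p = (\<Sum>j\<in>UNIV. v $ j * h j)"
  by (subst e_expand[of p v]) (simp_all add: inner_sum_right e_coords_pd)

lemma smooth_e_coords:
  assumes "\<And>j. smooth_on U (h j)"
  shows "smooth_on U (\<lambda>p. e (coords p (\<lambda>j. h j p)) p)"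
proof -
  have "smooth_on U (\<lambda>p. \<Sum>i\<in>UNIV. (\<Sum>j\<in>UNIV. g_inv gram p i j * h j p) *\<^sub>R pd i p)"
    by (intro smooth_intros open_U assms smooth_g_inv smooth_pd)
  then show ?thesis
    by (subst smooth_on_cong[OF open_U]) (auto simp: e_expand coords_def)
qed

text \<open>The orthogonal projection of the ambient space onto the tangent space, obtained as the
  dual of the covector that \<open>x\<close> induces there.\<close>

definition tang :: "real^'n \<Rightarrow> 'a \<Rightarrow> 'a" where
  "tang p x = e (coords p (\<lambda>j. x \<bullet> pd j p)) p"

lemma tang_inner_pd: "p \<in> U \<Longrightarrow> tang p x \<bullet> pd k p = x \<bullet> pd k p"
  by (simp add: tang_def e_coords_pd)

lemma tang_inner_e: "p \<in> U \<Longrightarrow> tang p x \<bullet> e v p = x \<bullet> e v p"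
  by (rule inner_e_eqI) (simp_all add: tang_inner_pd)

lemma tang_inner: "p \<in> U \<Longrightarrow> tang p x \<bullet> tang p y = x \<bullet> tang p y"
  unfolding tang_def[of p y] by (rule tang_inner_e)

lemma tang_e: "p \<in> U \<Longrightarrow> tang p (e v p) = e v p"
proof -
  assume p: "p \<in> U"
  have "(tang p (e v p) - e v p) \<bullet> e w p = 0" for w
    by (simp add: inner_diff_left tang_inner_e[OF p])
  moreover have "tang p (e v p) - e v p = e (coords p (\<lambda>j. e v p \<bullet> pd j p) - v) p"
    by (simp add: tang_def linear_diff[OF linear_e[OF p]])
  ultimately show ?thesis by (metis eq_iff_diff_eq_0 inner_eq_zero_iff)
qed

lemma partial_deriv_inner:
  fixes f g :: "real^'n \<Rightarrow> 'b::real_inner"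
  assumes "smooth_on U f" "smooth_on U g" "p \<in> U"
  shows "partial_deriv i (\<lambda>x. f x \<bullet> g x) p = f p \<bullet> partial_deriv i g p + partial_deriv i f p \<bullet> g p"
  unfolding partial_deriv_eq_dir_deriv by (rule dir_deriv_inner[OF assms])

lemma partial_deriv_commute:
  fixes f :: "real^'n \<Rightarrow> 'b::euclidean_space"
  assumes "smooth_on U f" "p \<in> U"
  shows "partial_deriv i (partial_deriv j f) p = partial_deriv j (partial_deriv i f) p"
  unfolding partial_deriv_eq_dir_deriv by (rule dir_deriv_commute[OF assms(1) open_U assms(2)])

section \<open>Levi-Civita connection and curvature of an immersion\<close>

abbreviation second :: "'n \<Rightarrow> 'n \<Rightarrow> real^'n \<Rightarrow> 'a" where
  "second i j \<equiv> partial_deriv i (partial_deriv j \<psi>)"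

lemma smooth_second: "smooth_on U (second i j)"
  by (intro smooth_on_partial_deriv smooth)

text \<open>Expanding the three derivatives of inner products and using the symmetry of second
  derivatives, all terms cancel except twice \<open>second i j p \<bullet> pd l p\<close>. Covariant
  differentiation is thus tangential projection of ambient differentiation.\<close>

lemma christoffel_gram:
  assumes "p \<in> U"
  shows "christoffel gram k i j p = coords p (\<lambda>l. second i j p \<bullet> pd l p) $ k"
proof -
  have "partial_deriv i (\<lambda>x. gram x $ j $ l) p + partial_deriv j (\<lambda>x. gram x $ i $ l) p
      - partial_deriv l (\<lambda>x. gram x $ i $ j) p = 2 * (second i j p \<bullet> pd l p)" for l
    by (simp add: partial_deriv_inner[OF smooth_pd smooth_pd assms] partial_deriv_commute[OF smooth assms, of j i]
        partial_deriv_commute[OF smooth assms, of l] inner_commute)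
  then show ?thesis
    by (simp add: christoffel_def coords_def sum_divide_distrib)
qed

lemma smooth_christoffel: "smooth_on U (christoffel gram k i j)"
proof -
  have "smooth_on U (\<lambda>p. \<Sum>l\<in>UNIV. g_inv gram p k l * (second i j p \<bullet> pd l p))"
    by (intro smooth_intros open_U smooth_g_inv smooth_pd smooth_second)
  then show ?thesis
    by (subst smooth_on_cong[OF open_U]) (auto simp: christoffel_gram coords_def)
qed

lemma tang_second:
  "p \<in> U \<Longrightarrow> tang p (second i j p) = (\<Sum>m\<in>UNIV. christoffel gram m i j p *\<^sub>R pd m p)"
  by (simp add: tang_def e_expand christoffel_gram)

text \<open>One half of the Gauss equation, before antisymmetrizing in \<open>i, j\<close>.\<close>

lemma gauss_half:
  assumes p: "p \<in> U"
  shows "(\<Sum>m\<in>UNIV. (pd k p \<bullet> pd m p) * (partial_deriv i (christoffel gram m j l) p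
      + (\<Sum>s\<in>UNIV. christoffel gram m i s p * christoffel gram s j l p)))
    = partial_deriv i (second j l) p \<bullet> pd k p + second j l p \<bullet> second i k p
      - tang p (second j l p) \<bullet> tang p (second i k p)"
proof -
  let ?\<Gamma> = "christoffel gram"
  define T where "T x = (\<Sum>m\<in>UNIV. ?\<Gamma> m j l x *\<^sub>R pd m x)" for x
  have T: "T x = tang x (second j l x)" if "x \<in> U" for x
    using tang_second[OF that] by (simp add: T_def)
  have smT: "smooth_on U T"
    unfolding T_def[abs_def] by (intro smooth_intros open_U smooth_christoffel smooth_pd)
  have dT: "partial_deriv i T p
      = (\<Sum>m\<in>UNIV. ?\<Gamma> m j l p *\<^sub>R second i m p + partial_deriv i (?\<Gamma> m j l) p *\<^sub>R pd m p)"
  proof -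
    have "(T has_derivative (\<lambda>v. \<Sum>m\<in>UNIV. ?\<Gamma> m j l p *\<^sub>R dir_deriv v (partial_deriv m \<psi>) p
        + dir_deriv v (?\<Gamma> m j l) p *\<^sub>R pd m p)) (at p)"
      unfolding T_def[abs_def]
      by (intro has_derivative_sum bounded_bilinear.FDERIV[OF bounded_bilinear_scaleR] has_derivative_dir_deriv
        smooth_on_differentiable[OF _ p] smooth_pd smooth_christoffel)
    from dir_deriv_unique[OF this] show ?thesis by (simp add: partial_deriv_eq_dir_deriv)
  qed
  \<comment> \<open>\<open>T\<close> is the tangential part of the second derivative, so both have
    the same products with tangent vectors throughout \<open>U\<close>; comparing the derivatives of
    these products isolates the Christoffel terms.\<close>
  have "partial_deriv i (\<lambda>x. T x \<bullet> pd k x) p = partial_deriv i (\<lambda>x. second j l x \<bullet> pd k x) p"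
    unfolding partial_deriv_eq_dir_deriv[of i]
    by (rule dir_deriv_cong_open[OF open_U p]) (simp add: T tang_inner_pd)
  then have "partial_deriv i T p \<bullet> pd k p
      = partial_deriv i (second j l) p \<bullet> pd k p + second j l p \<bullet> second i k p - T p \<bullet> second i k p"
    by (simp add: partial_deriv_inner[OF smT smooth_pd p] partial_deriv_inner[OF smooth_second smooth_pd p])
  moreover have "T p \<bullet> second i k p = tang p (second j l p) \<bullet> tang p (second i k p)"
    by (simp add: T[OF p] tang_inner[OF p, of "second i k p"] inner_commute)
  moreover have "partial_deriv i T p \<bullet> pd k p = (\<Sum>m\<in>UNIV. (pd k p \<bullet> pd m p) * (partial_deriv i (?\<Gamma> m j l) p
      + (\<Sum>s\<in>UNIV. ?\<Gamma> m i s p * ?\<Gamma> s j l p)))"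
  proof -
    have "second i m p \<bullet> pd k p = (\<Sum>s\<in>UNIV. ?\<Gamma> s i m p * (pd s p \<bullet> pd k p))" for m
      using tang_inner_pd[OF p, of "second i m p" k] tang_second[OF p, of i m] by (simp add: inner_sum_left)
    then have "partial_deriv i T p \<bullet> pd k p = (\<Sum>m\<in>UNIV. \<Sum>s\<in>UNIV. ?\<Gamma> m j l p * (?\<Gamma> s i m p * (pd s p \<bullet> pd k p)))
        + (\<Sum>m\<in>UNIV. partial_deriv i (?\<Gamma> m j l) p * (pd m p \<bullet> pd k p))"
      by (simp add: dT inner_sum_left inner_add_left sum.distrib sum_distrib_left)
    also have "(\<Sum>m\<in>UNIV. \<Sum>s\<in>UNIV. ?\<Gamma> m j l p * (?\<Gamma> s i m p * (pd s p \<bullet> pd k p)))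
        = (\<Sum>s\<in>UNIV. \<Sum>m\<in>UNIV. (pd k p \<bullet> pd s p) * (?\<Gamma> s i m p * ?\<Gamma> m j l p))"
      by (subst sum.swap) (simp add: mult_ac inner_commute)
    finally show ?thesis
      by (simp add: sum_distrib_left distrib_left sum.distrib inner_commute mult_ac)
  qed
  ultimately show ?thesis by simp
qed

text \<open>Antisymmetrizing in \<open>i, j\<close> cancels the third derivatives. Each difference
  that remains is the inner product of the normal parts of two second derivatives, that is, of
  values of the second fundamental form.\<close>

theorem gauss_equation:
  assumes p: "p \<in> U"
  shows "riem gram p i j k l =
    (second i k p \<bullet> second j l p - tang p (second i k p) \<bullet> tang p (second j l p))
    - (second i l p \<bullet> second j k p - tang p (second i l p) \<bullet> tang p (second j k p))"
proof -
  let ?\<Gamma> = "christoffel gram"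
  have "riem gram p i j k l
      = (\<Sum>m\<in>UNIV. (pd k p \<bullet> pd m p) * (partial_deriv i (?\<Gamma> m j l) p + (\<Sum>s\<in>UNIV. ?\<Gamma> m i s p * ?\<Gamma> s j l p)))
        - (\<Sum>m\<in>UNIV. (pd k p \<bullet> pd m p) * (partial_deriv j (?\<Gamma> m i l) p + (\<Sum>s\<in>UNIV. ?\<Gamma> m j s p * ?\<Gamma> s i l p)))"
    unfolding riem_def riem_up_def sum_subtractf[symmetric]
    by (rule sum.cong) (simp_all add: sum_subtractf algebra_simps)
  then show ?thesis
    unfolding gauss_half[OF p] partial_deriv_commute[OF smooth_pd p, of i j l]
    by (simp add: inner_commute)
qed

section \<open>Gradient and Hessian in the ambient space\<close>

definition grad :: "(real^'n \<Rightarrow> real) \<Rightarrow> real^'n \<Rightarrow> 'a" where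
  "grad f p = e (gradient gram f p) p"

lemma gradient_eq_coords: "gradient gram f p = coords p (\<lambda>j. partial_deriv j f p)"
  by (simp add: gradient_def coords_def)

lemma smooth_grad: "smooth_on U f \<Longrightarrow> smooth_on U (grad f)"
  unfolding grad_def[abs_def] gradient_eq_coords
  by (rule smooth_e_coords[of "\<lambda>j. partial_deriv j f"]) (rule smooth_on_partial_deriv)

lemma grad_inner_e:
  assumes "smooth_on U f" "p \<in> U"
  shows "grad f p \<bullet> e v p = dir_deriv v f p"
  by (simp add: grad_def gradient_eq_coords e_coords_inner[OF assms(2)]
      dir_deriv_expand[OF smooth_on_differentiable[OF assms]])

text \<open>Differentiating \<open>grad f x \<bullet> pd j x = partial_deriv j f x\<close> produces
  the Christoffel correction as the product of \<open>grad f p\<close> with a second derivative of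
  \<psi>, of which only the tangential part counts.\<close>

lemma hessian_gram:
  assumes f: "smooth_on U f" and p: "p \<in> U"
  shows "hessian gram f p v w = dir_deriv v (grad f) p \<bullet> e w p"
proof -
  have "partial_deriv i (partial_deriv j f) p - (\<Sum>k\<in>UNIV. christoffel gram k i j p * partial_deriv k f p)
      = partial_deriv i (grad f) p \<bullet> pd j p" for i j
  proof -
    have "partial_deriv i (\<lambda>x. grad f x \<bullet> pd j x) p = partial_deriv i (partial_deriv j f) p"
      unfolding partial_deriv_eq_dir_deriv[of i]
      by (rule dir_deriv_cong_open[OF open_U p]) (simp add: grad_inner_e[OF f] partial_deriv_eq_dir_deriv)
    then have "partial_deriv i (grad f) p \<bullet> pd j p
        = partial_deriv i (partial_deriv j f) p - grad f p \<bullet> second i j p"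
      by (simp add: partial_deriv_inner[OF smooth_grad[OF f] smooth_pd p])
    moreover have "grad f p \<bullet> second i j p = tang p (second i j p) \<bullet> grad f p"
      unfolding grad_def by (metis tang_inner_e[OF p] inner_commute)
    moreover have "tang p (second i j p) \<bullet> grad f p = (\<Sum>k\<in>UNIV. christoffel gram k i j p * partial_deriv k f p)"
      unfolding tang_second[OF p] inner_sum_left inner_scaleR_left
      by (simp add: inner_commute[of _ "grad f p"] grad_inner_e[OF f p] partial_deriv_eq_dir_deriv)
    ultimately show ?thesis by simp
  qed
  then show ?thesis
    by (simp add: hessian_def e_expand[OF p] dir_deriv_expand[OF smooth_on_differentiable[OF smooth_grad[OF f] p]]
        inner_sum_left inner_sum_right mult_ac sum_distrib_left) (rule sum.swap)
qed

lemma g_norm_gram: "p \<in> U \<Longrightarrow> g_norm gram p v = norm (e v p)"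
  by (simp add: g_norm_def g_inner_gram norm_eq_sqrt_inner)

lemma carleman_at_gramD:
  assumes f: "smooth_on U f" and p: "p \<in> U" and c: "carleman_at gram f p"
  shows "grad f p \<noteq> 0"
    and "\<And>\<xi>. e \<xi> p \<bullet> grad f p = 0 \<Longrightarrow> norm (e \<xi> p) = norm (grad f p) \<Longrightarrow>
      dir_deriv (gradient gram f p) (grad f) p \<bullet> grad f p + dir_deriv \<xi> (grad f) p \<bullet> e \<xi> p = 0"
  using c e_eq_0_iff[OF p]
  by (auto simp: carleman_at_def Let_def g_inner_gram[OF p] g_norm_gram[OF p] hessian_gram[OF f p] grad_def)

lemma hessian_sym:
  assumes f: "smooth_on U f" and p: "p \<in> U"
  shows "dir_deriv v (grad f) p \<bullet> e w p = dir_deriv w (grad f) p \<bullet> e v p"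
proof -
  have *: "dir_deriv v (grad f) p \<bullet> e w p = dir_deriv v (dir_deriv w f) p - grad f p \<bullet> dir_deriv v (dir_deriv w \<psi>) p"
    for v w
  proof -
    have "dir_deriv v (\<lambda>x. grad f x \<bullet> e w x) p = dir_deriv v (dir_deriv w f) p"
      by (rule dir_deriv_cong_open[OF open_U p]) (simp add: grad_inner_e[OF f])
    then show ?thesis
      by (simp add: dir_deriv_inner[OF smooth_grad[OF f] smooth_e p])
  qed
  show ?thesis
    by (simp add: * dir_deriv_commute[OF f open_U p, of v w] dir_deriv_commute[OF smooth open_U p, of v w])
qed

end

section \<open>The cross product and diagonal quadratic forms\<close>

unbundle cross3_syntax

lemma cross_cross_unit:
  assumes "n \<bullet> n = 1"
  shows "n \<times> (n \<times> x) = (n \<bullet> x) *\<^sub>R n - x"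
proof -
  have "n \<times> (n \<times> x) = (n \<bullet> x) *\<^sub>R n - (n \<bullet> n) *\<^sub>R x"
    by (simp add: cross3_simps forall_3)
  with assms show ?thesis by simp
qed

lemma cross_dot_cross:
  fixes u v w z :: "real^3"
  shows "(u \<times> v) \<bullet> (w \<times> z) = (u \<bullet> w) * (v \<bullet> z) - (u \<bullet> z) * (v \<bullet> w)"
  by (simp add: cross3_simps)

lemma cross_of_normal:
  assumes "n \<bullet> n = 1" "n \<bullet> u = 0" "n \<bullet> v = 0"
  shows "u \<times> v = (n \<bullet> (u \<times> v)) *\<^sub>R n"
proof -
  have "n \<times> (u \<times> v) = (n \<bullet> v) *\<^sub>R u - (n \<bullet> u) *\<^sub>R v"
    by (simp add: cross3_simps forall_3)
  then show ?thesis using cross_cross_unit[OF assms(1), of "u \<times> v"] assms by simp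
qed

text \<open>\<open>x\<close> and \<open>n \<times> x\<close> form an orthogonal frame of the plane
  perpendicular to \<open>n\<close>, both of length |x|. The proof trades products with
  \<open>n \<times> x\<close> for cross products, which are multiples of \<open>n\<close>.\<close>

lemma plane_parseval:
  fixes n x u v :: "real^3"
  assumes n: "n \<bullet> n = 1" and perp: "n \<bullet> x = 0" "n \<bullet> u = 0" "n \<bullet> v = 0"
  shows "(x \<bullet> u) * (x \<bullet> v) + ((n \<times> x) \<bullet> u) * ((n \<times> x) \<bullet> v) = (x \<bullet> x) * (u \<bullet> v)"
proof -
  have eq: "(n \<times> x) \<bullet> y = n \<bullet> (x \<times> y)" for y by (simp add: cross3_simps)
  have "((n \<times> x) \<bullet> u) * ((n \<times> x) \<bullet> v) = ((n \<bullet> (x \<times> u)) *\<^sub>R n) \<bullet> ((n \<bullet> (x \<times> v)) *\<^sub>R n)"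
    by (simp add: n eq)
  also have "\<dots> = (x \<times> u) \<bullet> (x \<times> v)"
    by (simp only: cross_of_normal[OF n perp(1,2), symmetric] cross_of_normal[OF n perp(1,3), symmetric])
  finally show ?thesis by (simp add: cross_dot_cross inner_commute)
qed

lemma unit_normal_exists:
  fixes n :: "real^3"
  obtains f where "n \<bullet> f = 0" "f \<bullet> f = 1"
proof -
  obtain y where y: "y \<noteq> 0" "orthogonal n y"
    using orthogonal_to_vector_exists[of n] by auto
  then show thesis
    by (intro that[of "y /\<^sub>R norm y"]) (auto simp: orthogonal_def dot_square_norm power2_eq_square)
qed

definition diag :: "real^'n::finite \<Rightarrow> real^'n \<Rightarrow> real^'n" where
  "diag a x = (\<chi> i. a $ i * x $ i)"

lemma diag_nth [simp]: "diag a x $ i = a $ i * x $ i"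
  by (simp add: diag_def)

lemma linear_diag: "linear (diag a)"
  by (rule linearI) (simp_all add: vec_eq_iff algebra_simps)

lemma bounded_linear_diag: "bounded_linear (diag a)"
  using linear_diag linear_conv_bounded_linear by blast

lemma diag_sym: "diag a x \<bullet> y = x \<bullet> diag a y"
  by (simp add: inner_vec_def mult_ac)

text \<open>A linear map A satisfies Au \<times> Av = cof(A) (u \<times> v), and here the cofactor
  matrix is diagonal. The left side is a minor of the form A on the plane perpendicular to
  \<open>n\<close>; as the cross products are multiples of \<open>n\<close>, it is the area term
  times the value of cof(A) on \<open>n\<close>.\<close>

lemma diag_cross_dot:
  fixes u v w z :: "real^3"
  assumes n: "n \<bullet> n = 1" and perp: "n \<bullet> u = 0" "n \<bullet> v = 0" "n \<bullet> w = 0" "n \<bullet> z = 0"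
  shows "(diag a u \<bullet> w) * (diag a v \<bullet> z) - (diag a u \<bullet> z) * (diag a v \<bullet> w)
    = (diag (vector [a $ 2 * a $ 3, a $ 3 * a $ 1, a $ 1 * a $ 2]) n \<bullet> n)
      * ((u \<bullet> w) * (v \<bullet> z) - (u \<bullet> z) * (v \<bullet> w))"
proof -
  let ?c = "vector [a $ 2 * a $ 3, a $ 3 * a $ 1, a $ 1 * a $ 2] :: real^3"
  have cof: "diag a u \<times> diag a v = diag ?c (u \<times> v)"
    by (simp add: cross3_simps forall_3)
  have "(diag a u \<bullet> w) * (diag a v \<bullet> z) - (diag a u \<bullet> z) * (diag a v \<bullet> w) = diag ?c (u \<times> v) \<bullet> (w \<times> z)"
    by (simp flip: cof cross_dot_cross)
  also have "\<dots> = (n \<bullet> (u \<times> v)) * (n \<bullet> (w \<times> z)) * (diag ?c n \<bullet> n)"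
    by (subst cross_of_normal[OF n perp(1,2)], subst cross_of_normal[OF n perp(3,4)])
      (simp add: linear_scale[OF linear_diag])
  also have "(n \<bullet> (u \<times> v)) * (n \<bullet> (w \<times> z)) = (u \<times> v) \<bullet> (w \<times> z)"
  proof -
    have "(n \<bullet> (u \<times> v)) * (n \<bullet> (w \<times> z)) = ((n \<bullet> (u \<times> v)) *\<^sub>R n) \<bullet> ((n \<bullet> (w \<times> z)) *\<^sub>R n)"
      by (simp add: n)
    then show ?thesis
      by (simp only: cross_of_normal[OF n perp(1,2), symmetric] cross_of_normal[OF n perp(3,4), symmetric])
  qed
  finally show ?thesis by (simp add: cross_dot_cross mult_ac)
qed

section \<open>Maps into an ellipsoid\<close>

text \<open>\<open>a\<close> holds the coefficients of the quadric, to be the inverse squares of the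
  semi-axes; \<open>N\<close> is then half the gradient of the quadratic form. The dimension of
  \<open>U\<close> is left open because \<sigma> will be one component of a chart of the
  product.\<close>

locale ellipsoid_map =
  fixes U :: "(real^'n::finite) set" and \<sigma> :: "real^'n \<Rightarrow> real^3" and a :: "real^3"
  assumes open_dom: "open U" and smooth_sigma: "smooth_on U \<sigma>"
    and a_pos: "\<And>i. a $ i > 0"
    and on_ellipsoid: "\<And>p. p \<in> U \<Longrightarrow> diag a (\<sigma> p) \<bullet> \<sigma> p = 1"
begin

abbreviation t :: "real^'n \<Rightarrow> real^'n \<Rightarrow> real^3" where "t v p \<equiv> dir_deriv v \<sigma> p"

definition N :: "real^'n \<Rightarrow> real^3" where "N p = diag a (\<sigma> p)"

definition nrm :: "real^'n \<Rightarrow> real" where "nrm p = sqrt (N p \<bullet> N p)"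

definition n :: "real^'n \<Rightarrow> real^3" where "n p = inverse (nrm p) *\<^sub>R N p"

text \<open>The Gauss curvature of the quadric; that this formula gives it is the content of
  \<open>diag_curvature\<close>.\<close>

definition K :: "real^'n \<Rightarrow> real" where "K p = a $ 1 * a $ 2 * a $ 3 / (N p \<bullet> N p)\<^sup>2"

lemma diff_sigma: "p \<in> U \<Longrightarrow> \<sigma> differentiable (at p)"
  by (rule smooth_on_differentiable[OF smooth_sigma])

lemma smooth_t: "smooth_on U (dir_deriv v \<sigma>)"
  by (rule smooth_on_dir_deriv[OF open_dom smooth_sigma])

lemma smooth_N: "smooth_on U N"
  unfolding N_def[abs_def] by (rule smooth_on_bounded_linear[OF open_dom bounded_linear_diag smooth_sigma])

lemma dir_deriv_N: "p \<in> U \<Longrightarrow> dir_deriv v N p = diag a (t v p)"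
  unfolding N_def[abs_def] by (rule dir_deriv_bounded_linear[OF bounded_linear_diag diff_sigma])

lemma N_inner_t:
  assumes "p \<in> U" shows "N p \<bullet> t v p = 0"
proof -
  have "dir_deriv v (\<lambda>x. N x \<bullet> \<sigma> x) p = dir_deriv v (\<lambda>x. 1) p"
    by (rule dir_deriv_cong_open[OF open_dom assms]) (simp add: N_def on_ellipsoid)
  then have "N p \<bullet> t v p + diag a (t v p) \<bullet> \<sigma> p = 0"
    by (simp add: dir_deriv_inner[OF smooth_N smooth_sigma assms] dir_deriv_N[OF assms])
  moreover have "N p \<bullet> t v p = diag a (t v p) \<bullet> \<sigma> p"
    unfolding N_def by (metis diag_sym inner_commute)
  ultimately show ?thesis by simp
qed

lemma N_nonzero:
  assumes "p \<in> U" shows "N p \<noteq> 0"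
proof
  assume "N p = 0"
  then have "diag a (\<sigma> p) \<bullet> \<sigma> p = 0" by (simp add: N_def)
  then show False using on_ellipsoid[OF assms] by simp
qed

lemma N_pos: "p \<in> U \<Longrightarrow> N p \<bullet> N p > 0"
  by (simp add: N_nonzero)

lemma nrm_pos: "p \<in> U \<Longrightarrow> nrm p > 0"
  by (simp add: nrm_def N_nonzero)

lemma nrm_sq: "p \<in> U \<Longrightarrow> nrm p * nrm p = N p \<bullet> N p"
  by (simp add: nrm_def)

lemma smooth_inv_nrm: "smooth_on U (\<lambda>p. inverse (nrm p))"
  unfolding nrm_def
  by (intro smooth_on_inverse smooth_on_sqrt smooth_on_inner smooth_N open_dom) (use N_nonzero in auto)

lemma smooth_n: "smooth_on U n"
  unfolding n_def[abs_def] by (intro smooth_on_scaleR smooth_inv_nrm smooth_N open_dom)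

lemma n_unit: "p \<in> U \<Longrightarrow> n p \<bullet> n p = 1"
  using nrm_sq[of p] nrm_pos[of p] N_nonzero[of p] by (simp add: n_def field_simps)

lemma n_inner_t: "p \<in> U \<Longrightarrow> n p \<bullet> t v p = 0"
  by (simp add: n_def N_inner_t)

lemma n_inner_iff: "p \<in> U \<Longrightarrow> n p \<bullet> x = 0 \<longleftrightarrow> N p \<bullet> x = 0"
  using nrm_pos[of p] by (simp add: n_def)

lemma n_inner_dn: 
  assumes "p \<in> U" shows "n p \<bullet> dir_deriv v n p = 0"
proof -
  have "dir_deriv v (\<lambda>x. n x \<bullet> n x) p = dir_deriv v (\<lambda>x. 1) p"
    by (rule dir_deriv_cong_open[OF open_dom assms]) (simp add: n_unit)
  then show ?thesis
    by (simp add: dir_deriv_inner[OF smooth_n smooth_n assms] inner_commute)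
qed

text \<open>Differentiating the normalizing factor contributes only a multiple of \<open>N\<close>,
  which is invisible to \<open>x\<close>. Hence the shape operator is \<open>diag a\<close> divided
  by \<open>nrm\<close>, up to tangential projection.\<close>

lemma dn_inner:
  assumes "p \<in> U" "n p \<bullet> x = 0"
  shows "dir_deriv v n p \<bullet> x = diag a (t v p) \<bullet> x / nrm p"
proof -
  have "dir_deriv v n p = inverse (nrm p) *\<^sub>R dir_deriv v N p + dir_deriv v (\<lambda>x. inverse (nrm x)) p *\<^sub>R N p"
    unfolding n_def[abs_def]
    by (rule dir_deriv_bilinear[OF bounded_bilinear_scaleR])
      (use assms smooth_inv_nrm smooth_N smooth_on_differentiable in blast)+
  then show ?thesis
    using assms by (simp add: dir_deriv_N inner_add_left n_inner_iff divide_inverse_commute)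
qed

lemma n_inner_dt:
  assumes "p \<in> U"
  shows "n p \<bullet> dir_deriv u (dir_deriv v \<sigma>) p = - (diag a (t u p) \<bullet> t v p / nrm p)"
proof -
  have "dir_deriv u (\<lambda>x. n x \<bullet> t v x) p = dir_deriv u (\<lambda>x. 0) p"
    by (rule dir_deriv_cong_open[OF open_dom assms]) (simp add: n_inner_t)
  then show ?thesis
    using dn_inner[OF assms n_inner_t[OF assms], of u v]
    by (simp add: dir_deriv_inner[OF smooth_n smooth_t assms])
qed

text \<open>The cofactor form takes the constant value \<open>a $ 1 * a $ 2 * a $ 3\<close> on
  \<open>N\<close>: each cofactor times the square of \<open>a $ i\<close> is that product times
  \<open>a $ i\<close>, and the point satisfies the quadric equation. Normalizing \<open>N\<close>
  accounts for the powers of its length in \<open>K\<close>.\<close>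

lemma diag_curvature:
  assumes "p \<in> U" "n p \<bullet> u = 0" "n p \<bullet> v = 0" "n p \<bullet> w = 0" "n p \<bullet> z = 0"
  shows "(diag a u \<bullet> w) * (diag a v \<bullet> z) - (diag a u \<bullet> z) * (diag a v \<bullet> w)
    = N p \<bullet> N p * K p * ((u \<bullet> w) * (v \<bullet> z) - (u \<bullet> z) * (v \<bullet> w))"
proof -
  let ?c = "vector [a $ 2 * a $ 3, a $ 3 * a $ 1, a $ 1 * a $ 2] :: real^3"
  have "diag ?c (n p) \<bullet> n p = inverse (nrm p * nrm p) * (diag ?c (N p) \<bullet> N p)"
    by (simp add: n_def linear_scale[OF linear_diag] mult_ac)
  also have "diag ?c (N p) \<bullet> N p = a $ 1 * a $ 2 * a $ 3 * (diag a (\<sigma> p) \<bullet> \<sigma> p)"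
    by (simp add: N_def inner_vec_def sum_3 vector_def algebra_simps)
  finally have "diag ?c (n p) \<bullet> n p = N p \<bullet> N p * K p"
    using N_pos[OF assms(1)] by (simp add: on_ellipsoid[OF assms(1)] nrm_sq[OF assms(1)] K_def field_simps power2_eq_square)
  then show ?thesis using diag_cross_dot[OF n_unit[OF assms(1)] assms(2-)] by simp
qed

lemma K_pos: "p \<in> U \<Longrightarrow> K p > 0"
  using a_pos N_pos[of p] by (simp add: K_def)

end

section \<open>Charts of a product of two ellipsoids\<close>

lemma dir_deriv_Pair:
  assumes "f differentiable (at p)" "g differentiable (at p)"
  shows "dir_deriv v (\<lambda>x. (f x, g x)) p = (dir_deriv v f p, dir_deriv v g p)"
  by (rule dir_deriv_unique[OF has_derivative_Pair[OF has_derivative_dir_deriv[OF assms(1)]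
        has_derivative_dir_deriv[OF assms(2)]]])

locale ellipsoid_pair =
  immersion U "\<lambda>p. (\<psi>1 p, \<psi>2 p)" + E1: ellipsoid_map U \<psi>1 a + E2: ellipsoid_map U \<psi>2 b
  for U :: "(real^4) set" and \<psi>1 \<psi>2 :: "real^4 \<Rightarrow> real^3" and a b :: "real^3"
begin

lemma e_Pair: "p \<in> U \<Longrightarrow> e v p = (E1.t v p, E2.t v p)"
  by (rule dir_deriv_Pair[OF E1.diff_sigma E2.diff_sigma])

lemma pd_Pair: "p \<in> U \<Longrightarrow> pd i p = (partial_deriv i \<psi>1 p, partial_deriv i \<psi>2 p)"
  unfolding partial_deriv_eq_dir_deriv by (rule e_Pair)

text \<open>The differential is injective on a space of dimension 4 and lands in the product of two
  tangent planes, of dimension 2 + 2. This lets tangent vectors of the factors be prescribed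
  separately in a chart that does not split.\<close>

lemma e_surj:
  assumes p: "p \<in> U" and x: "E1.n p \<bullet> x = 0" and y: "E2.n p \<bullet> y = 0"
  obtains v where "E1.t v p = x" "E2.t v p = y"
proof -
  define T where "T = Sigma {x. E1.N p \<bullet> x = 0} (\<lambda>_. {y. E2.N p \<bullet> y = 0})"
  have sub: "subspace {x. E1.N p \<bullet> x = 0}" "subspace {x. E2.N p \<bullet> x = 0}"
    by (rule subspace_hyperplane)+
  have "dim T = 4"
    using dim_Times[OF sub] dim_hyperplane[OF E1.N_nonzero[OF p]] dim_hyperplane[OF E2.N_nonzero[OF p]]
    by (simp add: T_def)
  moreover have "dim (range (\<lambda>v. e v p)) = 4"
    using dim_image_eq[OF linear_e[OF p], of UNIV] inj_deriv[OF p] by simp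
  moreover have "range (\<lambda>v. e v p) \<subseteq> T"
    by (auto simp: T_def e_Pair[OF p] E1.N_inner_t[OF p] E2.N_inner_t[OF p])
  moreover have "subspace (range (\<lambda>v. e v p))"
    using linear_subspace_image[OF linear_e[OF p] subspace_UNIV] .
  moreover have "subspace T" unfolding T_def by (rule subspace_Times[OF sub])
  ultimately have "range (\<lambda>v. e v p) = T" by (simp add: subspace_dim_equal)
  moreover have "(x, y) \<in> T" using x y by (simp add: T_def E1.n_inner_iff[OF p] E2.n_inner_iff[OF p])
  ultimately have "(x, y) \<in> range (\<lambda>v. e v p)" by simp
  then obtain v where "(x, y) = e v p" by blast
  then show thesis using that e_Pair[OF p] by auto
qed

text \<open>The normal space of the product is spanned by the two factor normals. Removing their
  components from \<open>x - tang p x\<close> leaves a vector that is tangent by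
  \<open>e_surj\<close> and orthogonal to every tangent vector, hence zero.\<close>

lemma normal_part:
  assumes p: "p \<in> U"
  shows "x \<bullet> y - tang p x \<bullet> tang p y
    = (E1.n p \<bullet> fst x) * (E1.n p \<bullet> fst y) + (E2.n p \<bullet> snd x) * (E2.n p \<bullet> snd y)"
proof -
  have nt: "fst x - fst (tang p x) = (E1.n p \<bullet> fst x) *\<^sub>R E1.n p"
       "snd x - snd (tang p x) = (E2.n p \<bullet> snd x) *\<^sub>R E2.n p" for x
  proof -
    define z where "z = x - tang p x"
    have perp: "z \<bullet> e v p = 0" for v by (simp add: z_def inner_diff_left tang_inner_e[OF p])
    have tn: "E1.n p \<bullet> fst (tang p x) = 0" "E2.n p \<bullet> snd (tang p x) = 0"
      by (simp_all add: tang_def e_Pair[OF p] E1.n_inner_t[OF p] E2.n_inner_t[OF p])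
    define z1 where "z1 = fst z - (E1.n p \<bullet> fst z) *\<^sub>R E1.n p"
    define z2 where "z2 = snd z - (E2.n p \<bullet> snd z) *\<^sub>R E2.n p"
    have z: "E1.n p \<bullet> z1 = 0" "E2.n p \<bullet> z2 = 0"
      by (simp_all add: z1_def z2_def inner_diff_right E1.n_unit[OF p] E2.n_unit[OF p])
    obtain v where "E1.t v p = z1" "E2.t v p = z2" using e_surj[OF p z] .
    then have "fst z \<bullet> z1 + snd z \<bullet> z2 = 0" using perp[of v] by (simp add: e_Pair[OF p] inner_prod_def)
    moreover have "z1 \<bullet> z1 = fst z \<bullet> z1 - (E1.n p \<bullet> fst z) * (E1.n p \<bullet> z1)"
      by (subst (1) z1_def) (simp add: inner_diff_left)
    moreover have "z2 \<bullet> z2 = snd z \<bullet> z2 - (E2.n p \<bullet> snd z) * (E2.n p \<bullet> z2)"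
      by (subst (1) z2_def) (simp add: inner_diff_left)
    ultimately have "z1 \<bullet> z1 + z2 \<bullet> z2 = 0" using z by simp
    then have "z1 = 0" "z2 = 0"
      by (simp_all add: add_nonneg_eq_0_iff)
    then show "fst x - fst (tang p x) = (E1.n p \<bullet> fst x) *\<^sub>R E1.n p"
        "snd x - snd (tang p x) = (E2.n p \<bullet> snd x) *\<^sub>R E2.n p"
      using tn by (simp_all add: z1_def z2_def z_def inner_diff_right)
  qed
  have "x \<bullet> y - tang p x \<bullet> tang p y = (x - tang p x) \<bullet> (y - tang p y)"
    using tang_inner[OF p, of x y] tang_inner[OF p, of y x]
    by (simp add: inner_diff_left inner_diff_right inner_commute)
  then show ?thesis
    by (simp add: inner_prod_def nt E1.n_unit[OF p] E2.n_unit[OF p])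
qed

section \<open>Curvature tensors in terms of the two pulled back factor metrics\<close>

abbreviation P :: "real^4 \<Rightarrow> 4 \<Rightarrow> 4 \<Rightarrow> real" where
  "P p i j \<equiv> partial_deriv i \<psi>1 p \<bullet> partial_deriv j \<psi>1 p"

abbreviation Q :: "real^4 \<Rightarrow> 4 \<Rightarrow> 4 \<Rightarrow> real" where
  "Q p i j \<equiv> partial_deriv i \<psi>2 p \<bullet> partial_deriv j \<psi>2 p"

lemma gram_PQ: "p \<in> U \<Longrightarrow> gram p $ i $ j = P p i j + Q p i j"
  by (simp add: pd_Pair inner_prod_def)

lemma second_Pair:
  assumes p: "p \<in> U"
  shows "second i j p = (partial_deriv i (partial_deriv j \<psi>1) p, partial_deriv i (partial_deriv j \<psi>2) p)"
proof -
  have "second i j p = partial_deriv i (\<lambda>p. (partial_deriv j \<psi>1 p, partial_deriv j \<psi>2 p)) p"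
    unfolding partial_deriv_eq_dir_deriv[of i]
    by (rule dir_deriv_cong_open[OF open_U p]) (rule pd_Pair)
  also have "\<dots> = (partial_deriv i (partial_deriv j \<psi>1) p, partial_deriv i (partial_deriv j \<psi>2) p)"
    unfolding partial_deriv_eq_dir_deriv[of i]
    by (intro dir_deriv_Pair smooth_on_differentiable[OF _ p] smooth_on_partial_deriv E1.smooth_sigma E2.smooth_sigma)
  finally show ?thesis .
qed

text \<open>The second fundamental form has one component along each factor normal, given by
  \<open>diag a\<close> and \<open>diag b\<close> up to sign and scale. No mixed products occur in
  the Gauss equation, and \<open>diag_curvature\<close> evaluates the minors of each
  component.\<close>

lemma riem_PQ:
  assumes p: "p \<in> U"
  shows "riem gram p i j k l = E1.K p * (P p i k * P p j l - P p i l * P p j k)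
    + E2.K p * (Q p i k * Q p j l - Q p i l * Q p j k)"
proof -
  let ?s1 = "\<lambda>i k. diag a (partial_deriv i \<psi>1 p) \<bullet> partial_deriv k \<psi>1 p"
  let ?s2 = "\<lambda>i k. diag b (partial_deriv i \<psi>2 p) \<bullet> partial_deriv k \<psi>2 p"
  have B: "second i k p \<bullet> second j l p - tang p (second i k p) \<bullet> tang p (second j l p)
      = ?s1 i k * ?s1 j l / (E1.N p \<bullet> E1.N p) + ?s2 i k * ?s2 j l / (E2.N p \<bullet> E2.N p)" for i j k l
    unfolding normal_part[OF p]
    by (simp add: second_Pair[OF p])
      (simp add: partial_deriv_eq_dir_deriv E1.n_inner_dt[OF p] E2.n_inner_dt[OF p]
        flip: E1.nrm_sq[OF p] E2.nrm_sq[OF p])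
  have 1: "(?s1 i k * ?s1 j l - ?s1 i l * ?s1 j k) / (E1.N p \<bullet> E1.N p) = E1.K p * (P p i k * P p j l - P p i l * P p j k)"
    unfolding partial_deriv_eq_dir_deriv
    using E1.diag_curvature[OF p, of "E1.t (axis i 1) p" "E1.t (axis j 1) p" "E1.t (axis k 1) p" "E1.t (axis l 1) p"]
      E1.N_nonzero[OF p] by (simp add: E1.n_inner_t[OF p])
  have 2: "(?s2 i k * ?s2 j l - ?s2 i l * ?s2 j k) / (E2.N p \<bullet> E2.N p) = E2.K p * (Q p i k * Q p j l - Q p i l * Q p j k)"
    unfolding partial_deriv_eq_dir_deriv
    using E2.diag_curvature[OF p, of "E2.t (axis i 1) p" "E2.t (axis j 1) p" "E2.t (axis k 1) p" "E2.t (axis l 1) p"]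
      E2.N_nonzero[OF p] by (simp add: E2.n_inner_t[OF p])
  show ?thesis
    unfolding gauss_equation[OF p] B 1[symmetric] 2[symmetric] by (simp add: diff_divide_distrib)
qed

lemma coords_e:
  assumes p: "p \<in> U" shows "(\<Sum>j\<in>UNIV. g_inv gram p i j * (pd j p \<bullet> e v p)) = v $ i"
proof -
  have "e (coords p (\<lambda>j. e v p \<bullet> pd j p)) p = e v p"
    using tang_e[OF p] by (simp add: tang_def)
  then have "coords p (\<lambda>j. e v p \<bullet> pd j p) = v" using inj_deriv[OF p] by (auto dest: injD)
  then have "coords p (\<lambda>j. e v p \<bullet> pd j p) $ i = v $ i" by simp
  then show ?thesis by (simp add: coords_def inner_commute)
qed

lemma trace_rank_one:
  assumes p: "p \<in> U"
  shows "(\<Sum>i\<in>UNIV. \<Sum>k\<in>UNIV. g_inv gram p i k * ((pd i p \<bullet> x) * (pd k p \<bullet> e v p))) = x \<bullet> e v p"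
proof -
  have "(\<Sum>i\<in>UNIV. \<Sum>k\<in>UNIV. g_inv gram p i k * ((pd i p \<bullet> x) * (pd k p \<bullet> e v p)))
      = (\<Sum>i\<in>UNIV. (pd i p \<bullet> x) * (\<Sum>k\<in>UNIV. g_inv gram p i k * (pd k p \<bullet> e v p)))"
    by (simp add: sum_distrib_left mult_ac)
  also have "\<dots> = x \<bullet> e v p"
    unfolding coords_e[OF p] by (simp add: e_expand[OF p] inner_sum_right mult_ac inner_commute)
  finally show ?thesis .
qed

lemma trace_P_rank_one:
  assumes p: "p \<in> U" and y: "E1.n p \<bullet> y = 0"
  shows "(\<Sum>i\<in>UNIV. \<Sum>k\<in>UNIV. g_inv gram p i k *
    ((partial_deriv i \<psi>1 p \<bullet> x) * (partial_deriv k \<psi>1 p \<bullet> y))) = x \<bullet> y"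
proof -
  obtain v where v: "E1.t v p = y" "E2.t v p = 0" using e_surj[OF p y] by (metis inner_zero_right)
  show ?thesis using trace_rank_one[OF p, of "(x, 0)" v] by (simp add: pd_Pair[OF p] e_Pair[OF p] v)
qed

lemma trace_Q_rank_one:
  assumes p: "p \<in> U" and y: "E2.n p \<bullet> y = 0"
  shows "(\<Sum>i\<in>UNIV. \<Sum>k\<in>UNIV. g_inv gram p i k *
    ((partial_deriv i \<psi>2 p \<bullet> x) * (partial_deriv k \<psi>2 p \<bullet> y))) = x \<bullet> y"
proof -
  obtain v where v: "E1.t v p = 0" "E2.t v p = y" using e_surj[OF p _ y] by (metis inner_zero_right)
  show ?thesis using trace_rank_one[OF p, of "(0, x)" v] by (simp add: pd_Pair[OF p] e_Pair[OF p] v)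
qed

text \<open>The traces are the dimensions of the factors. \<open>plane_parseval\<close> with a unit
  tangent vector and its rotation splits each form into two rank one forms of trace 1.\<close>

lemma trace_PQ:
  assumes p: "p \<in> U"
  shows "(\<Sum>i\<in>UNIV. \<Sum>k\<in>UNIV. g_inv gram p i k * P p i k) = 2"
    and "(\<Sum>i\<in>UNIV. \<Sum>k\<in>UNIV. g_inv gram p i k * Q p i k) = 2"
proof -
  obtain f1 where f1: "E1.n p \<bullet> f1 = 0" "f1 \<bullet> f1 = 1" using unit_normal_exists[of "E1.n p"] .
  have "g_inv gram p i k * P p i k = g_inv gram p i k * ((partial_deriv i \<psi>1 p \<bullet> f1) * (partial_deriv k \<psi>1 p \<bullet> f1))
      + g_inv gram p i k * ((partial_deriv i \<psi>1 p \<bullet> (E1.n p \<times> f1)) * (partial_deriv k \<psi>1 p \<bullet> (E1.n p \<times> f1)))" for i k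
    using plane_parseval[OF E1.n_unit[OF p] f1(1) E1.n_inner_t[OF p] E1.n_inner_t[OF p], of "axis i 1" "axis k 1"] f1(2)
    unfolding partial_deriv_eq_dir_deriv by (simp add: inner_commute flip: distrib_left)
  moreover have "(E1.n p \<times> f1) \<bullet> (E1.n p \<times> f1) = 1"
    by (simp add: cross_dot_cross E1.n_unit[OF p] f1)
  ultimately show "(\<Sum>i\<in>UNIV. \<Sum>k\<in>UNIV. g_inv gram p i k * P p i k) = 2"
    using trace_P_rank_one[OF p f1(1), of f1] trace_P_rank_one[OF p, of "E1.n p \<times> f1" "E1.n p \<times> f1"]
    by (simp add: sum.distrib f1 dot_cross_self)
  obtain f2 where f2: "E2.n p \<bullet> f2 = 0" "f2 \<bullet> f2 = 1" using unit_normal_exists[of "E2.n p"] .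
  have "g_inv gram p i k * Q p i k = g_inv gram p i k * ((partial_deriv i \<psi>2 p \<bullet> f2) * (partial_deriv k \<psi>2 p \<bullet> f2))
      + g_inv gram p i k * ((partial_deriv i \<psi>2 p \<bullet> (E2.n p \<times> f2)) * (partial_deriv k \<psi>2 p \<bullet> (E2.n p \<times> f2)))" for i k
    using plane_parseval[OF E2.n_unit[OF p] f2(1) E2.n_inner_t[OF p] E2.n_inner_t[OF p], of "axis i 1" "axis k 1"] f2(2)
    unfolding partial_deriv_eq_dir_deriv by (simp add: inner_commute flip: distrib_left)
  moreover have "(E2.n p \<times> f2) \<bullet> (E2.n p \<times> f2) = 1"
    by (simp add: cross_dot_cross E2.n_unit[OF p] f2)
  ultimately show "(\<Sum>i\<in>UNIV. \<Sum>k\<in>UNIV. g_inv gram p i k * Q p i k) = 2"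
    using trace_Q_rank_one[OF p f2(1), of f2] trace_Q_rank_one[OF p, of "E2.n p \<times> f2" "E2.n p \<times> f2"]
    by (simp add: sum.distrib f2 dot_cross_self)
qed

lemma ricci_PQ:
  assumes p: "p \<in> U"
  shows "ricci gram p j l = E1.K p * P p j l + E2.K p * Q p j l"
proof -
  let ?g = "g_inv gram p"
  have "ricci gram p j l = (\<Sum>i\<in>UNIV. \<Sum>k\<in>UNIV.
      E1.K p * P p j l * (?g i k * P p i k)
      - E1.K p * (?g i k * (P p i l * P p k j))
      + E2.K p * Q p j l * (?g i k * Q p i k)
      - E2.K p * (?g i k * (Q p i l * Q p k j)))"
    unfolding ricci_def riem_PQ[OF p]
    by (intro sum.cong refl) (simp add: algebra_simps inner_commute)
  also have "\<dots> = E1.K p * P p j l * 2 - E1.K p * P p l j + E2.K p * Q p j l * 2 - E2.K p * Q p l j"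
    unfolding sum.distrib sum_subtractf
    unfolding sum_distrib_left[symmetric]
      trace_PQ[OF p] trace_P_rank_one[OF p E1.n_inner_t[OF p, of "axis j 1", folded partial_deriv_eq_dir_deriv]]
      trace_Q_rank_one[OF p E2.n_inner_t[OF p, of "axis j 1", folded partial_deriv_eq_dir_deriv]] ..
  finally show ?thesis by (simp add: inner_commute)
qed

lemma scal_PQ:
  assumes p: "p \<in> U"
  shows "scal gram p = 2 * (E1.K p + E2.K p)"
proof -
  have "scal gram p = (\<Sum>i\<in>UNIV. \<Sum>k\<in>UNIV.
      E1.K p * (g_inv gram p i k * P p i k) + E2.K p * (g_inv gram p i k * Q p i k))"
    unfolding scal_def ricci_PQ[OF p]
    by (intro sum.cong refl) (simp add: algebra_simps)
  also have "\<dots> = E1.K p * 2 + E2.K p * 2"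
    unfolding sum.distrib
    unfolding sum_distrib_left[symmetric] trace_PQ[OF p] ..
  finally show ?thesis by simp
qed

text \<open>In dimension 4 the divisors are 2 and 6. With S = \<open>K1 + K2\<close> and scalar
  curvature 2 S, the unmixed terms give K - K + S/3 for either curvature K, and the mixed ones - S/2
  + S/3, so only S survives.\<close>

lemma weyl_PQ:
  assumes p: "p \<in> U"
  shows "weyl gram p i j k l = (E1.K p + E2.K p) / 3 *
      ((P p i k * P p j l - P p i l * P p j k) + (Q p i k * Q p j l - Q p i l * Q p j k))
    - (E1.K p + E2.K p) / 6 *
      ((P p i k * Q p j l - P p i l * Q p j k) + (Q p i k * P p j l - Q p i l * P p j k))"
  unfolding weyl_def Let_def riem_PQ[OF p] ricci_PQ[OF p] scal_PQ[OF p] gram_PQ[OF p]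
  by (simp add: field_simps)

section \<open>The Weyl operator on bivectors with one leg in the first factor\<close>

lemma pd_contract:
  assumes p: "p \<in> U"
  shows "(\<Sum>k\<in>UNIV. v $ k * P p i k) = partial_deriv i \<psi>1 p \<bullet> E1.t v p"
    "(\<Sum>k\<in>UNIV. v $ k * Q p i k) = partial_deriv i \<psi>2 p \<bullet> E2.t v p"
  by (simp_all add: dir_deriv_expand[OF E1.diff_sigma[OF p]] dir_deriv_expand[OF E2.diff_sigma[OF p]] inner_sum_right)

lemma wedge_contract:
  fixes \<beta> \<gamma> :: "4 \<Rightarrow> real"
  shows "(\<Sum>k\<in>UNIV. \<Sum>l\<in>UNIV. (\<beta> k * \<gamma> l - \<beta> l * \<gamma> k) * wedge v w $ k $ l)
    = 2 * ((\<Sum>k\<in>UNIV. v $ k * \<beta> k) * (\<Sum>k\<in>UNIV. w $ k * \<gamma> k)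
      - (\<Sum>k\<in>UNIV. w $ k * \<beta> k) * (\<Sum>k\<in>UNIV. v $ k * \<gamma> k))"
  unfolding wedge_def sum_4 by (simp add: algebra_simps)

text \<open>The factor 2 comes from summing over ordered pairs \<open>k, l\<close> and cancels the
  halving in \<open>weyl_operator\<close>. Since \<open>v\<close> has no second component, the two
  mixed terms combine into the second component of \<open>w'\<close>.\<close>

lemma weyl_contract:
  assumes p: "p \<in> U" and v: "E2.t v p = 0" "E1.t v p \<bullet> E1.t w p = 0"
    and w': "E1.t w' p = ((E1.K p + E2.K p) / 3) *\<^sub>R E1.t w p"
      "E2.t w' p = (- (E1.K p + E2.K p) / 6) *\<^sub>R E2.t w p"
  shows "(\<Sum>k\<in>UNIV. \<Sum>l\<in>UNIV. weyl gram p i j k l * wedge v w $ k $ l)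
    = 2 * ((pd i p \<bullet> e v p) * (pd j p \<bullet> e w' p) - (pd j p \<bullet> e v p) * (pd i p \<bullet> e w' p))"
proof -
  have "(\<Sum>k\<in>UNIV. \<Sum>l\<in>UNIV. weyl gram p i j k l * wedge v w $ k $ l)
    = (\<Sum>k\<in>UNIV. \<Sum>l\<in>UNIV.
      (E1.K p + E2.K p) / 3 * ((P p i k * P p j l - P p i l * P p j k) * wedge v w $ k $ l)
      + (E1.K p + E2.K p) / 3 * ((Q p i k * Q p j l - Q p i l * Q p j k) * wedge v w $ k $ l)
      - (E1.K p + E2.K p) / 6 * ((P p i k * Q p j l - P p i l * Q p j k) * wedge v w $ k $ l)
      - (E1.K p + E2.K p) / 6 * ((Q p i k * P p j l - Q p i l * P p j k) * wedge v w $ k $ l))"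
    unfolding weyl_PQ[OF p]
    by (intro sum.cong refl) algebra
  also have "\<dots> = (E1.K p + E2.K p) / 3 * (2 * ((partial_deriv i \<psi>1 p \<bullet> E1.t v p) * (partial_deriv j \<psi>1 p \<bullet> E1.t w p)
        - (partial_deriv i \<psi>1 p \<bullet> E1.t w p) * (partial_deriv j \<psi>1 p \<bullet> E1.t v p)))
      - (E1.K p + E2.K p) / 6 * (2 * ((partial_deriv i \<psi>1 p \<bullet> E1.t v p) * (partial_deriv j \<psi>2 p \<bullet> E2.t w p)))
      + (E1.K p + E2.K p) / 6 * (2 * ((partial_deriv i \<psi>2 p \<bullet> E2.t w p) * (partial_deriv j \<psi>1 p \<bullet> E1.t v p)))"
    unfolding sum.distrib sum_subtractf
    unfolding sum_distrib_left[symmetric] wedge_contract pd_contract[OF p]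
    by (simp add: v)
  also have "\<dots> = 2 * ((pd i p \<bullet> e v p) * (pd j p \<bullet> e w' p) - (pd j p \<bullet> e v p) * (pd i p \<bullet> e w' p))"
    by (simp add: pd_Pair[OF p] e_Pair[OF p] v w') (simp add: field_simps)
  finally show ?thesis .
qed

theorem eigenflag_at_gram:
  assumes p: "p \<in> U"
  shows "eigenflag_at gram p"
proof -
  obtain f where f: "E1.n p \<bullet> f = 0" "f \<bullet> f = 1" using unit_normal_exists[of "E1.n p"] .
  obtain v where v: "E1.t v p = f" "E2.t v p = 0" using e_surj[OF p f(1)] by (metis inner_zero_right)
  have "v \<noteq> 0" using v(1) f(2) linear_0[OF linear_dir_deriv[OF E1.diff_sigma[OF p]]] by force
  moreover have "weyl_operator gram p (wedge v w) \<in> wedge_perp gram p v" if "g_inner gram p v w = 0" for w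
  proof -
    have vw: "f \<bullet> E1.t w p = 0"
      using that by (simp add: g_inner_gram[OF p] e_Pair[OF p] v)
    \<comment> \<open>The operator rescales the two components of \<open>w\<close> separately. The
      first remains a multiple of that of \<open>w\<close>, which keeps \<open>w'\<close>
      perpendicular to \<open>v\<close>.\<close>
    obtain w' where w': "E1.t w' p = ((E1.K p + E2.K p) / 3) *\<^sub>R E1.t w p"
        "E2.t w' p = (- (E1.K p + E2.K p) / 6) *\<^sub>R E2.t w p"
      by (rule e_surj[OF p, of "((E1.K p + E2.K p) / 3) *\<^sub>R E1.t w p" "(- (E1.K p + E2.K p) / 6) *\<^sub>R E2.t w p"])
        (simp_all add: E1.n_inner_t[OF p] E2.n_inner_t[OF p])
    have "weyl_operator gram p (wedge v w) $ i $ j = wedge v w' $ i $ j" for i j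
    proof -
      have "weyl_operator gram p (wedge v w) $ i $ j = (\<Sum>a\<in>UNIV. \<Sum>b\<in>UNIV. g_inv gram p i a * g_inv gram p j b *
          (\<Sum>k\<in>UNIV. \<Sum>l\<in>UNIV. weyl gram p a b k l * wedge v w $ k $ l)) / 2"
        by (simp add: weyl_operator_def sum_distrib_left mult_ac)
      also have "\<dots> = (\<Sum>a\<in>UNIV. \<Sum>b\<in>UNIV.
          (g_inv gram p i a * (pd a p \<bullet> e v p)) * (g_inv gram p j b * (pd b p \<bullet> e w' p))
          - (g_inv gram p i a * (pd a p \<bullet> e w' p)) * (g_inv gram p j b * (pd b p \<bullet> e v p)))"
        using v vw
        by (simp add: weyl_contract[OF p _ _ w'] sum_divide_distrib) (simp add: algebra_simps diff_divide_distrib)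
      also have "\<dots> = wedge v w' $ i $ j"
        by (simp add: sum_subtractf flip: sum_distrib_left sum_distrib_right)
          (simp add: coords_e[OF p] wedge_def)
      finally show ?thesis .
    qed
    then have "weyl_operator gram p (wedge v w) = wedge v w'" by (simp add: vec_eq_iff)
    moreover have "g_inner gram p v w' = 0"
      by (simp add: g_inner_gram[OF p] e_Pair[OF p] v w' vw)
    ultimately show ?thesis unfolding wedge_perp_def by blast
  qed
  ultimately show ?thesis
    unfolding eigenflag_at_def by (intro exI[of _ v]) (auto simp: wedge_perp_def)
qed

end

section \<open>Concircular fields on a scalene ellipsoid\<close>

text \<open>Testing the derivative of \<alpha> against tangent vectors only makes
  \<open>concircular\<close> a statement about the covariant derivative on the surface;
  \<open>chart_surj\<close> lets all objects live on a domain of larger dimension.\<close>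

locale concircular_field = ellipsoid_map U \<sigma> a
  for U :: "(real^'n::finite) set" and \<sigma> :: "real^'n \<Rightarrow> real^3" and a :: "real^3" +
  fixes \<alpha> :: "real^'n::finite \<Rightarrow> real^3" and \<kappa> :: "real^'n \<Rightarrow> real"
  assumes chart_surj: "\<And>p x. p \<in> U \<Longrightarrow> n p \<bullet> x = 0 \<Longrightarrow> \<exists>v. t v p = x"
    and smooth_alpha: "smooth_on U \<alpha>" and smooth_kappa: "smooth_on U \<kappa>"
    and alpha_tangent: "\<And>p. p \<in> U \<Longrightarrow> n p \<bullet> \<alpha> p = 0"
    and alpha_nonzero: "\<And>p. p \<in> U \<Longrightarrow> \<alpha> p \<noteq> 0"
    and concircular: "\<And>p v w. p \<in> U \<Longrightarrow> dir_deriv v \<alpha> p \<bullet> t w p = - \<kappa> p * (t v p \<bullet> t w p)"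
    and a_distinct: "\<And>i j. i \<noteq> j \<Longrightarrow> a $ i \<noteq> a $ j"
begin

lemma normal_eqI:
  assumes p: "p \<in> U" and "\<And>v. x \<bullet> t v p = 0"
  shows "x = (n p \<bullet> x) *\<^sub>R n p"
proof -
  define y where "y = x - (n p \<bullet> x) *\<^sub>R n p"
  have ny: "n p \<bullet> y = 0" by (simp add: y_def inner_diff_right n_unit[OF p])
  then obtain v where v: "t v p = y" using chart_surj[OF p] by blast
  have "y \<bullet> y = x \<bullet> y - (n p \<bullet> x) * (n p \<bullet> y)"
    by (subst (1) y_def) (simp add: inner_diff_left)
  then have "y = 0" using assms(2)[of v] v ny by simp
  then show ?thesis by (simp add: y_def)
qed

text \<open>The vector on the left is normal, and its length comes from differentiating
  \<open>n x \<bullet> \<alpha> x = 0\<close>. Pairing it with a second derivative of \<sigma> gives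
  a product of two second fundamental forms, ready for antisymmetrization.\<close>

lemma dalpha_normal:
  assumes p: "p \<in> U"
  shows "(dir_deriv v \<alpha> p + \<kappa> p *\<^sub>R t v p) \<bullet> dir_deriv u (dir_deriv w \<sigma>) p
    = (diag a (t v p) \<bullet> \<alpha> p) * (diag a (t u p) \<bullet> t w p) / (N p \<bullet> N p)"
proof -
  define Z where "Z = dir_deriv v \<alpha> p + \<kappa> p *\<^sub>R t v p"
  have "Z \<bullet> t w p = 0" for w by (simp add: Z_def inner_add_left concircular[OF p])
  then have Z: "Z = (n p \<bullet> Z) *\<^sub>R n p" by (rule normal_eqI[OF p])
  have "dir_deriv v (\<lambda>x. n x \<bullet> \<alpha> x) p = dir_deriv v (\<lambda>x. 0) p"
    by (rule dir_deriv_cong_open[OF open_dom p]) (simp add: alpha_tangent)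
  then have "n p \<bullet> Z = - (diag a (t v p) \<bullet> \<alpha> p / nrm p)"
    using dn_inner[OF p alpha_tangent[OF p], of v]
    by (simp add: dir_deriv_inner[OF smooth_n smooth_alpha p] Z_def inner_add_right n_inner_t[OF p])
  moreover have "Z \<bullet> y = (n p \<bullet> Z) * (n p \<bullet> y)" for y
    by (subst Z) simp
  ultimately show ?thesis
    by (simp add: n_inner_dt[OF p] flip: Z_def nrm_sq[OF p])
qed

lemma plane_complement:
  assumes p: "p \<in> U"
  obtains u where "t u p \<bullet> t v p = 0" "t u p \<noteq> 0"
proof -
  obtain y where y: "n p \<bullet> y = 0" "y \<bullet> t v p = 0" "y \<noteq> 0"
  proof (cases "t v p = 0")
    case True
    obtain f where "n p \<bullet> f = 0" "f \<bullet> f = 1" using unit_normal_exists .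
    then show ?thesis using that True by force
  next
    case False
    have "(n p \<times> t v p) \<bullet> (n p \<times> t v p) = t v p \<bullet> t v p"
      by (simp add: cross_dot_cross n_unit[OF p] n_inner_t[OF p])
    then have "n p \<times> t v p \<noteq> 0" using False by force
    then show ?thesis using that[of "n p \<times> t v p"] by (simp add: dot_cross_self)
  qed
  then show thesis using chart_surj[OF p y(1)] that by blast
qed

text \<open>This is the Ricci identity for \<alpha>: R(u,v)\<alpha> equals d\<kappa>(v) u -
  d\<kappa>(u) v, and on a surface also K times the rotation term. Testing against a nonzero
  \<open>u\<close> perpendicular to \<open>v\<close> leaves the claim.\<close>

lemma dir_deriv_kappa:
  assumes p: "p \<in> U"
  shows "dir_deriv v \<kappa> p = K p * (\<alpha> p \<bullet> t v p)"
proof -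
  have D: "dir_deriv u (dir_deriv v \<alpha>) p \<bullet> t w p + dir_deriv v \<alpha> p \<bullet> dir_deriv u (dir_deriv w \<sigma>) p
      = - (dir_deriv u \<kappa> p * (t v p \<bullet> t w p) + \<kappa> p * (dir_deriv u (dir_deriv v \<sigma>) p \<bullet> t w p
        + t v p \<bullet> dir_deriv u (dir_deriv w \<sigma>) p))" for u v w
  proof -
    have "dir_deriv u (\<lambda>x. dir_deriv v \<alpha> x \<bullet> t w x) p = dir_deriv u (\<lambda>x. - (\<kappa> x * (t v x \<bullet> t w x))) p"
      by (rule dir_deriv_cong_open[OF open_dom p]) (simp add: concircular)
    also have "\<dots> = - dir_deriv u (\<lambda>x. \<kappa> x * (t v x \<bullet> t w x)) p"
      by (rule dir_deriv_bounded_linear[OF bounded_linear_minus[OF bounded_linear_ident]])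
        (intro smooth_on_differentiable[OF _ p] smooth_on_mult smooth_on_inner smooth_t smooth_kappa open_dom)
    also have "dir_deriv u (\<lambda>x. \<kappa> x * (t v x \<bullet> t w x)) p
        = \<kappa> p * dir_deriv u (\<lambda>x. t v x \<bullet> t w x) p + dir_deriv u \<kappa> p * (t v p \<bullet> t w p)"
      by (rule dir_deriv_bilinear[OF bounded_bilinear_mult])
        (intro smooth_on_differentiable[OF _ p] smooth_on_inner smooth_t smooth_kappa open_dom)+
    finally show ?thesis
      by (simp add: dir_deriv_inner[OF smooth_on_dir_deriv[OF open_dom smooth_alpha] smooth_t p]
          dir_deriv_inner[OF smooth_t smooth_t p] algebra_simps)
  qed
  obtain u where u: "t u p \<bullet> t v p = 0" "t u p \<noteq> 0" using plane_complement[OF p] .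
  have Z: "(dir_deriv v \<alpha> p + \<kappa> p *\<^sub>R t v p) \<bullet> dir_deriv u (dir_deriv u \<sigma>) p
      - (dir_deriv u \<alpha> p + \<kappa> p *\<^sub>R t u p) \<bullet> dir_deriv v (dir_deriv u \<sigma>) p
      = dir_deriv v \<kappa> p * (t u p \<bullet> t u p)"
    using D[of u v u] D[of v u u] dir_deriv_commute[OF smooth_alpha open_dom p, of u v]
      dir_deriv_commute[OF smooth_sigma open_dom p, of u v] u
    by (simp add: inner_add_left inner_commute algebra_simps)
  have "(diag a (t v p) \<bullet> \<alpha> p) * (diag a (t u p) \<bullet> t u p) - (diag a (t v p) \<bullet> t u p) * (diag a (t u p) \<bullet> \<alpha> p)
      = N p \<bullet> N p * K p * ((t v p \<bullet> \<alpha> p) * (t u p \<bullet> t u p) - (t v p \<bullet> t u p) * (t u p \<bullet> \<alpha> p))"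
    using diag_curvature[OF p n_inner_t[OF p] n_inner_t[OF p] alpha_tangent[OF p] n_inner_t[OF p]] .
  then have "K p * (t v p \<bullet> \<alpha> p) * (t u p \<bullet> t u p) = ((diag a (t v p) \<bullet> \<alpha> p) * (diag a (t u p) \<bullet> t u p)
      - (diag a (t v p) \<bullet> t u p) * (diag a (t u p) \<bullet> \<alpha> p)) / (N p \<bullet> N p)"
    using u N_nonzero[OF p] by (simp add: inner_commute)
  also have "\<dots> = dir_deriv v \<kappa> p * (t u p \<bullet> t u p)"
    unfolding Z[symmetric] dalpha_normal[OF p] by (simp add: diff_divide_distrib mult_ac)
  finally show ?thesis using u(2) by (simp add: inner_commute)
qed

text \<open>The 1-form \<open>\<alpha>\<close> is closed, so the coefficient of any closed multiple of \<open>\<alpha>\<close> has differential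
  proportional to \<open>\<alpha>\<close>.\<close>

lemma coefficient_parallel:
  assumes p: "p \<in> U" and k: "smooth_on U k" and F: "smooth_on U F"
    and dF: "\<And>x v. x \<in> U \<Longrightarrow> dir_deriv v F x = k x * (\<alpha> x \<bullet> t v x)"
  shows "dir_deriv u k p * (\<alpha> p \<bullet> t v p) = dir_deriv v k p * (\<alpha> p \<bullet> t u p)"
proof -
  have "dir_deriv u (dir_deriv v F) p = k p * (\<alpha> p \<bullet> dir_deriv u (dir_deriv v \<sigma>) p - \<kappa> p * (t u p \<bullet> t v p))
      + dir_deriv u k p * (\<alpha> p \<bullet> t v p)" for u v
  proof -
    have "dir_deriv u (dir_deriv v F) p = dir_deriv u (\<lambda>x. k x * (\<alpha> x \<bullet> t v x)) p"
      by (rule dir_deriv_cong_open[OF open_dom p]) (simp add: dF)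
    also have "\<dots> = k p * dir_deriv u (\<lambda>x. \<alpha> x \<bullet> t v x) p + dir_deriv u k p * (\<alpha> p \<bullet> t v p)"
      by (rule dir_deriv_bilinear[OF bounded_bilinear_mult])
        (intro smooth_on_differentiable[OF _ p] smooth_on_inner smooth_t smooth_alpha k open_dom)+
    finally show ?thesis
      by (simp add: dir_deriv_inner[OF smooth_alpha smooth_t p] concircular[OF p])
  qed
  from this[of u v] this[of v u] show ?thesis
    using dir_deriv_commute[OF F open_dom p, of u v] dir_deriv_commute[OF smooth_sigma open_dom p, of u v]
    by (simp add: inner_commute)
qed

lemma tangential_multiple:
  assumes p: "p \<in> U" and par: "\<And>u v. (x \<bullet> t u p) * (\<alpha> p \<bullet> t v p) = (x \<bullet> t v p) * (\<alpha> p \<bullet> t u p)"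
  shows "x = (x \<bullet> \<alpha> p / (\<alpha> p \<bullet> \<alpha> p)) *\<^sub>R \<alpha> p + (n p \<bullet> x) *\<^sub>R n p"
proof -
  define k where "k = x \<bullet> \<alpha> p / (\<alpha> p \<bullet> \<alpha> p)"
  obtain u where u: "t u p = \<alpha> p" using chart_surj[OF p alpha_tangent[OF p]] by blast
  have "(x - k *\<^sub>R \<alpha> p) \<bullet> t v p = 0" for v
    using par[of u v] alpha_nonzero[OF p] unfolding u by (simp add: inner_diff_left k_def field_simps)
  from normal_eqI[OF p this] show ?thesis
    by (simp add: inner_diff_right alpha_tangent[OF p] k_def[symmetric] algebra_simps)
qed

text \<open>Half the ambient gradient of the function \<open>m2\<close>; its tangential part is
  therefore the gradient of \<open>m2 / 2\<close> on the surface.\<close>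

definition q :: "real^'n \<Rightarrow> real^3" where "q p = diag a (N p)"

lemma smooth_q: "smooth_on U q"
  unfolding q_def[abs_def] by (rule smooth_on_bounded_linear[OF open_dom bounded_linear_diag smooth_N])

lemma dir_deriv_q: "p \<in> U \<Longrightarrow> dir_deriv v q p = diag a (diag a (t v p))"
  unfolding q_def[abs_def]
  by (subst dir_deriv_bounded_linear[OF bounded_linear_diag smooth_on_differentiable[OF smooth_N]])
    (simp_all add: dir_deriv_N)

definition m2 where "m2 p = N p \<bullet> N p"
definition m3 where "m3 p = N p \<bullet> q p"
definition m4 where "m4 p = q p \<bullet> q p"

lemma dir_deriv_m:
  assumes "p \<in> U"
  shows "dir_deriv v m2 p = 2 * (q p \<bullet> t v p)"
    "dir_deriv v m3 p = 2 * (diag a (q p) \<bullet> t v p)"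
    "dir_deriv v m4 p = 2 * (diag a (diag a (q p)) \<bullet> t v p)"
  unfolding m2_def[abs_def] m3_def[abs_def] m4_def[abs_def]
  by (simp_all add: dir_deriv_inner[OF smooth_N smooth_N assms] dir_deriv_inner[OF smooth_N smooth_q assms]
      dir_deriv_inner[OF smooth_q smooth_q assms] dir_deriv_N[OF assms] dir_deriv_q[OF assms])
    (simp_all add: inner_commute[of "diag a (t v p)"] inner_commute[of "diag a (diag a (t v p))"]
      inner_commute[of "diag a (diag a (diag a (t v p)))"] diag_sym[symmetric] q_def)

lemma smooth_m: "smooth_on U m2" "smooth_on U m3" "smooth_on U m4"
  unfolding m2_def[abs_def] m3_def[abs_def] m4_def[abs_def]
  by (intro smooth_on_inner smooth_N smooth_q open_dom)+

lemma m2_pos: "p \<in> U \<Longrightarrow> m2 p > 0"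
  by (simp add: m2_def N_nonzero)

text \<open>The coefficient of \<alpha> in the tangential part of \<open>q\<close>, once that part
  is known to be a multiple of \<alpha>.\<close>

definition k where "k p = q p \<bullet> \<alpha> p / (\<alpha> p \<bullet> \<alpha> p)"

lemma smooth_k: "smooth_on U k"
  unfolding k_def[abs_def]
  by (intro smooth_on_divide smooth_on_inner smooth_q smooth_alpha open_dom) (simp add: alpha_nonzero)

text \<open>\<open>K\<close> is the coefficient of \<alpha> in the exact form d\<kappa>, so dK is
  proportional to \<alpha>. Since \<open>K\<close> is a constant over the square of
  \<open>m2\<close>, the same holds for the differential of \<open>m2\<close>.\<close>

lemma dm2_parallel:
  assumes p: "p \<in> U"
  shows "(q p \<bullet> t u p) * (\<alpha> p \<bullet> t v p) = (q p \<bullet> t v p) * (\<alpha> p \<bullet> t u p)"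
proof -
  define c where "c = a $ 1 * a $ 2 * a $ 3"
  have K: "K x = c * inverse (m2 x * m2 x)" for x
    by (simp add: K_def c_def m2_def power2_eq_square field_simps)
  have smK: "smooth_on U K"
    unfolding K[abs_def] using m2_pos
    by (intro smooth_on_mult smooth_on_inverse smooth_on_const smooth_m open_dom) force
  have c: "c > 0" using a_pos by (simp add: c_def)
  have dK: "dir_deriv u K p = - (4 * c * (q p \<bullet> t u p) * inverse (m2 p ^ 3))" for u
  proof -
    have dm: "m2 differentiable at p" using smooth_on_differentiable[OF smooth_m(1) p] .
    have "dir_deriv u K p = c * dir_deriv u (\<lambda>x. inverse (m2 x * m2 x)) p"
      unfolding K[abs_def]
      by (rule dir_deriv_bounded_linear[OF bounded_linear_mult_right])
        (use m2_pos[OF p] dm in \<open>auto intro!: differentiable_inverse differentiable_mult\<close>)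
    also have "dir_deriv u (\<lambda>x. inverse (m2 x * m2 x)) p
        = - (dir_deriv u (\<lambda>x. m2 x * m2 x) p * (inverse (m2 p * m2 p) * inverse (m2 p * m2 p)))"
      by (rule dir_deriv_inverse) (use m2_pos[OF p] dm in \<open>auto intro!: differentiable_mult\<close>)
    also have "dir_deriv u (\<lambda>x. m2 x * m2 x) p = 2 * (m2 p * dir_deriv u m2 p)"
      by (simp add: dir_deriv_bilinear[OF bounded_bilinear_mult dm dm])
    finally show ?thesis
      using m2_pos[OF p] by (simp add: dir_deriv_m[OF p] field_simps power3_eq_cube)
  qed
  show ?thesis
    using coefficient_parallel[OF p smK smooth_kappa dir_deriv_kappa, of u v] c m2_pos[OF p]
    unfolding dK by simp
qed

lemma q_decomposition:
  assumes p: "p \<in> U" shows "q p = k p *\<^sub>R \<alpha> p + (n p \<bullet> q p) *\<^sub>R n p"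
  unfolding k_def by (rule tangential_multiple[OF p dm2_parallel[OF p]])

text \<open>Half the gradient of \<open>m4 - m3\<^sup>2 / m2\<close>, the squared length of the tangential part of \<open>q\<close>.\<close>

definition \<rho> where
  "\<rho> p = diag a (diag a (q p)) - (2 * (m3 p / m2 p)) *\<^sub>R diag a (q p) + (m3 p / m2 p)\<^sup>2 *\<^sub>R q p"

text \<open>The squared tangential length \<open>R\<close> of \<open>q\<close> is k^2 |\<alpha>|^2.
  Here dk is proportional to \<alpha> because k \<alpha> is the differential of
  \<open>m2 / 2\<close>, and d|\<alpha>|^2 = - 2 \<kappa> \<alpha> by concircularity. Hence dR is
  proportional to \<alpha>, while its expression through the moments is 2 \<rho>.\<close>

lemma rho_parallel:
  assumes p: "p \<in> U"
  shows "(\<rho> p \<bullet> t u p) * (\<alpha> p \<bullet> t v p) = (\<rho> p \<bullet> t v p) * (\<alpha> p \<bullet> t u p)"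
proof -
  define R where "R x = m4 x - m3 x * m3 x / m2 x" for x
  have R: "R x = k x * k x * (\<alpha> x \<bullet> \<alpha> x)" if x: "x \<in> U" for x
  proof -
    have "q x \<bullet> q x = k x * k x * (\<alpha> x \<bullet> \<alpha> x) + (n x \<bullet> q x) * (n x \<bullet> q x)"
      by (subst (1 2) q_decomposition[OF x])
        (simp add: inner_add_left inner_add_right alpha_tangent[OF x] inner_commute[of "\<alpha> x" "n x"] n_unit[OF x])
    moreover have "(n x \<bullet> q x) * (n x \<bullet> q x) = m3 x * m3 x / m2 x"
      by (simp add: n_def m3_def m2_def divide_inverse mult_ac flip: nrm_sq[OF x])
    ultimately show ?thesis by (simp add: R_def m4_def)
  qed
  have dk: "dir_deriv u k p * (\<alpha> p \<bullet> t v p) = dir_deriv v k p * (\<alpha> p \<bullet> t u p)" for u v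
  proof (rule coefficient_parallel[OF p smooth_k])
    show "smooth_on U (\<lambda>x. m2 x / 2)" by (intro smooth_on_divide smooth_on_const smooth_m open_dom) simp
    show "dir_deriv v (\<lambda>x. m2 x / 2) x = k x * (\<alpha> x \<bullet> t v x)" if x: "x \<in> U" for x v
    proof -
      have "dir_deriv v (\<lambda>x. m2 x / 2) x = q x \<bullet> t v x"
        by (subst dir_deriv_bounded_linear[OF bounded_linear_divide smooth_on_differentiable[OF smooth_m(1) x]])
          (simp add: dir_deriv_m[OF x])
      also have "\<dots> = k x * (\<alpha> x \<bullet> t v x)"
        by (subst q_decomposition[OF x]) (simp add: inner_add_left n_inner_t[OF x])
      finally show ?thesis .
    qed
  qed
  have dR: "dir_deriv u R p = 2 * (\<rho> p \<bullet> t u p)" for u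
  proof -
    have 1: "R x = m4 x - m3 x * (m3 x * inverse (m2 x))" for x by (simp add: R_def divide_inverse)
    note ds = smooth_on_differentiable[OF smooth_m(1) p] smooth_on_differentiable[OF smooth_m(2) p]
      smooth_on_differentiable[OF smooth_m(3) p]
    have m: "m2 p \<noteq> 0" using m2_pos[OF p] by simp
    have "((\<lambda>x. m4 x - m3 x * (m3 x * inverse (m2 x))) has_derivative (\<lambda>v. dir_deriv v m4 p -
       (m3 p * (m3 p * - (inverse (m2 p) * dir_deriv v m2 p * inverse (m2 p)) + dir_deriv v m3 p * inverse (m2 p))
       + dir_deriv v m3 p * (m3 p * inverse (m2 p))))) (at p)"
      by (intro has_derivative_diff has_derivative_mult Deriv.has_derivative_inverse m has_derivative_dir_deriv ds)
    from dir_deriv_unique[OF this, of u] show ?thesis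
      unfolding 1[abs_def] dir_deriv_m[OF p] using m
      by (simp add: \<rho>_def inner_add_left inner_diff_left divide_inverse power2_eq_square algebra_simps)
  qed
  have dR': "dir_deriv u R p = 2 * k p * (\<alpha> p \<bullet> \<alpha> p) * dir_deriv u k p - 2 * k p * k p * \<kappa> p * (\<alpha> p \<bullet> t u p)" for u
  proof -
    obtain w where w: "t w p = \<alpha> p" using chart_surj[OF p alpha_tangent[OF p]] by blast
    have da: "dir_deriv u \<alpha> p \<bullet> \<alpha> p = - \<kappa> p * (\<alpha> p \<bullet> t u p)"
      using concircular[OF p, of u w] by (simp add: w inner_commute)
    have "((\<lambda>x. k x * k x * (\<alpha> x \<bullet> \<alpha> x)) has_derivative (\<lambda>v. k p * k p * (\<alpha> p \<bullet> dir_deriv v \<alpha> p + dir_deriv v \<alpha> p \<bullet> \<alpha> p)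
        + (k p * dir_deriv v k p + dir_deriv v k p * k p) * (\<alpha> p \<bullet> \<alpha> p))) (at p)"
      by (intro has_derivative_mult has_derivative_inner has_derivative_dir_deriv smooth_on_differentiable[OF _ p]
          smooth_k smooth_alpha)
    from dir_deriv_unique[OF this, of u] show ?thesis
      using dir_deriv_cong_open[OF open_dom p R] da by (simp add: inner_commute algebra_simps)
  qed
  have "dir_deriv u R p * (\<alpha> p \<bullet> t v p) = dir_deriv v R p * (\<alpha> p \<bullet> t u p)"
    using dk[of u v] unfolding dR' by algebra
  then show ?thesis unfolding dR by simp
qed

text \<open>\<open>q\<close> and \<rho> lie in the plane spanned by \<alpha> and the normal, which
  also contains \<open>N\<close>; the determinant of the three vectors vanishes.\<close>

lemma scalene_relation:
  assumes p: "p \<in> U"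
  shows "\<sigma> p $ 1 * \<sigma> p $ 2 * \<sigma> p $ 3 * ((a $ 1 + a $ 2 + a $ 3) * m2 p - 2 * m3 p) = 0"
proof -
  define c where "c = m3 p / m2 p"
  have "N p \<bullet> (q p \<times> \<rho> p) = 0"
  proof -
    have N: "N p = nrm p *\<^sub>R n p" using nrm_pos[OF p] by (simp add: n_def)
    obtain s1 s2 s3 s4 where qr: "q p = s1 *\<^sub>R \<alpha> p + s2 *\<^sub>R n p" "\<rho> p = s3 *\<^sub>R \<alpha> p + s4 *\<^sub>R n p"
      using q_decomposition[OF p] tangential_multiple[OF p rho_parallel[OF p]] by blast
    show ?thesis
      unfolding N qr by (simp add: cross_add_left cross_add_right cross_mult_left cross_mult_right
          inner_add_right dot_cross_self)
  qed
  \<comment> \<open>With x for the point, the rows have entries a_i x_i, a_i^2 x_i and a_i^2 x_i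
    (a_i - c)^2. Pulling a_i x_i out of each column leaves the determinant of the rows 1, a_i, a_i^3
    - 2 c a_i^2 (a multiple of the second row is dropped), which is the Vandermonde product times
    a_1 + a_2 + a_3 - 2 c.\<close>
  then have "a $ 1 * a $ 2 * a $ 3 * ((a $ 2 - a $ 1) * (a $ 3 - a $ 1) * (a $ 3 - a $ 2))
      * (\<sigma> p $ 1 * \<sigma> p $ 2 * \<sigma> p $ 3 * (a $ 1 + a $ 2 + a $ 3 - 2 * c)) = 0"
    unfolding \<rho>_def c_def[symmetric] q_def N_def
    by (simp add: cross3_def inner_vec_def sum_3 vector_def) algebra
  moreover have "a $ i \<noteq> 0" for i using a_pos[of i] by simp
  ultimately have "\<sigma> p $ 1 * \<sigma> p $ 2 * \<sigma> p $ 3 * (a $ 1 + a $ 2 + a $ 3 - 2 * c) = 0"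
    using a_distinct[of 2 1] a_distinct[of 3 1] a_distinct[of 3 2] by simp
  then show ?thesis using m2_pos[OF p] by (auto simp: c_def)
qed

text \<open>Where a coordinate vanishes, the corresponding axis is tangent and so is attained by
  \<open>t\<close>. Were the coordinate zero on an open set, every \<open>t v p\<close> would have
  zero component along that axis.\<close>

lemma coordinate_nonzero:
  assumes W: "open W" "W \<subseteq> U" "W \<noteq> {}"
  obtains p where "p \<in> W" "\<sigma> p $ i \<noteq> 0"
proof -
  have False if z: "\<And>p. p \<in> W \<Longrightarrow> \<sigma> p $ i = 0"
  proof -
    obtain p where p: "p \<in> W" "p \<in> U" using W by blast
    have tz: "t v p $ i = 0" for v
    proof -
      have "dir_deriv v (\<lambda>x. \<sigma> x $ i) p = dir_deriv v (\<lambda>x. 0) p"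
        by (rule dir_deriv_cong_open[OF W(1) p(1)]) (simp add: z)
      then show ?thesis
        by (simp add: dir_deriv_bounded_linear[OF bounded_linear_vec_nth diff_sigma[OF p(2)]])
    qed
    have "n p \<bullet> axis i 1 = 0" by (simp add: inner_axis n_def N_def z[OF p(1)])
    then obtain v where "t v p = axis i 1" using chart_surj[OF p(2)] by blast
    then show False using tz[of v] by simp
  qed
  then show thesis using that by blast
qed

text \<open>Where all coordinates are nonzero the relation \<open>s * m2 = 2 * m3\<close> can be
  divided out and differentiated, so \<open>s q - 2 diag a q\<close> is a multiple of
  \<open>N\<close>. That multiple is zero, and the components force \<open>s = 2 * a $ i\<close> for
  more than one \<open>i\<close>.\<close>

lemma domain_empty: "U = {}"
proof (rule ccontr)
  assume ne: "U \<noteq> {}"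
  define s where "s = a $ 1 + a $ 2 + a $ 3"
  have cont: "continuous_on U (\<lambda>p. \<sigma> p $ i)" for i
    by (intro smooth_on_continuous smooth_on_nth open_dom smooth_sigma)
  define W where "W i = {p \<in> U. \<sigma> p $ i \<noteq> 0}" for i
  have oW: "open (W i)" for i
  proof -
    have "W i = U \<inter> (\<lambda>p. \<sigma> p $ i) -` (- {0})" by (auto simp: W_def)
    then show ?thesis using continuous_open_preimage[OF cont open_dom, of "- {0}"] by auto
  qed
  have "W 1 \<noteq> {}" using coordinate_nonzero[OF open_dom subset_refl ne, of 1] by (auto simp: W_def)
  then have "W 1 \<inter> W 2 \<noteq> {}"
    using coordinate_nonzero[of "W 1" 2] oW by (auto simp: W_def)
  then have "W 1 \<inter> W 2 \<inter> W 3 \<noteq> {}"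
    using coordinate_nonzero[of "W 1 \<inter> W 2" 3] oW by (auto simp: W_def)
  then obtain p where p: "p \<in> W 1 \<inter> W 2 \<inter> W 3" by blast
  then have pU: "p \<in> U" by (simp add: W_def)
  have rel: "s * m2 x - 2 * m3 x = 0" if "x \<in> W 1 \<inter> W 2 \<inter> W 3" for x
    using scalene_relation[of x] that by (simp add: W_def s_def)
  have "(s *\<^sub>R q p - 2 *\<^sub>R diag a (q p)) \<bullet> t v p = 0" for v
  proof -
    have "dir_deriv v (\<lambda>x. s * m2 x - 2 * m3 x) p = dir_deriv v (\<lambda>x. 0) p"
      by (rule dir_deriv_cong_open[of "W 1 \<inter> W 2 \<inter> W 3"]) (use oW p rel in auto)
    moreover have "((\<lambda>x. s * m2 x - 2 * m3 x) has_derivative (\<lambda>v. s * dir_deriv v m2 p - 2 * dir_deriv v m3 p)) (at p)"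
      by (intro has_derivative_diff has_derivative_mult_right has_derivative_dir_deriv
          smooth_on_differentiable[OF _ pU] smooth_m)
    ultimately show ?thesis
      using dir_deriv_unique by (fastforce simp: dir_deriv_m[OF pU] inner_diff_left)
  qed
  from normal_eqI[OF pU this] obtain c where c: "s *\<^sub>R q p - 2 *\<^sub>R diag a (q p) = c *\<^sub>R N p"
    unfolding n_def scaleR_scaleR by blast
  \<comment> \<open>Pairing with the position vector isolates \<open>c\<close>: the products of
    \<open>N\<close>, \<open>q\<close> and \<open>diag a (q p)\<close> with it are 1,
    \<open>m2\<close> and \<open>m3\<close>.\<close>
  have "c = c *\<^sub>R N p \<bullet> \<sigma> p" using on_ellipsoid[OF pU] by (simp add: N_def)
  also have "\<dots> = s * m2 p - 2 * m3 p"
    unfolding c[symmetric] by (simp add: m2_def m3_def inner_diff_left q_def N_def diag_sym inner_commute[of "diag a _" "\<sigma> p"])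
  finally have "c = 0" using rel[OF p] by simp
  have "s = 2 * a $ i" if "\<sigma> p $ i \<noteq> 0" for i
  proof -
    have "(s *\<^sub>R q p - 2 *\<^sub>R diag a (q p)) $ i = 0" using c \<open>c = 0\<close> by simp
    then have "a $ i * a $ i * \<sigma> p $ i * (s - 2 * a $ i) = 0" by (simp add: q_def N_def algebra_simps)
    then show ?thesis using that a_pos[of i] by simp
  qed
  then have "s = 2 * a $ 1" "s = 2 * a $ 2" using p by (auto simp: W_def)
  then show False using a_distinct[of 1 2] by simp
qed

end

section \<open>Limiting Carleman weights\<close>

locale carleman_immersion = immersion U \<psi>
  for U :: "(real^'n::finite) set" and \<psi> :: "real^'n \<Rightarrow> 'a::euclidean_space" +
  fixes f :: "real^'n \<Rightarrow> real"
  assumes smooth_f: "smooth_on U f" and carleman: "\<And>p. p \<in> U \<Longrightarrow> carleman_at gram f p"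
begin

definition X :: "real^'n \<Rightarrow> 'a" where "X = grad f"

definition r :: "real^'n \<Rightarrow> real" where "r p = X p \<bullet> X p"

text \<open>The tangent vector dual to the 1-form d log |X|, since
  \<open>dir_deriv v X p \<bullet> X p\<close> is half the derivative of \<open>r\<close>.\<close>

definition \<theta> :: "real^'n \<Rightarrow> 'a" where
  "\<theta> p = e (coords p (\<lambda>j. partial_deriv j X p \<bullet> X p / r p)) p"

definition lam :: "real^'n \<Rightarrow> real" where "lam p = \<theta> p \<bullet> X p"

lemma X_nonzero: "p \<in> U \<Longrightarrow> X p \<noteq> 0"
  unfolding X_def by (rule carleman_at_gramD(1)[OF smooth_f _ carleman])

lemma r_pos: "p \<in> U \<Longrightarrow> r p > 0"
  by (simp add: r_def X_nonzero)

lemma smooth_X: "smooth_on U X"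
  unfolding X_def by (rule smooth_grad[OF smooth_f])

lemma smooth_r: "smooth_on U r"
  unfolding r_def[abs_def] by (intro smooth_on_inner smooth_X open_U)

lemma smooth_theta: "smooth_on U \<theta>"
  unfolding \<theta>_def[abs_def]
  by (rule smooth_e_coords, intro smooth_on_divide smooth_on_inner smooth_on_partial_deriv smooth_X smooth_r open_U)
    (use r_pos in force)

lemma smooth_lam: "smooth_on U lam"
  unfolding lam_def[abs_def] by (intro smooth_on_inner smooth_X smooth_theta open_U)

lemma theta_inner_e: 
  assumes p: "p \<in> U" shows "\<theta> p \<bullet> e v p = dir_deriv v X p \<bullet> X p / r p"
  by (simp add: \<theta>_def e_coords_inner[OF p] dir_deriv_expand[OF smooth_on_differentiable[OF smooth_X p]]
      inner_sum_left sum_divide_distrib)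

lemma X_eq_e: "X p = e (gradient gram f p) p"
  by (simp add: X_def grad_def)

lemma dX_sym: "p \<in> U \<Longrightarrow> dir_deriv v X p \<bullet> e w p = dir_deriv w X p \<bullet> e v p"
  unfolding X_def by (rule hessian_sym[OF smooth_f])

text \<open>The weight condition fixes the Hessian on the diagonal perpendicular to X, and \<theta>
  together with symmetry fixes its row at X. The right hand side is the symmetric form with these
  data, so the difference vanishes on the diagonal and, by polarization, everywhere.\<close>

lemma carleman_hessian:
  assumes p: "p \<in> U"
  shows "dir_deriv v X p \<bullet> e w p
    = (X p \<bullet> e v p) * (\<theta> p \<bullet> e w p) + (\<theta> p \<bullet> e v p) * (X p \<bullet> e w p) - lam p * (e v p \<bullet> e w p)"
proof -
  interpret le: linear "\<lambda>v. e v p" by (rule linear_e[OF p])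
  interpret lX: linear "\<lambda>v. dir_deriv v X p" by (rule linear_dir_deriv[OF smooth_on_differentiable[OF smooth_X p]])
  define x where "x = gradient gram f p"
  have ex: "e x p = X p" by (simp add: x_def X_eq_e)
  have r: "r p > 0" by (rule r_pos[OF p])
  define h where "h v w = dir_deriv v X p \<bullet> e w p" for v w
  have hsym: "h v w = h w v" for v w unfolding h_def by (rule dX_sym[OF p])
  have hx: "h x v = r p * (\<theta> p \<bullet> e v p)" for v
    unfolding hsym[of x] theta_inner_e[OF p] using r by (simp add: h_def ex)
  have hlin: "h (v + w) z = h v z + h w z" "h z (v + w) = h z v + h z w"
    "h (c *\<^sub>R v) z = c * h v z" "h z (c *\<^sub>R v) = c * h z v" for v w z c
    by (simp_all add: h_def le.add lX.add le.scale lX.scale inner_add_left inner_add_right)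
  have perp: "h \<xi> \<xi> = - lam p * (e \<xi> p \<bullet> e \<xi> p)" if \<xi>: "e \<xi> p \<bullet> X p = 0" for \<xi>
  proof (cases "\<xi> = 0")
    case True
    then show ?thesis by (simp add: h_def le.zero lX.zero)
  next
    case False
    then have nz: "norm (e \<xi> p) > 0" using e_eq_0_iff[OF p] by simp
    \<comment> \<open>The condition only speaks of \<xi> as long as the gradient, so a general \<xi>
      is rescaled and the square of \<open>c\<close> divided out.\<close>
    define c where "c = norm (X p) / norm (e \<xi> p)"
    have c: "c > 0" using nz X_nonzero[OF p] by (simp add: c_def)
    have "dir_deriv (gradient gram f p) X p \<bullet> X p + dir_deriv (c *\<^sub>R \<xi>) X p \<bullet> e (c *\<^sub>R \<xi>) p = 0"
      unfolding X_def
      by (rule carleman_at_gramD(2)[OF smooth_f p carleman[OF p]])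
        (use \<xi> nz in \<open>simp_all add: le.scale c_def flip: X_def\<close>)
    then have "h x x + c * c * h \<xi> \<xi> = 0"
      by (simp add: h_def ex le.scale lX.scale mult_ac flip: x_def)
    moreover have "h x x = r p * lam p" by (simp add: hx ex lam_def)
    moreover have "r p = c * c * (e \<xi> p \<bullet> e \<xi> p)"
      using nz by (simp add: r_def c_def dot_square_norm power2_eq_square)
    ultimately have "c * c * (h \<xi> \<xi> + lam p * (e \<xi> p \<bullet> e \<xi> p)) = 0"
      by (simp add: algebra_simps)
    then show ?thesis using c by simp
  qed
  define Q where "Q v w = h v w - (X p \<bullet> e v p) * (\<theta> p \<bullet> e w p) - (\<theta> p \<bullet> e v p) * (X p \<bullet> e w p)
      + lam p * (e v p \<bullet> e w p)" for v w
  have Q0: "Q v v = 0" for v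
  proof -
    define c where "c = X p \<bullet> e v p / r p"
    define \<xi> where "\<xi> = v - c *\<^sub>R x"
    have v: "v = c *\<^sub>R x + \<xi>" by (simp add: \<xi>_def)
    have \<xi>: "e \<xi> p \<bullet> X p = 0"
      using r by (simp add: \<xi>_def le.diff le.scale ex inner_diff_left c_def flip: r_def) (simp add: inner_commute)
    have "h x x = r p * lam p" by (simp add: hx ex lam_def)
    then show ?thesis
      unfolding v using \<xi> perp[OF \<xi>] hsym[of \<xi> x] hx[of \<xi>]
      by (simp add: Q_def hlin le.add le.scale ex inner_add_left inner_add_right inner_commute[of "X p" "e \<xi> p"]
          flip: r_def lam_def) (simp add: algebra_simps)
  qed
  have "Q (v + w) (v + w) = Q v v + Q w w + 2 * Q v w"
    using hsym[of v w] by (simp add: Q_def hlin le.add inner_add_left inner_add_right inner_commute algebra_simps)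
  then have "Q v w = 0" using Q0 by simp
  then show ?thesis by (simp add: Q_def h_def)
qed

definition Z :: "real^'n \<Rightarrow> real^'n \<Rightarrow> 'a" where
  "Z v p = dir_deriv v X p - (X p \<bullet> e v p) *\<^sub>R \<theta> p - (\<theta> p \<bullet> e v p) *\<^sub>R X p + lam p *\<^sub>R e v p"

lemma Z_normal: "p \<in> U \<Longrightarrow> Z v p \<bullet> e w p = 0"
  by (simp add: Z_def inner_diff_left inner_add_left carleman_hessian)

text \<open>\<open>s\<close> collects the terms of the Ricci identity that are quadratic in
  \<open>v\<close>, while \<eta> below is linear in \<open>u\<close>; this separation makes both
  eliminable.\<close>

definition s :: "real^'n \<Rightarrow> real^'n \<Rightarrow> real" where
  "s v p = (\<theta> p \<bullet> e v p)\<^sup>2 - dir_deriv v \<theta> p \<bullet> e v p"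

definition \<eta> :: "real^'n \<Rightarrow> real^'n \<Rightarrow> real" where
  "\<eta> u p = lam p * (\<theta> p \<bullet> e u p) - dir_deriv u lam p"

text \<open>The Ricci identity for \<open>X\<close>: \<open>Z\<close> is the normal part of \<open>dX\<close>, so by the Gauss equation the left hand
  side is the curvature term \<open>R(u, v, v, X)\<close> up to sign.\<close>

lemma ricci_identity:
  assumes p: "p \<in> U" and v: "X p \<bullet> e v p = 0" "e u p \<bullet> e v p = 0"
  shows "Z v p \<bullet> dir_deriv u (dir_deriv v \<psi>) p - Z u p \<bullet> dir_deriv v (dir_deriv v \<psi>) p
    = (X p \<bullet> e u p) * s v p + \<eta> u p * (e v p \<bullet> e v p)"
proof -
  let ?dd = "\<lambda>u v. dir_deriv u (dir_deriv v \<psi>) p"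
  have D: "dir_deriv u (dir_deriv v X) p \<bullet> e w p + dir_deriv v X p \<bullet> ?dd u w
      = (X p \<bullet> e v p) * (\<theta> p \<bullet> ?dd u w + dir_deriv u \<theta> p \<bullet> e w p)
        + (X p \<bullet> ?dd u v + dir_deriv u X p \<bullet> e v p) * (\<theta> p \<bullet> e w p)
        + (\<theta> p \<bullet> e v p) * (X p \<bullet> ?dd u w + dir_deriv u X p \<bullet> e w p)
        + (\<theta> p \<bullet> ?dd u v + dir_deriv u \<theta> p \<bullet> e v p) * (X p \<bullet> e w p)
        - (lam p * (e v p \<bullet> ?dd u w + ?dd u v \<bullet> e w p) + dir_deriv u lam p * (e v p \<bullet> e w p))" for u v w
  proof -
    have "dir_deriv u (\<lambda>x. dir_deriv v X x \<bullet> e w x) p = dir_deriv u (\<lambda>x. (X x \<bullet> e v x) * (\<theta> x \<bullet> e w x)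
        + (\<theta> x \<bullet> e v x) * (X x \<bullet> e w x) - lam x * (e v x \<bullet> e w x)) p"
      by (rule dir_deriv_cong_open[OF open_U p]) (rule carleman_hessian)
    also have "\<dots> = (X p \<bullet> e v p) * (\<theta> p \<bullet> ?dd u w + dir_deriv u \<theta> p \<bullet> e w p)
        + (X p \<bullet> ?dd u v + dir_deriv u X p \<bullet> e v p) * (\<theta> p \<bullet> e w p)
        + ((\<theta> p \<bullet> e v p) * (X p \<bullet> ?dd u w + dir_deriv u X p \<bullet> e w p)
        + (\<theta> p \<bullet> ?dd u v + dir_deriv u \<theta> p \<bullet> e v p) * (X p \<bullet> e w p))
        - (lam p * (e v p \<bullet> ?dd u w + ?dd u v \<bullet> e w p) + dir_deriv u lam p * (e v p \<bullet> e w p))"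
      by (rule dir_deriv_unique) (intro has_derivative_diff has_derivative_add has_derivative_mult has_derivative_inner
          has_derivative_dir_deriv smooth_on_differentiable[OF _ p] smooth_X smooth_theta smooth_lam smooth_e)
    finally show ?thesis
      by (simp add: dir_deriv_inner[OF smooth_on_dir_deriv[OF open_U smooth_X] smooth_e p])
  qed
  have h: "dir_deriv u X p \<bullet> e v p = (X p \<bullet> e u p) * (\<theta> p \<bullet> e v p)"
    "dir_deriv v X p \<bullet> e u p = (X p \<bullet> e u p) * (\<theta> p \<bullet> e v p)"
    "dir_deriv v X p \<bullet> e v p = - lam p * (e v p \<bullet> e v p)"
    unfolding carleman_hessian[OF p] using v by (simp_all add: inner_commute)
  show ?thesis
    using D[of u v v] D[of v u v] v
    unfolding dir_deriv_commute[OF smooth_X open_U p, of v u] dir_deriv_commute[OF smooth open_U p, of v u] h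
    by (simp add: Z_def s_def \<eta>_def inner_diff_left inner_add_left h power2_eq_square inner_commute[of "e v p" "?dd u v"]
        algebra_simps)
qed

end

section \<open>Weights on a product of ellipsoids\<close>

locale carleman_pair =
  ellipsoid_pair U \<psi>1 \<psi>2 a b + carleman_immersion U "\<lambda>p. (\<psi>1 p, \<psi>2 p)" f
  for U :: "(real^4) set" and \<psi>1 \<psi>2 :: "real^4 \<Rightarrow> real^3" and a b :: "real^3" and f :: "real^4 \<Rightarrow> real"
begin

lemma X_tangent: "p \<in> U \<Longrightarrow> E1.n p \<bullet> fst (X p) = 0" "p \<in> U \<Longrightarrow> E2.n p \<bullet> snd (X p) = 0"
  by (simp_all add: X_eq_e e_Pair E1.n_inner_t E2.n_inner_t)

lemma theta_tangent: "p \<in> U \<Longrightarrow> E1.n p \<bullet> fst (\<theta> p) = 0" "p \<in> U \<Longrightarrow> E2.n p \<bullet> snd (\<theta> p) = 0"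
  by (simp_all add: \<theta>_def e_Pair E1.n_inner_t E2.n_inner_t)

lemma smooth_X12: "smooth_on U (\<lambda>x. fst (X x))" "smooth_on U (\<lambda>x. snd (X x))"
  by (intro smooth_on_fst smooth_on_snd open_U smooth_X)+

lemma dX12:
  assumes "p \<in> U"
  shows "fst (dir_deriv v X p) = dir_deriv v (\<lambda>x. fst (X x)) p"
    "snd (dir_deriv v X p) = dir_deriv v (\<lambda>x. snd (X x)) p"
  using dir_deriv_bounded_linear[OF bounded_linear_fst smooth_on_differentiable[OF smooth_X assms]]
    dir_deriv_bounded_linear[OF bounded_linear_snd smooth_on_differentiable[OF smooth_X assms]] by simp_all

lemma n_dX:
  assumes p: "p \<in> U"
  shows "E1.n p \<bullet> dir_deriv v (\<lambda>x. fst (X x)) p = - (diag a (E1.t v p) \<bullet> fst (X p) / E1.nrm p)"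
    and "E2.n p \<bullet> dir_deriv v (\<lambda>x. snd (X x)) p = - (diag b (E2.t v p) \<bullet> snd (X p) / E2.nrm p)"
proof -
  have "dir_deriv v (\<lambda>x. E1.n x \<bullet> fst (X x)) p = dir_deriv v (\<lambda>x. 0) p"
    by (rule dir_deriv_cong_open[OF open_U p]) (rule X_tangent)
  then show "E1.n p \<bullet> dir_deriv v (\<lambda>x. fst (X x)) p = - (diag a (E1.t v p) \<bullet> fst (X p) / E1.nrm p)"
    by (simp add: dir_deriv_inner[OF E1.smooth_n smooth_X12(1) p] E1.dn_inner[OF p X_tangent(1)[OF p]])
  have "dir_deriv v (\<lambda>x. E2.n x \<bullet> snd (X x)) p = dir_deriv v (\<lambda>x. 0) p"
    by (rule dir_deriv_cong_open[OF open_U p]) (rule X_tangent)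
  then show "E2.n p \<bullet> dir_deriv v (\<lambda>x. snd (X x)) p = - (diag b (E2.t v p) \<bullet> snd (X p) / E2.nrm p)"
    by (simp add: dir_deriv_inner[OF E2.smooth_n smooth_X12(2) p] E2.dn_inner[OF p X_tangent(2)[OF p]])
qed

text \<open>\<open>Z\<close> is normal to the product, so only its components along the two factor
  normals matter. These come from differentiating the tangency of the two parts of X.\<close>

lemma Z_inner_second:
  assumes p: "p \<in> U"
  shows "Z v p \<bullet> dir_deriv u (dir_deriv w (\<lambda>p. (\<psi>1 p, \<psi>2 p))) p
    = (diag a (E1.t v p) \<bullet> fst (X p)) * (diag a (E1.t u p) \<bullet> E1.t w p) / (E1.N p \<bullet> E1.N p)
      + (diag b (E2.t v p) \<bullet> snd (X p)) * (diag b (E2.t u p) \<bullet> E2.t w p) / (E2.N p \<bullet> E2.N p)"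
proof -
  have "tang p (Z v p) = e (coords p (\<lambda>j. 0)) p"
    by (simp add: tang_def partial_deriv_eq_dir_deriv Z_normal[OF p])
  also have "coords p (\<lambda>j. 0) = 0" by (simp add: coords_def vec_eq_iff)
  finally have tZ: "tang p (Z v p) = 0" by (simp add: linear_0[OF linear_e[OF p]])
  have Zn: "E1.n p \<bullet> fst (Z v p) = - (diag a (E1.t v p) \<bullet> fst (X p) / E1.nrm p)"
    "E2.n p \<bullet> snd (Z v p) = - (diag b (E2.t v p) \<bullet> snd (X p) / E2.nrm p)"
    by (simp_all add: Z_def inner_diff_right inner_add_right X_tangent[OF p] theta_tangent[OF p] e_Pair[OF p]
        E1.n_inner_t[OF p] E2.n_inner_t[OF p] dX12[OF p] n_dX[OF p])
  have "dir_deriv u (dir_deriv w (\<lambda>p. (\<psi>1 p, \<psi>2 p))) p = dir_deriv u (\<lambda>p. (E1.t w p, E2.t w p)) p"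
    by (rule dir_deriv_cong_open[OF open_U p]) (rule e_Pair)
  also have "\<dots> = (dir_deriv u (E1.t w) p, dir_deriv u (E2.t w) p)"
    by (intro dir_deriv_Pair smooth_on_differentiable[OF _ p] E1.smooth_t E2.smooth_t)
  finally show ?thesis
    using normal_part[OF p, of "Z v p" "dir_deriv u (dir_deriv w (\<lambda>p. (\<psi>1 p, \<psi>2 p))) p"] unfolding Zn
    by (simp add: tZ E1.n_inner_dt[OF p] E2.n_inner_dt[OF p] flip: E1.nrm_sq[OF p] E2.nrm_sq[OF p])
qed

lemma curvature_identity:
  assumes p: "p \<in> U" and v: "X p \<bullet> e v p = 0" "e u p \<bullet> e v p = 0"
  shows "- E1.K p * ((E1.t u p \<bullet> fst (X p)) * (E1.t v p \<bullet> E1.t v p) - (E1.t u p \<bullet> E1.t v p) * (E1.t v p \<bullet> fst (X p)))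
    - E2.K p * ((E2.t u p \<bullet> snd (X p)) * (E2.t v p \<bullet> E2.t v p) - (E2.t u p \<bullet> E2.t v p) * (E2.t v p \<bullet> snd (X p)))
    = (X p \<bullet> e u p) * s v p + \<eta> u p * (e v p \<bullet> e v p)"
proof -
  have 1: "((diag a (E1.t u p) \<bullet> fst (X p)) * (diag a (E1.t v p) \<bullet> E1.t v p)
      - (diag a (E1.t u p) \<bullet> E1.t v p) * (diag a (E1.t v p) \<bullet> fst (X p))) / (E1.N p \<bullet> E1.N p)
      = E1.K p * ((E1.t u p \<bullet> fst (X p)) * (E1.t v p \<bullet> E1.t v p) - (E1.t u p \<bullet> E1.t v p) * (E1.t v p \<bullet> fst (X p)))"
    using E1.diag_curvature[OF p E1.n_inner_t[OF p, of u] E1.n_inner_t[OF p, of v] X_tangent(1)[OF p] E1.n_inner_t[OF p, of v]]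
      E1.N_nonzero[OF p] by simp
  have 2: "((diag b (E2.t u p) \<bullet> snd (X p)) * (diag b (E2.t v p) \<bullet> E2.t v p)
      - (diag b (E2.t u p) \<bullet> E2.t v p) * (diag b (E2.t v p) \<bullet> snd (X p))) / (E2.N p \<bullet> E2.N p)
      = E2.K p * ((E2.t u p \<bullet> snd (X p)) * (E2.t v p \<bullet> E2.t v p) - (E2.t u p \<bullet> E2.t v p) * (E2.t v p \<bullet> snd (X p)))"
    using E2.diag_curvature[OF p E2.n_inner_t[OF p, of u] E2.n_inner_t[OF p, of v] X_tangent(2)[OF p] E2.n_inner_t[OF p, of v]]
      E2.N_nonzero[OF p] by simp
  show ?thesis
    unfolding ricci_identity[OF p v, symmetric] Z_inner_second[OF p]
    using 1 2 by (simp add: diff_divide_distrib mult_ac)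
qed

text \<open>\<open>u\<close> runs over the two components of X and \<open>v\<close> over their
  rotations by a right angle. Each \<open>v\<close> is then orthogonal to X and to both
  \<open>u\<close>; the curvature term vanishes when \<open>u\<close> and \<open>v\<close> lie in
  different factors.\<close>

lemma gradient_in_one_factor:
  assumes p: "p \<in> U"
  shows "fst (X p) = 0 \<or> snd (X p) = 0"
proof (rule ccontr)
  assume "\<not> ?thesis"
  then have nz: "fst (X p) \<noteq> 0" "snd (X p) \<noteq> 0" by auto
  define \<alpha> \<beta> where "\<alpha> = fst (X p) \<bullet> fst (X p)" and "\<beta> = snd (X p) \<bullet> snd (X p)"
  have pos: "\<alpha> > 0" "\<beta> > 0" using nz by (auto simp: \<alpha>_def \<beta>_def)
  obtain u1 where u1: "E1.t u1 p = fst (X p)" "E2.t u1 p = 0"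
    using e_surj[OF p X_tangent(1)[OF p], of 0] by auto
  obtain u2 where u2: "E1.t u2 p = 0" "E2.t u2 p = snd (X p)"
    using e_surj[OF p _ X_tangent(2)[OF p], of 0] by auto
  obtain v1 where v1: "E1.t v1 p = E1.n p \<times> fst (X p)" "E2.t v1 p = 0"
    using e_surj[OF p, of "E1.n p \<times> fst (X p)" 0] by (auto simp: dot_cross_self)
  obtain v2 where v2: "E1.t v2 p = 0" "E2.t v2 p = E2.n p \<times> snd (X p)"
    using e_surj[OF p, of 0 "E2.n p \<times> snd (X p)"] by (auto simp: dot_cross_self)
  have rot: "(E1.n p \<times> fst (X p)) \<bullet> (E1.n p \<times> fst (X p)) = \<alpha>" "(E2.n p \<times> snd (X p)) \<bullet> (E2.n p \<times> snd (X p)) = \<beta>"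
    by (simp_all add: cross_dot_cross E1.n_unit[OF p] E2.n_unit[OF p] X_tangent[OF p] \<alpha>_def \<beta>_def)
  have ortho: "X p \<bullet> e v1 p = 0" "X p \<bullet> e v2 p = 0" "e u1 p \<bullet> e v1 p = 0" "e u1 p \<bullet> e v2 p = 0"
      "e u2 p \<bullet> e v1 p = 0" "e u2 p \<bullet> e v2 p = 0"
    by (simp_all add: e_Pair[OF p] inner_prod_def u1 u2 v1 v2 dot_cross_self)
  note simps = e_Pair[OF p] inner_prod_def u1 u2 v1 v2 rot dot_cross_self
  have "- E1.K p * (\<alpha> * \<alpha>) = \<alpha> * s v1 p + \<eta> u1 p * \<alpha>"
    using curvature_identity[OF p ortho(1) ortho(3)] by (simp add: simps flip: \<alpha>_def \<beta>_def)
  moreover have "0 = \<beta> * s v1 p + \<eta> u2 p * \<alpha>"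
    using curvature_identity[OF p ortho(1) ortho(5)] by (simp add: simps flip: \<alpha>_def \<beta>_def)
  moreover have "0 = \<alpha> * s v2 p + \<eta> u1 p * \<beta>"
    using curvature_identity[OF p ortho(2) ortho(4)] by (simp add: simps flip: \<alpha>_def \<beta>_def)
  moreover have "- E2.K p * (\<beta> * \<beta>) = \<beta> * s v2 p + \<eta> u2 p * \<beta>"
    using curvature_identity[OF p ortho(2) ortho(6)] by (simp add: simps flip: \<alpha>_def \<beta>_def)
  \<comment> \<open>Eliminating \<open>s v1 p\<close> from the first two equations gives \<eta>(u2)
    \<alpha> - \<eta>(u1) \<beta> = K1 \<alpha> \<beta>, and eliminating \<open>s v2 p\<close> from
    the last two gives - K2 \<alpha> \<beta> for the same expression.\<close>
  ultimately have "\<alpha> * \<alpha> * \<beta> * \<beta> * (E1.K p + E2.K p) = 0" by algebra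
  then show False using pos E1.K_pos[OF p] E2.K_pos[OF p] by simp
qed

text \<open>Everything reduces to the first factor: the Hessian vanishes along the second, which
  forces \<open>lam\<close> to vanish and \<theta> to be tangent to the first. The rotated field
  \<alpha> then satisfies \<open>concircular_field\<close>.\<close>

lemma domain_empty_if_one_factor:
  assumes X2: "\<And>p. p \<in> U \<Longrightarrow> snd (X p) = 0"
    and a_distinct: "\<And>i j. i \<noteq> j \<Longrightarrow> a $ i \<noteq> a $ j"
  shows "U = {}"
proof -
  have dX2: "snd (dir_deriv v X p) = 0" if p: "p \<in> U" for p v
  proof -
    have "dir_deriv v (\<lambda>x. snd (X x)) p = dir_deriv v (\<lambda>x. 0) p"
      by (rule dir_deriv_cong_open[OF open_U p]) (rule X2)
    then show ?thesis by (simp add: dX12[OF p])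
  qed
  \<comment> \<open>On a unit vector of the second factor the Hessian is zero, while its general
    form reduces to - \<open>lam\<close>.\<close>
  have lam0: "lam p = 0" if p: "p \<in> U" for p
  proof -
    obtain y where y: "E2.n p \<bullet> y = 0" "y \<bullet> y = 1" using unit_normal_exists .
    obtain v where v: "E1.t v p = 0" "E2.t v p = y" using e_surj[OF p _ y(1), of 0] by auto
    show ?thesis
      using carleman_hessian[OF p, of v v] dX2[OF p] X2[OF p] by (simp add: e_Pair[OF p] inner_prod_def v y(2))
  qed
  have theta2: "snd (\<theta> p) = 0" if p: "p \<in> U" for p
  proof -
    obtain v where v: "E1.t v p = 0" "E2.t v p = snd (\<theta> p)" using e_surj[OF p _ theta_tangent(2)[OF p], of 0] by auto
    have "\<theta> p \<bullet> e v p = dir_deriv (gradient gram f p) X p \<bullet> e v p / r p"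
      using theta_inner_e[OF p, of v] dX_sym[OF p, of v "gradient gram f p"] by (simp flip: X_eq_e)
    then have "snd (\<theta> p) \<bullet> snd (\<theta> p) = 0" by (simp add: e_Pair[OF p] inner_prod_def v dX2[OF p])
    then show ?thesis by simp
  qed
  define X1 where "X1 p = fst (X p)" for p
  define \<theta>1 where "\<theta>1 p = fst (\<theta> p)" for p
  have r: "r p = X1 p \<bullet> X1 p" if "p \<in> U" for p
    using X2[OF that] by (simp add: r_def inner_prod_def X1_def)
  have X1t: "E1.n p \<bullet> X1 p = 0" "E1.n p \<bullet> \<theta>1 p = 0" "\<theta>1 p \<bullet> X1 p = 0" if p: "p \<in> U" for p
    using X_tangent[OF p] theta_tangent[OF p] lam0[OF p] X2[OF p]
    by (simp_all add: X1_def \<theta>1_def lam_def inner_prod_def)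
  have sX1: "smooth_on U X1" and s\<theta>1: "smooth_on U \<theta>1"
    unfolding X1_def[abs_def] \<theta>1_def[abs_def] by (intro smooth_on_fst open_U smooth_X smooth_theta)+
  have hess: "dir_deriv v X1 p \<bullet> E1.t w p
      = (X1 p \<bullet> E1.t v p) * (\<theta>1 p \<bullet> E1.t w p) + (\<theta>1 p \<bullet> E1.t v p) * (X1 p \<bullet> E1.t w p)" if p: "p \<in> U" for v w p
    using carleman_hessian[OF p, of v w] dX2[OF p] X2[OF p] theta2[OF p] lam0[OF p]
    by (simp add: e_Pair[OF p] inner_prod_def X1_def[abs_def] \<theta>1_def dX12[OF p])
  have dr: "dir_deriv v r p = 2 * r p * (\<theta>1 p \<bullet> E1.t v p)" if p: "p \<in> U" for v p
  proof -
    have "dir_deriv v r p = 2 * (dir_deriv v X p \<bullet> X p)"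
      unfolding r_def[abs_def] by (simp add: dir_deriv_inner[OF smooth_X smooth_X p] inner_commute)
    moreover have "dir_deriv v X p \<bullet> X p = r p * (\<theta> p \<bullet> e v p)"
      using r_pos[OF p] by (simp add: theta_inner_e[OF p])
    ultimately show ?thesis by (simp add: e_Pair[OF p] inner_prod_def theta2[OF p] \<theta>1_def)
  qed
  \<comment> \<open>The Killing field X / r turned by a right angle. The rotation
    \<open>n \<times> _\<close> makes a skew covariant derivative on a surface a multiple of the
    metric.\<close>
  define \<alpha> where "\<alpha> p = inverse (r p) *\<^sub>R (E1.n p \<times> X1 p)" for p
  define \<kappa> where "\<kappa> p = \<theta>1 p \<bullet> (E1.n p \<times> X1 p) / r p" for p
  have rnz: "r p \<noteq> 0" if "p \<in> U" for p using r_pos[OF that] by simp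
  interpret concircular_field U \<psi>1 a \<alpha> \<kappa>
  proof unfold_locales
    show "\<exists>v. E1.t v p = x" if "p \<in> U" "E1.n p \<bullet> x = 0" for p x
      using e_surj[OF that, of 0] by auto
    show "smooth_on U \<alpha>" unfolding \<alpha>_def[abs_def]
      by (intro smooth_on_scaleR smooth_on_inverse smooth_on_cross smooth_r E1.smooth_n sX1 rnz open_U)
    show "smooth_on U \<kappa>" unfolding \<kappa>_def[abs_def]
      by (intro smooth_on_divide smooth_on_inner smooth_on_cross smooth_r E1.smooth_n sX1 s\<theta>1 rnz open_U)
    show "E1.n p \<bullet> \<alpha> p = 0" for p by (simp add: \<alpha>_def dot_cross_self)
    show "\<alpha> p \<noteq> 0" if p: "p \<in> U" for p
    proof -
      have "(E1.n p \<times> X1 p) \<bullet> (E1.n p \<times> X1 p) = r p"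
        by (simp add: cross_dot_cross E1.n_unit[OF p] X1t[OF p] r[OF p])
      then show ?thesis using rnz[OF p] by (auto simp: \<alpha>_def)
    qed
    show "dir_deriv v \<alpha> p \<bullet> E1.t w p = - \<kappa> p * (E1.t v p \<bullet> E1.t w p)" if p: "p \<in> U" for p v w
    proof -
      define n where "n = E1.n p"
      have n: "n \<bullet> n = 1" and nt: "\<And>v. n \<bullet> E1.t v p = 0" and nX: "n \<bullet> X1 p = 0" and n\<theta>: "n \<bullet> \<theta>1 p = 0"
        unfolding n_def by (rule E1.n_unit[OF p] E1.n_inner_t[OF p] X1t[OF p])+
      note diffs = smooth_on_differentiable[OF _ p]
      have 1: "dir_deriv v \<alpha> p = inverse (r p) *\<^sub>R dir_deriv v (\<lambda>x. E1.n x \<times> X1 x) p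
          + dir_deriv v (\<lambda>x. inverse (r x)) p *\<^sub>R (n \<times> X1 p)"
        unfolding \<alpha>_def[abs_def] n_def
        by (rule dir_deriv_bilinear[OF bounded_bilinear_scaleR diffs[OF smooth_on_inverse[OF open_U smooth_r rnz]]
              diffs[OF smooth_on_cross[OF open_U E1.smooth_n sX1]]])
      have 2: "dir_deriv v (\<lambda>x. E1.n x \<times> X1 x) p = n \<times> dir_deriv v X1 p + dir_deriv v E1.n p \<times> X1 p"
        unfolding n_def
        by (rule dir_deriv_bilinear[OF bilinear_conv_bounded_bilinear[THEN iffD1, OF bilinear_cross]])
          (intro diffs E1.smooth_n sX1)+
      have 3: "dir_deriv v (\<lambda>x. inverse (r x)) p = - 2 * (\<theta>1 p \<bullet> E1.t v p) / r p"
        by (subst dir_deriv_inverse[OF diffs[OF smooth_r] rnz[OF p]])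
          (use rnz[OF p] in \<open>simp add: dr[OF p] field_simps\<close>)
      \<comment> \<open>Rotating the normal contributes nothing tangentially:
        \<open>X1 p \<times> E1.t w p\<close> is normal, whereas the derivative of a unit normal is
        tangent.\<close>
      have 4: "(dir_deriv v E1.n p \<times> X1 p) \<bullet> E1.t w p = 0"
      proof -
        have "(dir_deriv v E1.n p \<times> X1 p) \<bullet> E1.t w p = dir_deriv v E1.n p \<bullet> (X1 p \<times> E1.t w p)"
          by (simp add: cross3_simps)
        also have "\<dots> = 0"
          by (subst cross_of_normal[OF n nX nt]) (simp add: n_def E1.n_inner_dn[OF p] inner_commute)
        finally show ?thesis .
      qed
      \<comment> \<open>Moving the rotation to the other side of the inner product evaluates the
        Hessian at a rotated tangent vector, realized here by \<open>w'\<close>.\<close>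
      obtain w' where w': "E1.t w' p = E1.t w p \<times> n" "E2.t w' p = 0"
        using e_surj[OF p, of "E1.t w p \<times> n" 0] by (auto simp: n_def dot_cross_self)
      have rot: "(n \<times> y) \<bullet> E1.t w p = y \<bullet> (E1.t w p \<times> n)" for y
        by (simp add: cross3_simps)
      have 5: "(n \<times> dir_deriv v X1 p) \<bullet> E1.t w p
          = (X1 p \<bullet> E1.t v p) * ((n \<times> \<theta>1 p) \<bullet> E1.t w p) + (\<theta>1 p \<bullet> E1.t v p) * ((n \<times> X1 p) \<bullet> E1.t w p)"
        using hess[OF p, of v w'] by (simp add: rot w')
      \<comment> \<open>In the tangent plane \<theta>1 is perpendicular to X1, because
        \<open>lam\<close> is zero, hence a multiple of the rotation of X1; \<kappa> is defined as
        that multiple.\<close>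
      have J: "r p *\<^sub>R \<theta>1 p = (\<kappa> p * r p) *\<^sub>R (n \<times> X1 p)"
      proof -
        have "(\<theta>1 p \<times> X1 p) = (n \<bullet> (\<theta>1 p \<times> X1 p)) *\<^sub>R n" by (rule cross_of_normal[OF n n\<theta> nX])
        then have "X1 p \<times> (\<theta>1 p \<times> X1 p) = X1 p \<times> ((n \<bullet> (\<theta>1 p \<times> X1 p)) *\<^sub>R n)" by simp
        moreover have "X1 p \<times> (\<theta>1 p \<times> X1 p) = (X1 p \<bullet> X1 p) *\<^sub>R \<theta>1 p - (\<theta>1 p \<bullet> X1 p) *\<^sub>R X1 p"
          by (simp add: cross3_simps forall_3)
        moreover have "n \<bullet> (\<theta>1 p \<times> X1 p) = - (\<kappa> p * r p)"
          using rnz[OF p] by (simp add: \<kappa>_def n_def[symmetric]) (simp add: cross3_simps)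
        ultimately show ?thesis
          using cross_skew[of "X1 p" n] by (simp add: X1t[OF p] r[OF p] cross_mult_right)
      qed
      then have J1: "\<theta>1 p = \<kappa> p *\<^sub>R (n \<times> X1 p)"
        using rnz[OF p] by (metis (no_types, lifting) mult.commute scaleR_left_imp_eq scaleR_scaleR)
      have J2: "n \<times> \<theta>1 p = - \<kappa> p *\<^sub>R X1 p"
        by (subst J1) (simp add: cross_mult_right cross_cross_unit[OF n] nX)
      have P: "(X1 p \<bullet> E1.t v p) * (X1 p \<bullet> E1.t w p) + ((n \<times> X1 p) \<bullet> E1.t v p) * ((n \<times> X1 p) \<bullet> E1.t w p)
          = r p * (E1.t v p \<bullet> E1.t w p)"
        unfolding r[OF p] by (rule plane_parseval[OF n nX nt nt])
      have "r p * (dir_deriv v \<alpha> p \<bullet> E1.t w p) = (X1 p \<bullet> E1.t v p) * ((n \<times> \<theta>1 p) \<bullet> E1.t w p)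
          - (\<theta>1 p \<bullet> E1.t v p) * ((n \<times> X1 p) \<bullet> E1.t w p)"
        unfolding 1 2 3 inner_add_left inner_scaleR_left 4 5 using rnz[OF p] by (simp add: field_simps)
      also have "\<dots> = - \<kappa> p * ((X1 p \<bullet> E1.t v p) * (X1 p \<bullet> E1.t w p) + ((n \<times> X1 p) \<bullet> E1.t v p) * ((n \<times> X1 p) \<bullet> E1.t w p))"
        unfolding J2 by (subst J1) (simp add: algebra_simps)
      finally have "r p * (dir_deriv v \<alpha> p \<bullet> E1.t w p) = r p * (- \<kappa> p * (E1.t v p \<bullet> E1.t w p))"
        unfolding P by simp
      then show ?thesis using rnz[OF p] by (simp only: mult_cancel_left) simp
    qed
    show "a $ i \<noteq> a $ j" if "i \<noteq> j" for i j by (rule a_distinct[OF that])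
  qed
  show ?thesis by (rule domain_empty)
qed

end

unbundle no cross3_syntax

section \<open>Locality and symmetry\<close>

context
  fixes U :: "(real^'n::finite) set" and G H :: "'n metric_field"
  assumes U: "open U" and GH: "\<And>x. x \<in> U \<Longrightarrow> G x = H x"
begin

lemma g_inv_cong: "p \<in> U \<Longrightarrow> g_inv G p = g_inv H p"
  by (simp add: g_inv_def fun_eq_iff GH)

lemma christoffel_cong:
  assumes p: "p \<in> U" shows "christoffel G k i j p = christoffel H k i j p"
proof -
  have "partial_deriv l (\<lambda>x. G x $ i $ j) p = partial_deriv l (\<lambda>x. H x $ i $ j) p" for l i j
    unfolding partial_deriv_eq_dir_deriv by (rule dir_deriv_cong_open[OF U p]) (simp add: GH)
  then show ?thesis by (simp add: christoffel_def g_inv_cong[OF p])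
qed

lemma riem_cong: assumes p: "p \<in> U" shows "riem G p = riem H p"
proof -
  have "partial_deriv l (christoffel G k i j) p = partial_deriv l (christoffel H k i j) p" for l k i j
    unfolding partial_deriv_eq_dir_deriv by (rule dir_deriv_cong_open[OF U p]) (rule christoffel_cong)
  then show ?thesis by (simp add: riem_def riem_up_def fun_eq_iff christoffel_cong[OF p] GH[OF p])
qed

text \<open>The pullback metric is only known to equal \<open>gram\<close> on \<open>U\<close>. The
  tensors involve derivatives, so agreement on an open set is what transfers them.\<close>

lemma eigenflag_at_cong: assumes p: "p \<in> U" shows "eigenflag_at G p \<longleftrightarrow> eigenflag_at H p"
proof -
  have "ricci G p = ricci H p" by (simp add: ricci_def fun_eq_iff riem_cong[OF p] g_inv_cong[OF p])
  moreover from this have "scal G p = scal H p" by (simp add: scal_def g_inv_cong[OF p])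
  ultimately have "weyl G p = weyl H p" by (simp add: weyl_def fun_eq_iff Let_def riem_cong[OF p] GH[OF p])
  then have "weyl_operator G p = weyl_operator H p"
    by (simp add: weyl_operator_def fun_eq_iff g_inv_cong[OF p])
  moreover have "wedge_perp G p = wedge_perp H p"
    by (simp add: wedge_perp_def fun_eq_iff g_inner_def GH[OF p])
  ultimately show ?thesis by (simp add: eigenflag_at_def)
qed

lemma gradient_cong: "p \<in> U \<Longrightarrow> gradient G f p = gradient H f p"
  by (simp add: gradient_def g_inv_cong)

lemma carleman_at_cong: assumes p: "p \<in> U" shows "carleman_at G f p \<longleftrightarrow> carleman_at H f p"
proof -
  have "hessian G f p = hessian H f p" by (simp add: hessian_def fun_eq_iff christoffel_cong[OF p])
  then show ?thesis
    by (simp add: carleman_at_def gradient_cong[OF p] g_inner_def g_norm_def GH[OF p])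
qed

end

section \<open>Restriction to open subsets and exchange of the factors\<close>

lemma carleman_pair_subset:
  assumes "carleman_pair U \<psi>1 \<psi>2 a b f" and W: "open W" "W \<subseteq> U"
  shows "carleman_pair W \<psi>1 \<psi>2 a b f"
proof -
  interpret carleman_pair U \<psi>1 \<psi>2 a b f by fact
  show ?thesis
    by unfold_locales
      (use W smooth inj_deriv E1.smooth_sigma E1.a_pos E1.on_ellipsoid E2.smooth_sigma E2.a_pos E2.on_ellipsoid
        smooth_f carleman in \<open>auto intro: smooth_on_subset\<close>)
qed

text \<open>Exchanging the components is an isometry of the ambient space, so the Gram matrix and
  the coordinate gradient stay the same. This reduces both cases of one-factor dependence to the
  first.\<close>

lemma carleman_pair_swap:
  assumes "carleman_pair U \<psi>1 \<psi>2 a b f"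
  shows "carleman_pair U \<psi>2 \<psi>1 b a f"
    and "p \<in> U \<Longrightarrow> carleman_immersion.X (\<lambda>p. (\<psi>2 p, \<psi>1 p)) f p
      = prod.swap (carleman_immersion.X (\<lambda>p. (\<psi>1 p, \<psi>2 p)) f p)"
proof -
  interpret carleman_pair U \<psi>1 \<psi>2 a b f by fact
  have sw: "dir_deriv v (\<lambda>p. (\<psi>2 p, \<psi>1 p)) p = prod.swap (e v p)" if "p \<in> U" for v p
    by (simp add: e_Pair[OF that] dir_deriv_Pair[OF E2.diff_sigma[OF that] E1.diff_sigma[OF that]])
  interpret S: immersion U "\<lambda>p. (\<psi>2 p, \<psi>1 p)"
  proof
    show "smooth_on U (\<lambda>p. (\<psi>2 p, \<psi>1 p))" by (intro smooth_on_Pair open_U E1.smooth_sigma E2.smooth_sigma)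
    show "inj (\<lambda>v. dir_deriv v (\<lambda>p. (\<psi>2 p, \<psi>1 p)) p)" if "p \<in> U" for p
      using inj_deriv[OF that] by (auto simp: sw[OF that] inj_def prod_eq_iff)
  qed (rule open_U)
  have gr: "gram x = S.gram x" if "x \<in> U" for x
    by (simp add: gram_def S.gram_def partial_deriv_eq_dir_deriv sw[OF that] vec_eq_iff inner_prod_def)
  interpret S: carleman_immersion U "\<lambda>p. (\<psi>2 p, \<psi>1 p)" f
  proof
    show "carleman_at S.gram f p" if "p \<in> U" for p
      using carleman[OF that] carleman_at_cong[OF open_U gr that] by simp
  qed (rule smooth_f)
  show "carleman_pair U \<psi>2 \<psi>1 b a f" ..
  show "S.X p = prod.swap (X p)" if "p \<in> U"
    by (simp add: S.X_eq_e X_eq_e sw[OF that] gradient_cong[OF open_U gr that])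
qed

text \<open>The set where the first part of X is nonzero is open, and the second part vanishes on
  it, so it is empty. By exchange the second part vanishes on \<open>U\<close> too, against the
  nonvanishing of the gradient.\<close>

lemma carleman_pair_domain_empty:
  assumes C: "carleman_pair U \<psi>1 \<psi>2 a b f"
    and a: "\<And>i j. i \<noteq> j \<Longrightarrow> a $ i \<noteq> a $ j" and b: "\<And>i j. i \<noteq> j \<Longrightarrow> b $ i \<noteq> b $ j"
  shows "U = {}"
proof -
  have fst0: "fst (carleman_immersion.X (\<lambda>p. (\<psi>1 p, \<psi>2 p)) f p) = 0"
    if C: "carleman_pair U \<psi>1 \<psi>2 a b f" and a: "\<And>i j. i \<noteq> j \<Longrightarrow> a $ i \<noteq> a $ j" and p: "p \<in> U"
    for \<psi>1 \<psi>2 a b p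
  proof (rule ccontr)
    interpret carleman_pair U \<psi>1 \<psi>2 a b f by fact
    assume nz: "\<not> ?thesis"
    define W where "W = {p \<in> U. fst (X p) \<noteq> 0}"
    have "W = U \<inter> (\<lambda>p. fst (X p)) -` (- {0})" by (auto simp: W_def)
    then have oW: "open W"
      using continuous_open_preimage[OF smooth_on_continuous[OF smooth_X12(1)] open_U, of "- {0}"] by auto
    then interpret W: carleman_pair W \<psi>1 \<psi>2 a b f
      using carleman_pair_subset[OF C] by (auto simp: W_def)
    have "W = {}"
      by (rule W.domain_empty_if_one_factor[OF _ a]) (use gradient_in_one_factor in \<open>auto simp: W_def\<close>)
    then show False using nz p by (auto simp: W_def)
  qed
  interpret carleman_pair U \<psi>1 \<psi>2 a b f by fact
  have "X p = 0" if p: "p \<in> U" for p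
    using fst0[OF C a p] fst0[OF carleman_pair_swap(1)[OF C] b p] carleman_pair_swap(2)[OF C p]
    by (simp add: prod_eq_iff)
  then show ?thesis using X_nonzero by blast
qed

section \<open>Coordinates on a product of ellipsoids\<close>

definition inv_sq :: "real^'n::finite \<Rightarrow> real^'n" where
  "inv_sq a = (\<chi> i. inverse (a $ i * a $ i))"

lemma inv_sq_props:
  assumes "\<And>i. a $ i > 0" and "\<forall>i j. i \<noteq> j \<longrightarrow> a $ i \<noteq> a $ j"
  shows "inv_sq a $ i > 0" "i \<noteq> j \<Longrightarrow> inv_sq a $ i \<noteq> inv_sq a $ j"
proof -
  show "inv_sq a $ i > 0" using assms(1)[of i] by (simp add: inv_sq_def)
  assume "i \<noteq> j"
  then have "a $ i * a $ i \<noteq> a $ j * a $ j"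
    using assms(1)[of i] assms(1)[of j] assms(2) by (metis less_imp_le power2_eq_iff_nonneg power2_eq_square)
  then show "inv_sq a $ i \<noteq> inv_sq a $ j" by (simp add: inv_sq_def del: inverse_mult_distrib)
qed

lemma ellipsoid_standard:
  assumes T: "orthogonal_transformation T" and x: "x \<in> ellipsoid c T a"
  shows "diag (inv_sq a) (inv T (x - c)) \<bullet> inv T (x - c) = 1"
proof -
  obtain y where y: "x = c + T y" "(\<Sum>i\<in>UNIV. (y $ i / a $ i)\<^sup>2) = 1"
    using x by (auto simp: ellipsoid_def)
  have "inv T (x - c) = y" using orthogonal_transformation_inj[OF T] by (simp add: y(1))
  then show ?thesis using y(2)
    by (simp add: inner_vec_def inv_sq_def power2_eq_square divide_inverse mult_ac)
qed

lemma pullback_product_metric: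
  "pullback_metric (product_metric induced_metric induced_metric) \<psi> p
    = (\<chi> i j. partial_deriv i \<psi> p \<bullet> partial_deriv j \<psi> p)"
  by (simp add: pullback_metric_def product_metric_def induced_metric_def inner_prod_def)

text \<open>Moving each factor by the rigid motion \<open>\<lambda>x. inv T (x - c)\<close>
  preserves inner products of derivatives, hence the pullback metric, and brings the ellipsoids into
  diagonal form.\<close>

lemma standardized_chart:
  fixes \<psi> :: "real^4 \<Rightarrow> (real^3) \<times> (real^3)"
  assumes T1: "orthogonal_transformation T1" and T2: "orthogonal_transformation T2"
    and a1: "\<And>i. a1 $ i > 0" "\<forall>i j. i \<noteq> j \<longrightarrow> a1 $ i \<noteq> a1 $ j"
    and a2: "\<And>i. a2 $ i > 0" "\<forall>i j. i \<noteq> j \<longrightarrow> a2 $ i \<noteq> a2 $ j"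
    and V: "V \<subseteq> ellipsoid c1 T1 a1 \<times> ellipsoid c2 T2 a2" and lp: "local_param V U \<psi>"
  defines "\<psi>1 \<equiv> \<lambda>p. inv T1 (fst (\<psi> p) - c1)" and "\<psi>2 \<equiv> \<lambda>p. inv T2 (snd (\<psi> p) - c2)"
  shows "ellipsoid_pair U \<psi>1 \<psi>2 (inv_sq a1) (inv_sq a2)"
    and "p \<in> U \<Longrightarrow> pullback_metric (product_metric induced_metric induced_metric) \<psi> p
      = immersion.gram (\<lambda>p. (\<psi>1 p, \<psi>2 p)) p"
proof -
  have U: "open U" and sm: "smooth_on U \<psi>" and inj: "\<And>p. p \<in> U \<Longrightarrow> inj (\<lambda>v. dir_deriv v \<psi> p)"
    and im: "\<psi> ` U \<subseteq> V"
    using lp by (auto simp: local_param_def dir_deriv_def dest: openin_imp_subset)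
  have o1: "orthogonal_transformation (inv T1)" and o2: "orthogonal_transformation (inv T2)"
    using T1 T2 orthogonal_transformation_inv by blast+
  have l1: "bounded_linear (inv T1)" and l2: "bounded_linear (inv T2)"
    using o1 o2 orthogonal_transformation_linear linear_conv_bounded_linear by blast+
  have s1: "smooth_on U \<psi>1" and s2: "smooth_on U \<psi>2"
    unfolding \<psi>1_def \<psi>2_def
    by (intro smooth_on_bounded_linear[OF U l1] smooth_on_bounded_linear[OF U l2] smooth_on_diff smooth_on_fst
        smooth_on_snd smooth_on_const U sm)+
  have d: "dir_deriv v (\<lambda>p. (\<psi>1 p, \<psi>2 p)) p = (inv T1 (fst (dir_deriv v \<psi> p)), inv T2 (snd (dir_deriv v \<psi> p)))"
    if p: "p \<in> U" for v p
  proof -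
    have "((\<lambda>p. (\<psi>1 p, \<psi>2 p)) has_derivative (\<lambda>v. (inv T1 (fst (dir_deriv v \<psi> p) - 0), inv T2 (snd (dir_deriv v \<psi> p) - 0)))) (at p)"
      unfolding \<psi>1_def \<psi>2_def
      by (intro has_derivative_Pair bounded_linear.has_derivative[OF l1] bounded_linear.has_derivative[OF l2]
          has_derivative_diff has_derivative_fst has_derivative_snd has_derivative_const
          has_derivative_dir_deriv smooth_on_differentiable[OF sm p])
    from dir_deriv_unique[OF this] show ?thesis by simp
  qed
  have ni: "inj (\<lambda>v. dir_deriv v (\<lambda>p. (\<psi>1 p, \<psi>2 p)) p)" if p: "p \<in> U" for p
  proof (rule injI)
    fix v w
    assume "dir_deriv v (\<lambda>p. (\<psi>1 p, \<psi>2 p)) p = dir_deriv w (\<lambda>p. (\<psi>1 p, \<psi>2 p)) p"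
    then have "fst (dir_deriv v \<psi> p) = fst (dir_deriv w \<psi> p)" "snd (dir_deriv v \<psi> p) = snd (dir_deriv w \<psi> p)"
      by (simp_all add: d[OF p] inj_eq[OF orthogonal_transformation_inj[OF o1]]
          inj_eq[OF orthogonal_transformation_inj[OF o2]])
    then show "v = w" using injD[OF inj[OF p]] by (simp add: prod_eq_iff)
  qed
  have e1: "diag (inv_sq a1) (\<psi>1 p) \<bullet> \<psi>1 p = 1" and e2: "diag (inv_sq a2) (\<psi>2 p) \<bullet> \<psi>2 p = 1" if p: "p \<in> U" for p
  proof -
    have "\<psi> p \<in> ellipsoid c1 T1 a1 \<times> ellipsoid c2 T2 a2" using im V p by blast
    then have "fst (\<psi> p) \<in> ellipsoid c1 T1 a1" "snd (\<psi> p) \<in> ellipsoid c2 T2 a2"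
      by (simp_all add: mem_Times_iff)
    then show "diag (inv_sq a1) (\<psi>1 p) \<bullet> \<psi>1 p = 1" "diag (inv_sq a2) (\<psi>2 p) \<bullet> \<psi>2 p = 1"
      unfolding \<psi>1_def \<psi>2_def by (simp_all add: ellipsoid_standard T1 T2)
  qed
  show pair: "ellipsoid_pair U \<psi>1 \<psi>2 (inv_sq a1) (inv_sq a2)"
    by unfold_locales (use U s1 s2 ni e1 e2 inv_sq_props[OF a1] inv_sq_props[OF a2] in \<open>auto intro: smooth_on_Pair\<close>)
  interpret ellipsoid_pair U \<psi>1 \<psi>2 "inv_sq a1" "inv_sq a2" by (rule pair)
  show "pullback_metric (product_metric induced_metric induced_metric) \<psi> p = gram p" if p: "p \<in> U"
    using o1 o2
    by (simp add: pullback_product_metric gram_def partial_deriv_eq_dir_deriv d[OF p] inner_prod_def vec_eq_iff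
        orthogonal_transformation_def)
qed


text \<open>Stereographic projection from \<open>- axis 3 1\<close>, read in the coordinates \<open>p $ i, p $ j\<close>.\<close>

definition stereo :: "4 \<Rightarrow> 4 \<Rightarrow> real^4 \<Rightarrow> real^3" where
  "stereo i j p = inverse (1 + p $ i * p $ i + p $ j * p $ j) *\<^sub>R
    ((2 * p $ i) *\<^sub>R axis 1 1 + (2 * p $ j) *\<^sub>R axis 2 1 + (1 - p $ i * p $ i - p $ j * p $ j) *\<^sub>R axis 3 1)"

lemma stereo_denominator: "1 + x * x + y * y > (0::real)"
  by (simp add: add_pos_nonneg)

lemma stereo_nth:
  "stereo i j p $ 1 = 2 * p $ i / (1 + p $ i * p $ i + p $ j * p $ j)"
  "stereo i j p $ 2 = 2 * p $ j / (1 + p $ i * p $ i + p $ j * p $ j)"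
  "stereo i j p $ 3 = (1 - p $ i * p $ i - p $ j * p $ j) / (1 + p $ i * p $ i + p $ j * p $ j)"
  by (simp_all add: stereo_def axis_def divide_inverse)

lemma stereo_plus_one: "1 + stereo i j p $ 3 = 2 / (1 + p $ i * p $ i + p $ j * p $ j)"
  using stereo_denominator[of "p $ i" "p $ j"] by (simp add: stereo_nth field_simps)

lemma stereo_unit: "stereo i j p \<bullet> stereo i j p = 1"
proof -
  define D where "D = 1 + p $ i * p $ i + p $ j * p $ j"
  have D: "D \<noteq> 0" using stereo_denominator[of "p $ i" "p $ j"] by (simp add: D_def)
  have "(2 * p $ i) * (2 * p $ i) + (2 * p $ j) * (2 * p $ j)
      + (1 - p $ i * p $ i - p $ j * p $ j) * (1 - p $ i * p $ i - p $ j * p $ j) = D * D"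
    by (simp add: D_def algebra_simps)
  moreover have "stereo i j p \<bullet> stereo i j p = ((2 * p $ i) * (2 * p $ i) + (2 * p $ j) * (2 * p $ j)
      + (1 - p $ i * p $ i - p $ j * p $ j) * (1 - p $ i * p $ i - p $ j * p $ j)) / (D * D)"
    by (simp add: inner_vec_def sum_3 stereo_nth D_def add_divide_distrib)
  ultimately show ?thesis using D by simp
qed

lemma stereo_left_inverse:
  "stereo i j p $ 1 / (1 + stereo i j p $ 3) = p $ i" "stereo i j p $ 2 / (1 + stereo i j p $ 3) = p $ j"
  unfolding stereo_plus_one stereo_nth(1,2) using stereo_denominator[of "p $ i" "p $ j"] by simp_all

lemma stereo_right_inverse:
  assumes y: "y \<bullet> y = 1" "1 + y $ 3 \<noteq> 0"
    and p: "p $ i = y $ 1 / (1 + y $ 3)" "p $ j = y $ 2 / (1 + y $ 3)"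
  shows "stereo i j p = y"
proof -
  define d where "d = 1 + y $ 3"
  have d: "d \<noteq> 0" using y by (simp add: d_def)
  \<comment> \<open>With d = 1 + y3 the sphere equation reads y1^2 + y2^2 = (1 + y3) (1 - y3) = d (2
    - d).\<close>
  have sq: "y $ 1 * y $ 1 + y $ 2 * y $ 2 = d * (2 - d)"
    using y(1) by (simp add: inner_vec_def sum_3 d_def algebra_simps)
  have q: "p $ i * p $ i + p $ j * p $ j = (2 - d) / d"
  proof -
    have "p $ i * p $ i + p $ j * p $ j = (y $ 1 * y $ 1 + y $ 2 * y $ 2) / (d * d)"
      by (simp add: p d_def[symmetric] add_divide_distrib)
    then show ?thesis unfolding sq using d by simp
  qed
  have D: "1 + p $ i * p $ i + p $ j * p $ j = 2 / d"
    using q d by (simp add: field_simps)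
  have y3: "1 - p $ i * p $ i - p $ j * p $ j = 2 * y $ 3 / d"
    using q d by (simp add: d_def field_simps)
  show ?thesis
    using d unfolding vec_eq_iff forall_3 stereo_nth D y3
    by (simp add: p d_def[symmetric])
qed

lemma smooth_stereo: "smooth_on UNIV (stereo i j)"
  unfolding stereo_def[abs_def]
  by (intro smooth_on_scaleR smooth_on_inverse smooth_on_add smooth_on_diff smooth_on_mult smooth_on_const
      smooth_on_nth smooth_on_ident open_UNIV) (metis stereo_denominator less_irrefl)

text \<open>An ellipsoid is an affine image of the unit sphere. The freedom of precomposing with a
  rotation places the given point at the pole \<open>axis 3 1\<close>, the centre of the
  stereographic chart.\<close>

lemma ellipsoid_affine_sphere:
  assumes T: "orthogonal_transformation T" and a: "\<And>i. a $ i > 0" and q: "q \<in> ellipsoid c T a"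
  obtains M M' :: "real^3 \<Rightarrow> real^3" where "bounded_linear M" "bounded_linear M'" "\<forall>y. M' (M y) = y" "\<forall>y. M (M' y) = y"
    "\<forall>y. c + M y \<in> ellipsoid c T a \<longleftrightarrow> y \<bullet> y = 1" "q = c + M (axis 3 1)"
proof -
  have mem: "c + T (diag a w) \<in> ellipsoid c T a \<longleftrightarrow> w \<bullet> w = 1" for w
  proof -
    have "T y = T z \<longleftrightarrow> y = z" for y z using orthogonal_transformation_inj[OF T] by (auto dest: injD)
    then have "c + T (diag a w) \<in> ellipsoid c T a \<longleftrightarrow> (\<Sum>i\<in>UNIV. (diag a w $ i / a $ i)\<^sup>2) = 1"
      by (auto simp: ellipsoid_def)
    moreover have "diag a w $ i / a $ i = w $ i" for i using a[of i] by simp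
    ultimately show ?thesis by (simp add: inner_vec_def power2_eq_square)
  qed
  define b where "b = (\<chi> i. inverse (a $ i))"
  have ab: "diag a (diag b y) = y" "diag b (diag a y) = y" for y
    using a by (simp_all add: vec_eq_iff b_def less_imp_neq[THEN not_sym])
  obtain z where z: "q = c + T z" using q by (auto simp: ellipsoid_def)
  define w where "w = diag b z"
  have qw: "q = c + T (diag a w)" by (simp add: z w_def ab)
  then have "norm w = 1" using q mem[of w] by (simp add: norm_eq_1)
  then obtain R :: "real^3 \<Rightarrow> real^3" where R: "orthogonal_transformation R" "R (axis 3 1) = w"
    using orthogonal_transformation_exists_1[of "axis 3 1" w] by (auto simp: norm_axis_1)
  define M where "M y = T (diag a (R y))" for y
  define M' where "M' x = inv R (diag b (inv T x))" for x
  have lin: "linear T" "linear R" "linear (inv T)" "linear (inv R)"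
    using T R orthogonal_transformation_inv orthogonal_transformation_linear by blast+
  show thesis
  proof
    show "bounded_linear M" "bounded_linear M'"
      unfolding M_def[abs_def] M'_def[abs_def]
      using lin linear_diag linear_compose[of _ T] linear_compose[of R "diag a"] linear_compose[of "inv T" "diag b"]
        linear_compose[of _ "inv R"]
      by (auto simp: o_def linear_conv_bounded_linear[symmetric])
    show "\<forall>y. M' (M y) = y"
      by (simp add: M_def M'_def orthogonal_transformation_inj[OF T] orthogonal_transformation_inj[OF R(1)] ab)
    show "\<forall>y. M (M' y) = y"
      by (simp add: M_def M'_def surj_f_inv_f[OF orthogonal_transformation_surj[OF T]]
          surj_f_inv_f[OF orthogonal_transformation_surj[OF R(1)]] ab)
    show "\<forall>y. c + M y \<in> ellipsoid c T a \<longleftrightarrow> y \<bullet> y = 1"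
      using R(1) by (simp add: M_def mem orthogonal_transformation_def)
    show "q = c + M (axis 3 1)" by (simp add: M_def R(2) qw)
  qed
qed

text \<open>Both halves of the theorem need an actual chart: the eigenflag condition demands one at
  each point, and a weight is tested only through charts.\<close>

lemma chart_exists:
  fixes V :: "((real^3) \<times> (real^3)) set"
  assumes T1: "orthogonal_transformation T1" and T2: "orthogonal_transformation T2"
    and a1: "\<And>i. a1 $ i > 0" and a2: "\<And>i. a2 $ i > 0"
    and V: "openin (top_of_set (ellipsoid c1 T1 a1 \<times> ellipsoid c2 T2 a2)) V" and q: "q \<in> V"
  obtains U and \<psi> :: "real^4 \<Rightarrow> (real^3) \<times> (real^3)" where "local_param V U \<psi>" "q \<in> \<psi> ` U"
proof -
  let ?S = "ellipsoid c1 T1 a1 \<times> ellipsoid c2 T2 a2"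
  obtain O' where O': "open O'" "V = ?S \<inter> O'" using V by (auto simp: openin_open)
  have "fst q \<in> ellipsoid c1 T1 a1" "snd q \<in> ellipsoid c2 T2 a2" using q O' by (auto simp: mem_Times_iff)
  obtain M1 M1' :: "real^3 \<Rightarrow> real^3" where M1: "bounded_linear M1" "bounded_linear M1'" "\<forall>y. M1' (M1 y) = y" "\<forall>y. M1 (M1' y) = y"
    "\<forall>y. c1 + M1 y \<in> ellipsoid c1 T1 a1 \<longleftrightarrow> y \<bullet> y = 1" "fst q = c1 + M1 (axis 3 1)"
    using ellipsoid_affine_sphere[OF T1 a1 \<open>fst q \<in> _\<close>] .
  obtain M2 M2' :: "real^3 \<Rightarrow> real^3" where M2: "bounded_linear M2" "bounded_linear M2'" "\<forall>y. M2' (M2 y) = y" "\<forall>y. M2 (M2' y) = y"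
    "\<forall>y. c2 + M2 y \<in> ellipsoid c2 T2 a2 \<longleftrightarrow> y \<bullet> y = 1" "snd q = c2 + M2 (axis 3 1)"
    using ellipsoid_affine_sphere[OF T2 a2 \<open>snd q \<in> _\<close>] .
  define \<psi> where "\<psi> p = (c1 + M1 (stereo 1 2 p), c2 + M2 (stereo 3 4 p))" for p
  define Y1 where "Y1 x = M1' (fst x - c1)" for x :: "(real^3) \<times> (real^3)"
  define Y2 where "Y2 x = M2' (snd x - c2)" for x :: "(real^3) \<times> (real^3)"
  \<comment> \<open>The inverse chart is given by a formula on the ambient space, differentiable on
    the open set \<open>P\<close> where its denominators are nonzero. The chain rule for \<theta>
    after \<psi> then yields injectivity of the derivative of \<psi>.\<close>
  define \<theta> :: "(real^3) \<times> (real^3) \<Rightarrow> real^4" where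
    "\<theta> x = (Y1 x $ 1 / (1 + Y1 x $ 3)) *\<^sub>R axis 1 1 + (Y1 x $ 2 / (1 + Y1 x $ 3)) *\<^sub>R axis 2 1
      + (Y2 x $ 1 / (1 + Y2 x $ 3)) *\<^sub>R axis 3 1 + (Y2 x $ 2 / (1 + Y2 x $ 3)) *\<^sub>R axis 4 1" for x
  define P where "P = {x. 1 + Y1 x $ 3 \<noteq> 0 \<and> 1 + Y2 x $ 3 \<noteq> 0}"
  have \<theta>_nth: "\<theta> x $ 1 = Y1 x $ 1 / (1 + Y1 x $ 3)" "\<theta> x $ 2 = Y1 x $ 2 / (1 + Y1 x $ 3)"
    "\<theta> x $ 3 = Y2 x $ 1 / (1 + Y2 x $ 3)" "\<theta> x $ 4 = Y2 x $ 2 / (1 + Y2 x $ 3)" for x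
    by (simp_all add: \<theta>_def axis_def)
  have Y\<psi>: "Y1 (\<psi> p) = stereo 1 2 p" "Y2 (\<psi> p) = stereo 3 4 p" for p
    by (simp_all add: Y1_def Y2_def \<psi>_def M1 M2)
  have \<theta>\<psi>: "\<theta> (\<psi> p) = p" for p
    by (simp add: vec_eq_iff forall_4 \<theta>_nth Y\<psi> stereo_left_inverse)
  have \<psi>S: "\<psi> p \<in> ?S" for p by (simp add: \<psi>_def M1 M2 stereo_unit)
  have \<psi>P: "\<psi> p \<in> P" for p
    using stereo_denominator[of "p $ 1" "p $ 2"] stereo_denominator[of "p $ 3" "p $ 4"]
    by (simp add: P_def Y\<psi> stereo_plus_one)
  have \<psi>\<theta>: "\<psi> (\<theta> x) = x" if x: "x \<in> ?S" "x \<in> P" for x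
  proof -
    have e: "fst x = c1 + M1 (Y1 x)" "snd x = c2 + M2 (Y2 x)" by (simp_all add: Y1_def Y2_def M1 M2)
    then have "c1 + M1 (Y1 x) \<in> ellipsoid c1 T1 a1" "c2 + M2 (Y2 x) \<in> ellipsoid c2 T2 a2"
      using x(1) by (auto simp: mem_Times_iff)
    then have u: "Y1 x \<bullet> Y1 x = 1" "Y2 x \<bullet> Y2 x = 1" by (simp_all add: M1 M2)
    have "stereo 1 2 (\<theta> x) = Y1 x" "stereo 3 4 (\<theta> x) = Y2 x"
      by (rule stereo_right_inverse; use u x(2) in \<open>simp add: P_def \<theta>_nth\<close>)+
    then show ?thesis using e by (simp add: \<psi>_def prod_eq_iff)
  qed
  have sm: "smooth_on UNIV \<psi>"
    unfolding \<psi>_def[abs_def]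
    by (intro smooth_on_Pair smooth_on_add smooth_on_const open_UNIV smooth_on_bounded_linear[OF open_UNIV M1(1)]
        smooth_on_bounded_linear[OF open_UNIV M2(1)] smooth_stereo)
  have dY: "Y1 differentiable (at x)" "Y2 differentiable (at x)" for x
    unfolding Y1_def[abs_def] Y2_def[abs_def]
    by (rule differentiableI, rule bounded_linear.has_derivative[OF M1(2)] bounded_linear.has_derivative[OF M2(2)],
        auto intro!: derivative_eq_intros)+
  have dYn: "(\<lambda>x. Y1 x $ i) differentiable (at x)" "(\<lambda>x. Y2 x $ i) differentiable (at x)" for x i
    using dY[of x] bounded_linear.has_derivative[OF bounded_linear_vec_nth] unfolding differentiable_def by blast+
  have d\<theta>: "\<theta> differentiable (at x)" if "x \<in> P" for x
    unfolding \<theta>_def[abs_def] using that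
    by (intro differentiable_add differentiable_scaleR differentiable_divide differentiable_const dYn)
      (auto simp: P_def)
  define U where "U = \<psi> -` O'"
  have U: "open U"
    using continuous_open_preimage[OF smooth_on_continuous[OF sm] open_UNIV O'(1)] by (simp add: U_def)
  have "local_param V U \<psi>"
    unfolding local_param_def
  proof (intro conjI ballI)
    show "open U" by (rule U)
    show "smooth_on U \<psi>" by (rule smooth_on_subset[OF sm]) simp
    show "inj (frechet_derivative \<psi> (at p))" if "p \<in> U" for p
    proof -
      have "frechet_derivative \<theta> (at (\<psi> p)) \<circ> frechet_derivative \<psi> (at p) = frechet_derivative (\<theta> \<circ> \<psi>) (at p)"
        by (rule frechet_derivative_compose[symmetric]) (auto intro: smooth_on_differentiable[OF sm] d\<theta> \<psi>P)
      also have "\<theta> \<circ> \<psi> = id" by (simp add: fun_eq_iff \<theta>\<psi>)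
      finally show ?thesis by (metis frechet_derivative_id inj_on_id inj_on_imageI2)
    qed
    show "\<exists>\<theta>. homeomorphism U (\<psi> ` U) \<psi> \<theta>"
    proof (intro exI[of _ \<theta>] homeomorphismI)
      show "continuous_on U \<psi>" using smooth_on_continuous[OF sm] continuous_on_subset by blast
      show "continuous_on (\<psi> ` U) \<theta>"
        by (intro continuous_at_imp_continuous_on ballI differentiable_imp_continuous_within d\<theta>) (auto simp: \<psi>P)
    qed (auto simp: \<theta>\<psi>)
    have "\<psi> ` U = V \<inter> P"
    proof (intro subset_antisym subsetI)
      show "x \<in> V \<inter> P" if "x \<in> \<psi> ` U" for x using that \<psi>S \<psi>P O'(2) by (auto simp: U_def)
      show "x \<in> \<psi> ` U" if x: "x \<in> V \<inter> P" for x
      proof (rule image_eqI)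
        show "x = \<psi> (\<theta> x)" using \<psi>\<theta>[of x] x O'(2) by simp
        then show "\<theta> x \<in> U" using x O'(2) by (simp add: U_def)
      qed
    qed
    moreover have "open P"
    proof -
      have cY: "continuous_on UNIV (\<lambda>x. 1 + Y1 x $ 3)" "continuous_on UNIV (\<lambda>x. 1 + Y2 x $ 3)"
        using dYn by (auto intro!: continuous_at_imp_continuous_on continuous_intros
            differentiable_imp_continuous_within)
      show ?thesis unfolding P_def by (intro open_Collect_conj open_Collect_neq cY continuous_on_const)
    qed
    ultimately show "openin (top_of_set V) (\<psi> ` U)" by (auto simp: openin_open)
  qed
  moreover have "q \<in> \<psi> ` U"
  proof (rule image_eqI)
    \<comment> \<open>The origin goes to the pole at which both components of \<open>q\<close> were
      placed.\<close>
    have "stereo i j 0 = axis 3 1" for i j by (simp add: stereo_def)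
    then show "q = \<psi> 0" by (simp add: \<psi>_def prod_eq_iff M1(6) M2(6))
    then show "0 \<in> U" using q O'(2) by (simp add: U_def)
  qed
  ultimately show thesis using that by blast
qed

theorem theorem1p8:
  fixes S1 S2 :: "(real^3) set" and V :: "((real^3) \<times> (real^3)) set"
  assumes "scalene_ellipsoid S1" and "scalene_ellipsoid S2"
    and "openin (top_of_set (S1 \<times> S2)) V" and "V \<noteq> {}"
  shows "eigenflag_condition TYPE(4) V (product_metric induced_metric induced_metric)
    \<and> \<not> (\<exists>\<phi>. limiting_carleman_weight TYPE(4) V (product_metric induced_metric induced_metric) \<phi>)"
proof -
  let ?g = "product_metric induced_metric induced_metric :: ((real^3) \<times> (real^3)) riem_metric"
  obtain c1 T1 a1 where 1: "orthogonal_transformation T1" "\<And>i. a1 $ i > 0"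
    "\<forall>i j. i \<noteq> j \<longrightarrow> a1 $ i \<noteq> a1 $ j" "S1 = ellipsoid c1 T1 a1"
    using assms(1) unfolding scalene_ellipsoid_def by blast
  obtain c2 T2 a2 where 2: "orthogonal_transformation T2" "\<And>i. a2 $ i > 0"
    "\<forall>i j. i \<noteq> j \<longrightarrow> a2 $ i \<noteq> a2 $ j" "S2 = ellipsoid c2 T2 a2"
    using assms(2) unfolding scalene_ellipsoid_def by blast
  have V: "openin (top_of_set (ellipsoid c1 T1 a1 \<times> ellipsoid c2 T2 a2)) V"
    using assms(3) 1(4) 2(4) by simp
  note chart = chart_exists[OF 1(1) 2(1) 1(2) 2(2) V]
  note std = standardized_chart[OF 1(1) 2(1) 1(2,3) 2(2,3) openin_imp_subset[OF V]]
  have eigenflag: "eigenflag_at (pullback_metric ?g \<psi>) p" if lp: "local_param V U \<psi>" and p: "p \<in> U"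
    for U and \<psi> :: "real^4 \<Rightarrow> (real^3) \<times> (real^3)" and p
  proof -
    interpret ellipsoid_pair U "\<lambda>p. inv T1 (fst (\<psi> p) - c1)" "\<lambda>p. inv T2 (snd (\<psi> p) - c2)" "inv_sq a1" "inv_sq a2"
      by (rule std(1)[OF lp])
    show ?thesis using eigenflag_at_cong[OF open_U std(2)[OF lp] p] eigenflag_at_gram[OF p] by simp
  qed
  have "eigenflag_condition TYPE(4) V ?g"
    unfolding eigenflag_condition_def
  proof (intro ballI conjI allI impI)
    fix q assume "q \<in> V"
    then obtain U and \<psi> :: "real^4 \<Rightarrow> (real^3) \<times> (real^3)" where "local_param V U \<psi>" "q \<in> \<psi> ` U"
      using chart by blast
    then show "\<exists>U (\<psi> :: real^4 \<Rightarrow> (real^3) \<times> (real^3)). local_param V U \<psi> \<and> q \<in> \<psi> ` U" by blast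
  qed (use eigenflag in blast)
  moreover have False if w: "limiting_carleman_weight TYPE(4) V ?g \<phi>" for \<phi>
  proof -
    obtain q where "q \<in> V" using assms(4) by blast
    then obtain U and \<psi> :: "real^4 \<Rightarrow> (real^3) \<times> (real^3)" where lp: "local_param V U \<psi>" and "q \<in> \<psi> ` U"
      using chart by blast
    interpret ellipsoid_pair U "\<lambda>p. inv T1 (fst (\<psi> p) - c1)" "\<lambda>p. inv T2 (snd (\<psi> p) - c2)" "inv_sq a1" "inv_sq a2"
      by (rule std(1)[OF lp])
    have f: "smooth_on U (\<phi> \<circ> \<psi>)" "\<And>p. p \<in> U \<Longrightarrow> carleman_at (pullback_metric ?g \<psi>) (\<phi> \<circ> \<psi>) p"
      using w lp unfolding limiting_carleman_weight_def by blast+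
    have "carleman_pair U (\<lambda>p. inv T1 (fst (\<psi> p) - c1)) (\<lambda>p. inv T2 (snd (\<psi> p) - c2)) (inv_sq a1) (inv_sq a2) (\<phi> \<circ> \<psi>)"
      by unfold_locales (use f carleman_at_cong[OF open_U std(2)[OF lp]] in auto)
    then have "U = {}"
      by (rule carleman_pair_domain_empty) (use inv_sq_props(2)[OF 1(2,3)] inv_sq_props(2)[OF 2(2,3)] in auto)
    then show False using \<open>q \<in> \<psi> ` U\<close> by simp
  qed
  ultimately show ?thesis by blast
qed

end
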